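(* Let $A$ be a finite abelian group. For every positive integer $N$, every irreducible representation $V$ of the quantum double $D(S_N\ltimes A^N)$ over $\mathbb{C}$, and every positive integer $n$, the higher Frobenius-Schur indicator $\nu_n(V)$ is an integer.
   Context: $S_N\ltimes A^N$ is the wreath product group: the semidirect product in which the symmetric group $S_N$ acts on $A^N$ by permuting the coordinates. Quantum double. For a finite group $G$, the quantum double $D(G)$ is the semisimple Hopf algebra over $\mathbb{C}$ with basis $g\delta_x$ ($g,x\in G$). It contains the group algebra $\mathbb{C}[G]$ and the algebra of functions $\mathrm{Fun}(G,\mathbb{C})$ (spanned by the delta functions $\delta_x$, with $\delta_x(y)=1$ if $x=y$ and $0$ otherwise, so that $\delta_x\delta_y=\delta_x(y)\,\delta_x$ and $\sum_x\delta_x=1$) as subalgebras, with the relation $g\delta_x g^{-1}=\delta_{gxg^{-1}}$. The coproduct is given by $\Delta(g)=g\otimes g$ and $\Delta(\delta_x)=\sum_{ab=x}\delta_a\otimes\delta_b$. The counit is given by $\varepsilon(g)=1$ and $\varepsilon(\delta_x)=1$ if $x=1$, and $0$ otherwise. The antipode is given by $g\mapsto g^{-1}$, $\delta_x\mapsto\delta_{x^{-1}}$ (extended as an anti-homomorphism). Higher Frobenius-Schur indicators. Let $H$ be a semisimple Hopf algebra over $\mathbb{C}$ and let $\Lambda\in H$ be the left integral with $\varepsilon(\Lambda)=1$ (i.e. $h\Lambda=\varepsilon(h)\Lambda$ for all $h\in H$). For an irreducible $H$-module $V$ and a positive integer $n$, one sets $$\nu_n(V)=\mathrm{Tr}_V(\Lambda_1\Lambda_2\cdots\Lambda_n),$$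 where $\Lambda_1\otimes\cdots\otimes\Lambda_n=\Delta_n(\Lambda)\in H^{\otimes n}$ is the iterated coproduct of $\Lambda$ (Sweedler notation, summation implied). For $H=D(G)$ one has $\Lambda=|G|^{-1}\big(\sum_{g\in G}g\big)\delta_1$. *)

theory Defs
  imports Complex_Main "HOL-Algebra.Sym_Groups" "HOL-Algebra.Product_Groups"
begin

section \<open>Wreath products\<close>

text \<open>
  The pair \<open>(h, k)\<close> stands for the product \<open>h k\<close>, with \<open>h k h\<^sup>-\<^sup>1 = \<phi> h k\<close>; hence
  \<open>(h k) (h' k') = (h h') ((\<phi> h'\<^sup>-\<^sup>1 k) k')\<close>.
\<close>

definition semidirect_product ::
  "('h, 'm) monoid_scheme \<Rightarrow> ('k, 'n) monoid_scheme \<Rightarrow> ('h \<Rightarrow> 'k \<Rightarrow> 'k) \<Rightarrow> ('h \<times> 'k) monoid"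
where
  "semidirect_product H K \<phi> =
    \<lparr>carrier = carrier H \<times> carrier K,
     mult = (\<lambda>(h, k) (h', k'). (h \<otimes>\<^bsub>H\<^esub> h', \<phi> (inv\<^bsub>H\<^esub> h') k \<otimes>\<^bsub>K\<^esub> k')),
     one = (\<one>\<^bsub>H\<^esub>, \<one>\<^bsub>K\<^esub>)\<rparr>"

definition permute_coords :: "nat \<Rightarrow> (nat \<Rightarrow> nat) \<Rightarrow> (nat \<Rightarrow> 'a) \<Rightarrow> nat \<Rightarrow> 'a" where
  "permute_coords N \<sigma> a = (\<lambda>i\<in>{1..N}. a (inv' \<sigma> i))"

definition wreath_product ::
  "nat \<Rightarrow> ('a, 'm) monoid_scheme \<Rightarrow> ((nat \<Rightarrow> nat) \<times> (nat \<Rightarrow> 'a)) monoid"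
where
  "wreath_product N A =
    semidirect_product (sym_group N) (product_group {1..N} (\<lambda>_. A)) (permute_coords N)"


lemma semidirect_product_group:
  assumes H: "group H" and K: "group K"
    and hom: "\<And>h. h \<in> carrier H \<Longrightarrow> \<phi> h \<in> hom K K"
    and act: "\<And>h h' k. h \<in> carrier H \<Longrightarrow> h' \<in> carrier H \<Longrightarrow> k \<in> carrier K \<Longrightarrow>
      \<phi> (h \<otimes>\<^bsub>H\<^esub> h') k = \<phi> h (\<phi> h' k)"
    and act_one: "\<And>k. k \<in> carrier K \<Longrightarrow> \<phi> \<one>\<^bsub>H\<^esub> k = k"
  shows "group (semidirect_product H K \<phi>)"
proof -
  interpret H: group H by fact
  interpret K: group K by fact
  have cl: "\<phi> h k \<in> carrier K" if "h \<in> carrier H" "k \<in> carrier K" for h k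
    using hom[OF that(1)] that(2) by (auto simp: hom_def)
  have mu: "\<phi> h (k \<otimes>\<^bsub>K\<^esub> k') = \<phi> h k \<otimes>\<^bsub>K\<^esub> \<phi> h k'"
    if "h \<in> carrier H" "k \<in> carrier K" "k' \<in> carrier K" for h k k'
    using hom[OF that(1)] that(2,3) by (auto simp: hom_def)
  have on: "\<phi> h \<one>\<^bsub>K\<^esub> = \<one>\<^bsub>K\<^esub>" if "h \<in> carrier H" for h
    using hom_one[OF hom[OF that] K K] .
  show ?thesis
  proof (rule groupI)
    fix x assume "x \<in> carrier (semidirect_product H K \<phi>)"
    then obtain h k where x: "x = (h, k)" "h \<in> carrier H" "k \<in> carrier K"
      by (auto simp: semidirect_product_def)
    show "\<exists>y\<in>carrier (semidirect_product H K \<phi>).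
        y \<otimes>\<^bsub>semidirect_product H K \<phi>\<^esub> x = \<one>\<^bsub>semidirect_product H K \<phi>\<^esub>"
      using x
      by (intro bexI[of _ "(inv\<^bsub>H\<^esub> h, \<phi> h (inv\<^bsub>K\<^esub> k))"])
         (simp_all add: semidirect_product_def cl act[symmetric] act_one)
  qed (auto simp: semidirect_product_def cl mu act act_one on H.m_assoc K.m_assoc
         H.inv_mult_group)
qed

lemma wreath_product_group:
  assumes "group A"
  shows "group (wreath_product N A)"
proof -
  interpret A: group A by fact
  show ?thesis
    unfolding wreath_product_def
  proof (rule semidirect_product_group)
    show "group (sym_group N)" by (rule sym_group_is_group)
    show "group (product_group {1..N} (\<lambda>_. A))" using assms by simp
  next
    fix h assume "h \<in> carrier (sym_group N)"
    then have "inv' h permutes {1..N}"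
      by (simp add: sym_group_def permutes_inv)
    from permutes_in_image[OF this]
    show "permute_coords N h \<in> hom (product_group {1..N} (\<lambda>_. A)) (product_group {1..N} (\<lambda>_. A))"
      by (auto simp: hom_def permute_coords_def PiE_iff fun_eq_iff)
  next
    fix h h' and k :: "nat \<Rightarrow> 'a"
    assume "h \<in> carrier (sym_group N)" "h' \<in> carrier (sym_group N)"
    then have p: "h permutes {1..N}" "h' permutes {1..N}"
      by (simp_all add: sym_group_def)
    have "inv' (h \<circ> h') = inv' h' \<circ> inv' h"
      using p by (simp add: permutes_bij o_inv_distrib)
    with permutes_in_image[OF permutes_inv[OF p(1)]]
    show "permute_coords N (h \<otimes>\<^bsub>sym_group N\<^esub> h') k = permute_coords N h (permute_coords N h' k)"
      by (auto simp: permute_coords_def sym_group_def fun_eq_iff)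
  next
    fix k assume "k \<in> carrier (product_group {1..N} (\<lambda>_. A))"
    then show "permute_coords N \<one>\<^bsub>sym_group N\<^esub> k = k"
      by (auto simp: permute_coords_def sym_group_def fun_eq_iff PiE_def extensional_def)
  qed
qed


section \<open>Finite-dimensional Hopf algebras over the complex numbers\<close>

text \<open>
  A finite-dimensional Hopf algebra is presented by a finite basis \<open>B\<close> together with its structure
  constants: \<open>mult_coeff H b c d\<close> is the coefficient of \<open>d\<close> in \<open>b c\<close>, \<open>comult_coeff H b c d\<close> is the
  coefficient of \<open>c \<otimes> d\<close> in \<open>\<Delta>(b)\<close>, and \<open>antipode_coeff H b c\<close> is the coefficient of \<open>c\<close> in
  \<open>S(b)\<close>. An element is a coefficient function that vanishes outside \<open>B\<close>, and an element of the
  \<open>n\<close>-th tensor power is a coefficient function on lists of length \<open>n\<close> over \<open>B\<close>, the list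
  \<open>[b\<^sub>1, \<dots>, b\<^sub>n]\<close> standing for \<open>b\<^sub>1 \<otimes> \<dots> \<otimes> b\<^sub>n\<close>. The record only holds the data; it does not
  impose the Hopf algebra axioms.
\<close>

record 'b hopf_data =
  hopf_basis :: "'b set"
  mult_coeff :: "'b \<Rightarrow> 'b \<Rightarrow> 'b \<Rightarrow> complex"
  unit_coeff :: "'b \<Rightarrow> complex"
  comult_coeff :: "'b \<Rightarrow> 'b \<Rightarrow> 'b \<Rightarrow> complex"
  counit_coeff :: "'b \<Rightarrow> complex"
  antipode_coeff :: "'b \<Rightarrow> 'b \<Rightarrow> complex"

definition hopf_elems :: "'b hopf_data \<Rightarrow> ('b \<Rightarrow> complex) set" where
  "hopf_elems H = {u. \<forall>b. b \<notin> hopf_basis H \<longrightarrow> u b = 0}"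

definition basis_elem :: "'b \<Rightarrow> 'b \<Rightarrow> complex" where
  "basis_elem b = (\<lambda>c. if c = b then 1 else 0)"

definition hopf_mult ::
  "'b hopf_data \<Rightarrow> ('b \<Rightarrow> complex) \<Rightarrow> ('b \<Rightarrow> complex) \<Rightarrow> 'b \<Rightarrow> complex"
where
  "hopf_mult H u v = (\<lambda>d. if d \<in> hopf_basis H
     then \<Sum>b\<in>hopf_basis H. \<Sum>c\<in>hopf_basis H. u b * v c * mult_coeff H b c d else 0)"

definition hopf_one :: "'b hopf_data \<Rightarrow> 'b \<Rightarrow> complex" where
  "hopf_one H = (\<lambda>b. if b \<in> hopf_basis H then unit_coeff H b else 0)"

definition hopf_counit :: "'b hopf_data \<Rightarrow> ('b \<Rightarrow> complex) \<Rightarrow> complex" where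
  "hopf_counit H u = (\<Sum>b\<in>hopf_basis H. u b * counit_coeff H b)"

text \<open>
  \<open>\<Delta>\<^sub>1 = id\<close> and \<open>\<Delta>\<^sub>n\<^sub>+\<^sub>1 = (\<Delta> \<otimes> id \<otimes> \<dots> \<otimes> id) \<circ> \<Delta>\<^sub>n\<close>, so that \<open>\<Delta>\<^sub>2 = \<Delta>\<close>; by convention
  \<open>\<Delta>\<^sub>0 = \<epsilon>\<close>.
\<close>

fun iterated_comult ::
  "'b hopf_data \<Rightarrow> nat \<Rightarrow> ('b \<Rightarrow> complex) \<Rightarrow> 'b list \<Rightarrow> complex"
where
  "iterated_comult H 0 u [] = hopf_counit H u"
| "iterated_comult H (Suc 0) u [b] = u b"
| "iterated_comult H (Suc (Suc n)) u (b # c # bs) =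
     (\<Sum>d\<in>hopf_basis H. iterated_comult H (Suc n) u (d # bs) * comult_coeff H d b c)"
| "iterated_comult H _ u _ = 0"

text \<open>The linear map from the \<open>n\<close>-th tensor power to \<open>H\<close> with
  \<open>b\<^sub>1 \<otimes> \<dots> \<otimes> b\<^sub>n \<mapsto> b\<^sub>1 \<cdots> b\<^sub>n\<close>.\<close>

definition tensor_mult ::
  "'b hopf_data \<Rightarrow> nat \<Rightarrow> ('b list \<Rightarrow> complex) \<Rightarrow> 'b \<Rightarrow> complex"
where
  "tensor_mult H n t = (\<lambda>d. \<Sum>bs | length bs = n \<and> set bs \<subseteq> hopf_basis H.
     t bs * foldr (hopf_mult H) (map basis_elem bs) (hopf_one H) d)"

definition normalized_left_integral :: "'b hopf_data \<Rightarrow> ('b \<Rightarrow> complex) \<Rightarrow> bool" where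
  "normalized_left_integral H \<Lambda> \<longleftrightarrow>
     \<Lambda> \<in> hopf_elems H \<and>
     (\<forall>h\<in>hopf_elems H. hopf_mult H h \<Lambda> = (\<lambda>b. hopf_counit H h * \<Lambda> b)) \<and>
     hopf_counit H \<Lambda> = 1"

definition hopf_integral :: "'b hopf_data \<Rightarrow> 'b \<Rightarrow> complex" where
  "hopf_integral H = (THE \<Lambda>. normalized_left_integral H \<Lambda>)"


section \<open>Irreducible modules and higher Frobenius-Schur indicators\<close>

text \<open>The trace does not depend on the chosen basis.
  It is only meaningful on finite-dimensional spaces.\<close>

definition (in vector_space) lin_trace :: "('b \<Rightarrow> 'b) \<Rightarrow> 'a" where
  "lin_trace f =
     (let B = (SOME B. independent B \<and> span B = UNIV) in \<Sum>b\<in>B. representation B (f b) b)"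

locale hopf_module = vector_space scale
  for H :: "'b hopf_data"
    and scale :: "complex \<Rightarrow> 'v::ab_group_add \<Rightarrow> 'v"
    and \<rho> :: "('b \<Rightarrow> complex) \<Rightarrow> 'v \<Rightarrow> 'v" +
  assumes action_linear: "u \<in> hopf_elems H \<Longrightarrow> Vector_Spaces.linear scale scale (\<rho> u)"
    and action_add: "u \<in> hopf_elems H \<Longrightarrow> w \<in> hopf_elems H \<Longrightarrow>
      \<rho> (\<lambda>b. u b + w b) v = \<rho> u v + \<rho> w v"
    and action_scale: "u \<in> hopf_elems H \<Longrightarrow> \<rho> (\<lambda>b. c * u b) v = scale c (\<rho> u v)"
    and action_mult: "u \<in> hopf_elems H \<Longrightarrow> w \<in> hopf_elems H \<Longrightarrow>
      \<rho> (hopf_mult H u w) v = \<rho> u (\<rho> w v)"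
    and action_one: "\<rho> (hopf_one H) v = v"

text \<open>Over a finite-dimensional \<open>H\<close>, irreducibility forces the module to be finite-dimensional,
  since it is spanned by the orbit of any nonzero vector.\<close>

locale irreducible_hopf_module = hopf_module H scale \<rho>
  for H :: "'b hopf_data"
    and scale :: "complex \<Rightarrow> 'v::ab_group_add \<Rightarrow> 'v"
    and \<rho> :: "('b \<Rightarrow> complex) \<Rightarrow> 'v \<Rightarrow> 'v" +
  assumes nonzero: "\<exists>v::'v. v \<noteq> 0"
    and irreducible: "subspace W \<Longrightarrow> (\<And>u w. u \<in> hopf_elems H \<Longrightarrow> w \<in> W \<Longrightarrow> \<rho> u w \<in> W) \<Longrightarrow>
      W = {0} \<or> W = UNIV"

definition fs_indicator ::
  "'b hopf_data \<Rightarrow> (complex \<Rightarrow> 'v::ab_group_add \<Rightarrow> 'v) \<Rightarrow> (('b \<Rightarrow> complex) \<Rightarrow> 'v \<Rightarrow> 'v) \<Rightarrow>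
    nat \<Rightarrow> complex"
where
  "fs_indicator H scale \<rho> n =
     vector_space.lin_trace scale (\<rho> (tensor_mult H n (iterated_comult H n (hopf_integral H))))"


section \<open>The quantum double of a finite group\<close>

text \<open>
  The basis element \<open>(g, x)\<close> stands for \<open>g \<delta>\<^sub>x\<close>. From \<open>\<delta>\<^sub>x h = h \<delta>\<^bsub>h\<^sup>-\<^sup>1 x h\<^esub>\<close> one gets
  \<open>(g \<delta>\<^sub>x) (h \<delta>\<^sub>y) = g h \<delta>\<^sub>y\<close> if \<open>h\<^sup>-\<^sup>1 x h = y\<close>, and \<open>0\<close> otherwise; the coproduct is
  \<open>\<Delta>(g \<delta>\<^sub>x) = \<Sum>\<^bsub>ab=x\<^esub> g \<delta>\<^sub>a \<otimes> g \<delta>\<^sub>b\<close>; and the antipode is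
  \<open>S(g \<delta>\<^sub>x) = S(\<delta>\<^sub>x) S(g) = \<delta>\<^bsub>x\<^sup>-\<^sup>1\<^esub> g\<^sup>-\<^sup>1 = g\<^sup>-\<^sup>1 \<delta>\<^bsub>g x\<^sup>-\<^sup>1 g\<^sup>-\<^sup>1\<^esub>\<close>.
\<close>

definition quantum_double :: "('g, 'm) monoid_scheme \<Rightarrow> ('g \<times> 'g) hopf_data" where
  "quantum_double G =
    \<lparr>hopf_basis = carrier G \<times> carrier G,
     mult_coeff = (\<lambda>(g, x) (h, y) (k, z).
       if inv\<^bsub>G\<^esub> h \<otimes>\<^bsub>G\<^esub> x \<otimes>\<^bsub>G\<^esub> h = y \<and> k = g \<otimes>\<^bsub>G\<^esub> h \<and> z = y then 1 else 0),
     unit_coeff = (\<lambda>(g, x). if g = \<one>\<^bsub>G\<^esub> then 1 else 0),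
     comult_coeff = (\<lambda>(g, x) (h, a) (k, b).
       if h = g \<and> k = g \<and> a \<otimes>\<^bsub>G\<^esub> b = x then 1 else 0),
     counit_coeff = (\<lambda>(g, x). if x = \<one>\<^bsub>G\<^esub> then 1 else 0),
     antipode_coeff = (\<lambda>(g, x) (h, y).
       if h = inv\<^bsub>G\<^esub> g \<and> y = g \<otimes>\<^bsub>G\<^esub> inv\<^bsub>G\<^esub> x \<otimes>\<^bsub>G\<^esub> inv\<^bsub>G\<^esub> g then 1 else 0)\<rparr>"

text \<open>The integral singled out by \<open>THE\<close> above exists and is
  \<open>|G|\<^sup>-\<^sup>1 (\<Sum>\<^sub>g g) \<delta>\<^sub>1\<close>.\<close>

lemma quantum_double_integral:
  assumes "group G" and fin: "finite (carrier G)"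
  defines "\<Lambda> \<equiv> (\<lambda>(g, x). if g \<in> carrier G \<and> x = \<one>\<^bsub>G\<^esub> then 1 / of_nat (card (carrier G)) else 0)"
  shows "normalized_left_integral (quantum_double G) \<Lambda>"
    and "hopf_integral (quantum_double G) = \<Lambda>"
proof -
  interpret group G by fact
  let ?C = "carrier G"
  let ?n = "of_nat (card ?C) :: complex"
  have n: "?n \<noteq> 0" using fin by (auto simp: card_eq_0_iff)
  have mult: "hopf_mult (quantum_double G) u v (k, z) =
      (\<Sum>h\<in>?C. u (k \<otimes>\<^bsub>G\<^esub> inv\<^bsub>G\<^esub> h, h \<otimes>\<^bsub>G\<^esub> z \<otimes>\<^bsub>G\<^esub> inv\<^bsub>G\<^esub> h) * v (h, z))"
    if kz: "k \<in> ?C" "z \<in> ?C" for u v k z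
  proof -
    have "hopf_mult (quantum_double G) u v (k, z) =
       (\<Sum>p\<in>?C \<times> ?C. \<Sum>q\<in>?C \<times> ?C. u p * v q * mult_coeff (quantum_double G) p q (k, z))"
      using kz by (simp add: hopf_mult_def quantum_double_def)
    also have "\<dots> = (\<Sum>q\<in>?C \<times> ?C. \<Sum>p\<in>?C \<times> ?C. u p * v q * mult_coeff (quantum_double G) p q (k, z))"
      by (rule sum.swap)
    also have "\<dots> = (\<Sum>q\<in>?C \<times> ?C. if snd q = z then
        u (k \<otimes>\<^bsub>G\<^esub> inv\<^bsub>G\<^esub> fst q, fst q \<otimes>\<^bsub>G\<^esub> z \<otimes>\<^bsub>G\<^esub> inv\<^bsub>G\<^esub> fst q) * v q else 0)"
    proof (intro sum.cong refl)
      fix q assume "q \<in> ?C \<times> ?C"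
      then obtain h y where q: "q = (h, y)" "h \<in> ?C" "y \<in> ?C" by auto
      have "(\<Sum>p\<in>?C \<times> ?C. u p * v q * mult_coeff (quantum_double G) p q (k, z)) =
        (\<Sum>p\<in>?C \<times> ?C. if p = (k \<otimes>\<^bsub>G\<^esub> inv\<^bsub>G\<^esub> h, h \<otimes>\<^bsub>G\<^esub> z \<otimes>\<^bsub>G\<^esub> inv\<^bsub>G\<^esub> h) then (if y = z then u p * v q else 0) else 0)"
      proof (intro sum.cong refl)
        fix p assume "p \<in> ?C \<times> ?C"
        then obtain g x where p: "p = (g, x)" "g \<in> ?C" "x \<in> ?C" by auto
        have "inv\<^bsub>G\<^esub> h \<otimes>\<^bsub>G\<^esub> x \<otimes>\<^bsub>G\<^esub> h = z \<longleftrightarrow> x = h \<otimes>\<^bsub>G\<^esub> z \<otimes>\<^bsub>G\<^esub> inv\<^bsub>G\<^esub> h"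
          using p q kz by (metis inv_closed inv_solve_left inv_solve_right m_assoc m_closed)
        moreover have "k = g \<otimes>\<^bsub>G\<^esub> h \<longleftrightarrow> g = k \<otimes>\<^bsub>G\<^esub> inv\<^bsub>G\<^esub> h"
          using p q kz by (metis inv_solve_right)
        ultimately show "u p * v q * mult_coeff (quantum_double G) p q (k, z) =
          (if p = (k \<otimes>\<^bsub>G\<^esub> inv\<^bsub>G\<^esub> h, h \<otimes>\<^bsub>G\<^esub> z \<otimes>\<^bsub>G\<^esub> inv\<^bsub>G\<^esub> h) then (if y = z then u p * v q else 0) else 0)"
          using p q by (auto simp: quantum_double_def)
      qed
      also have "\<dots> = (if snd q = z then
          u (k \<otimes>\<^bsub>G\<^esub> inv\<^bsub>G\<^esub> fst q, fst q \<otimes>\<^bsub>G\<^esub> z \<otimes>\<^bsub>G\<^esub> inv\<^bsub>G\<^esub> fst q) * v q else 0)"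
        using fin kz q by (simp add: sum.delta)
      finally show "(\<Sum>p\<in>?C \<times> ?C. u p * v q * mult_coeff (quantum_double G) p q (k, z)) = \<dots>" .
    qed
    also have "\<dots> = (\<Sum>h\<in>?C. \<Sum>y\<in>?C. if y = z then
        u (k \<otimes>\<^bsub>G\<^esub> inv\<^bsub>G\<^esub> h, h \<otimes>\<^bsub>G\<^esub> y \<otimes>\<^bsub>G\<^esub> inv\<^bsub>G\<^esub> h) * v (h, y) else 0)"
      by (subst sum.cartesian_product, rule sum.cong) auto
    also have "\<dots> = (\<Sum>h\<in>?C. u (k \<otimes>\<^bsub>G\<^esub> inv\<^bsub>G\<^esub> h, h \<otimes>\<^bsub>G\<^esub> z \<otimes>\<^bsub>G\<^esub> inv\<^bsub>G\<^esub> h) * v (h, z))"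
      using fin kz by (simp add: sum.delta)
    finally show ?thesis .
  qed
  have counit: "hopf_counit (quantum_double G) u = (\<Sum>g\<in>?C. u (g, \<one>\<^bsub>G\<^esub>))" for u
  proof -
    have "hopf_counit (quantum_double G) u = (\<Sum>g\<in>?C. \<Sum>x\<in>?C. if x = \<one>\<^bsub>G\<^esub> then u (g, x) else 0)"
      by (subst sum.cartesian_product)
        (auto simp: hopf_counit_def quantum_double_def intro!: sum.cong)
    also have "\<dots> = (\<Sum>g\<in>?C. u (g, \<one>\<^bsub>G\<^esub>))"
      using fin by (simp add: sum.delta)
    finally show ?thesis .
  qed
  have elems: "u (g, x) = 0" if "u \<in> hopf_elems (quantum_double G)" "\<not> (g \<in> ?C \<and> x \<in> ?C)" for u g x
    using that by (auto simp: hopf_elems_def quantum_double_def)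
  have off: "hopf_mult (quantum_double G) u v (g, x) = 0" if "\<not> (g \<in> ?C \<and> x \<in> ?C)" for u v g x
    using that by (auto simp: hopf_mult_def quantum_double_def)
  have lam_in: "\<Lambda> \<in> hopf_elems (quantum_double G)"
    by (auto simp: hopf_elems_def quantum_double_def \<Lambda>_def)
  have reidx: "(\<Sum>h\<in>?C. f (k \<otimes>\<^bsub>G\<^esub> inv\<^bsub>G\<^esub> h)) = (\<Sum>h\<in>?C. f h)" if "k \<in> ?C" for f :: "_ \<Rightarrow> complex" and k
    by (rule sum.reindex_bij_witness[of _ "\<lambda>h. inv\<^bsub>G\<^esub> h \<otimes>\<^bsub>G\<^esub> k" "\<lambda>h. k \<otimes>\<^bsub>G\<^esub> inv\<^bsub>G\<^esub> h"])
       (use that in \<open>auto simp: inv_mult_group m_assoc[symmetric] inv_solve_right' m_assoc\<close>)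
  have left: "hopf_mult (quantum_double G) h \<Lambda> = (\<lambda>b. hopf_counit (quantum_double G) h * \<Lambda> b)"
    if "h \<in> hopf_elems (quantum_double G)" for h
  proof (rule ext, clarify)
    fix k z
    show "hopf_mult (quantum_double G) h \<Lambda> (k, z) = hopf_counit (quantum_double G) h * \<Lambda> (k, z)"
    proof (cases "k \<in> ?C \<and> z = \<one>\<^bsub>G\<^esub>")
      case True
      then have "hopf_mult (quantum_double G) h \<Lambda> (k, z) = (\<Sum>g\<in>?C. h (k \<otimes>\<^bsub>G\<^esub> inv\<^bsub>G\<^esub> g, \<one>\<^bsub>G\<^esub>)) * (1 / ?n)"
        by (simp add: mult \<Lambda>_def sum_divide_distrib)
      with True show ?thesis by (simp add: reidx[of k "\<lambda>g. h (g, \<one>\<^bsub>G\<^esub>)"] counit \<Lambda>_def)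
    next
      case False
      then show ?thesis
        by (cases "k \<in> ?C \<and> z \<in> ?C") (auto simp: mult off \<Lambda>_def)
    qed
  qed
  have one: "hopf_counit (quantum_double G) \<Lambda> = 1"
    using n by (simp add: counit \<Lambda>_def)
  show norm: "normalized_left_integral (quantum_double G) \<Lambda>"
    using lam_in left one by (simp add: normalized_left_integral_def)
  show "hopf_integral (quantum_double G) = \<Lambda>"
    unfolding hopf_integral_def
  proof (rule the_equality, rule norm)
    fix L assume L: "normalized_left_integral (quantum_double G) L"
    then have Lin: "L \<in> hopf_elems (quantum_double G)" and L1: "(\<Sum>g\<in>?C. L (g, \<one>\<^bsub>G\<^esub>)) = 1"
      and LL: "hopf_mult (quantum_double G) \<Lambda> L = L"
      using lam_in one by (auto simp: normalized_left_integral_def counit)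
    show "L = \<Lambda>"
    proof (rule ext, clarify)
      fix k z
      show "L (k, z) = \<Lambda> (k, z)"
      proof (cases "k \<in> ?C \<and> z \<in> ?C")
        case False
        then show ?thesis using elems[OF Lin] elems[OF lam_in] by metis
      next
        case True
        then have "L (k, z) = (\<Sum>h\<in>?C. \<Lambda> (k \<otimes>\<^bsub>G\<^esub> inv\<^bsub>G\<^esub> h, h \<otimes>\<^bsub>G\<^esub> z \<otimes>\<^bsub>G\<^esub> inv\<^bsub>G\<^esub> h) * L (h, z))"
          using LL mult[of k z \<Lambda> L] by simp
        also have "\<dots> = (\<Sum>h\<in>?C. (if z = \<one>\<^bsub>G\<^esub> then 1 / ?n else 0) * L (h, z))"
        proof (intro sum.cong refl)
          fix h assume h: "h \<in> ?C"
          have "h \<otimes>\<^bsub>G\<^esub> z \<otimes>\<^bsub>G\<^esub> inv\<^bsub>G\<^esub> h = \<one>\<^bsub>G\<^esub> \<longleftrightarrow> z = \<one>\<^bsub>G\<^esub>"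
          proof
            assume "h \<otimes>\<^bsub>G\<^esub> z \<otimes>\<^bsub>G\<^esub> inv\<^bsub>G\<^esub> h = \<one>\<^bsub>G\<^esub>"
            then have "h \<otimes>\<^bsub>G\<^esub> z = h"
              using h True inv_solve_right'[of "h \<otimes>\<^bsub>G\<^esub> z" "\<one>\<^bsub>G\<^esub>" h] inv_equality
              by (metis inv_closed inv_inv m_closed)
            then show "z = \<one>\<^bsub>G\<^esub>" using h True by simp
          qed (use h in simp)
          then show "\<Lambda> (k \<otimes>\<^bsub>G\<^esub> inv\<^bsub>G\<^esub> h, h \<otimes>\<^bsub>G\<^esub> z \<otimes>\<^bsub>G\<^esub> inv\<^bsub>G\<^esub> h) * L (h, z) = (if z = \<one>\<^bsub>G\<^esub> then 1 / ?n else 0) * L (h, z)"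
            using h True by (simp add: \<Lambda>_def)
        qed
        also have "\<dots> = \<Lambda> (k, z)"
          using True L1 by (auto simp: \<Lambda>_def sum_distrib_left[symmetric])
        finally show ?thesis .
      qed
    qed
  qed
qed

end

theory Submission
  imports Defs "HOL-Algebra.Multiplicative_Group" "HOL-Algebra.Generated_Groups"
    "Jordan_Normal_Form.Schur_Decomposition"
begin

text \<open>
  Let \<open>G\<close> be a finite group and \<open>V\<close> a finite-dimensional module over \<open>D(G)\<close>. Expanding the iterated
  coproduct of \<open>\<Lambda>\<close> gives
  \<open>\<nu>\<^sub>n(V) = |G|\<^sup>-\<^sup>1 \<Sum> Tr (g \<delta>\<^bsub>x\<^sub>1\<^esub> \<cdots> g \<delta>\<^bsub>x\<^sub>n\<^esub>)\<close>, the sum running over \<open>g\<close> and over all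
  words with \<open>x\<^sub>1 \<cdots> x\<^sub>n = 1\<close>. Two different readings of this sum give two different arithmetic facts,
  which together force an integer.

  The number is an algebraic integer (\<open>indicator_sum_algebraic_int\<close>). On \<open>V\<^sup>\<otimes>\<^sup>n\<close> the element
  \<open>\<Delta>\<^sub>n(\<Lambda>)\<close> acts as a projection \<open>P\<close> that commutes with the cyclic shift \<open>E\<close> of the tensor factors,
  and \<open>\<nu>\<^sub>n(V) = Tr (P E)\<close>. As \<open>(P E)\<^sup>n\<^sup>+\<^sup>1 = P E\<close>, every eigenvalue of \<open>P E\<close> is \<open>0\<close> or an \<open>n\<close>-th
  root of unity.

  The number is rational if the group has enough symmetry. Moving all \<open>\<delta>\<close> to the right, a word
  contributes only if its letters are successive conjugates of the last one, which leaves
  \<open>\<nu>\<^sub>n(V) = |G|\<^sup>-\<^sup>1 \<Sum>\<^bsub>x, z\<^esub> N(x, z) Tr (z \<delta>\<^sub>x)\<close> with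
  \<open>N(x, z) = #{g. g\<^sup>n = z = (x\<^sup>-\<^sup>1 g)\<^sup>n}\<close> (\<open>indicator_sum_eq\<close>). Summing \<open>Tr (z \<delta>\<^sub>x)\<close> over all generators
  \<open>z\<close> of one cyclic group that commutes with \<open>x\<close> gives an integer, because averages over subgroups are
  projections (\<open>sum_trace_generators\<close>). So it suffices that \<open>N(x, z)\<close> depends only on \<open>x\<close> and the
  cyclic group generated by \<open>z\<close>; this is \<open>double_indicator_Ints\<close>.

  For \<open>G = S\<^sub>N \<ltimes> A\<^sup>N\<close> this follows from \<open>N(x, z) \<le> N(x, z\<^sup>k)\<close> (\<open>card_root_pairs_le\<close>), proved by an
  injection \<open>g \<mapsto> g u\<close>, which also sends \<open>y = x\<^sup>-\<^sup>1 g\<close> to \<open>y u\<close>. Regard \<open>G\<close> as permutations of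
  \<open>{1, \<dots>, N} \<times> A\<close> commuting with the translations by \<open>A\<close>, and let \<open>\<zeta>\<close>, \<open>\<sigma>\<close>, \<open>\<tau>\<close> be the
  permutations of \<open>{1, \<dots>, N}\<close> underlying \<open>z\<close>, \<open>g\<close>, \<open>y\<close>, so that \<open>\<sigma>\<^sup>n = \<tau>\<^sup>n = \<zeta>\<close>. The abelian group
  \<open>M\<close> generated by \<open>z\<close> and the diagonal copy of \<open>A\<close> commutes with \<open>g\<close> and \<open>y\<close>, and it is transitive
  above each \<open>\<zeta>\<close>-orbit. A \<open>\<sigma>\<close>-cycle that consists of \<open>d\<close> \<open>\<zeta>\<close>-orbits returns to its first orbit after
  \<open>d\<close> steps and acts there as an element of \<open>M\<close>; hence above such a cycle \<open>z\<close> has an \<open>(n/d)\<close>-th root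
  in \<open>M\<close>. The \<open>d\<close> for which such a root exists are closed under gcd (\<open>minimal_root\<close>), so there
  is a least one, \<open>l\<close>, dividing all of them, with a root \<open>m\<close>. Let \<open>u\<close> act on each \<open>\<zeta>\<close>-orbit as
  \<open>m\<close> to the power \<open>(k - 1) t\<close>, with an integer \<open>t\<close> chosen for each orbit. Then \<open>(g u)\<^sup>n\<close> is \<open>z\<close> times
  \<open>m\<close> to the power \<open>(k - 1) s\<close>, where \<open>s\<close> is the sum of \<open>t\<close> over \<open>n\<close> steps of \<open>\<sigma>\<close>; this is
  \<open>z\<^sup>k\<close> if \<open>s = n/l\<close>. The same is needed for \<open>\<tau>\<close>. Constant weights \<open>1/l\<close> meet both requirements, and their
  sums over \<open>\<sigma>\<close>-cycles and over \<open>\<tau>\<close>-cycles are integers; by \<open>integral_rounding\<close> there are also integers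
  \<open>t\<close> with the same sums.
\<close>

section \<open>Traces of matrices with \<open>X\<^sup>m\<^sup>+\<^sup>1 = X\<close>\<close>

text \<open>
  Matrices are functions of two indices from a finite set, because the index sets below are a basis
  of a vector space and the words over such a basis.
\<close>

definition matmul :: "'i set \<Rightarrow> ('i \<Rightarrow> 'i \<Rightarrow> complex) \<Rightarrow> ('i \<Rightarrow> 'i \<Rightarrow> complex) \<Rightarrow> 'i \<Rightarrow> 'i \<Rightarrow> complex" where
  "matmul I X Y = (\<lambda>i j. \<Sum>k\<in>I. X i k * Y k j)"

fun matpow :: "'i set \<Rightarrow> ('i \<Rightarrow> 'i \<Rightarrow> complex) \<Rightarrow> nat \<Rightarrow> 'i \<Rightarrow> 'i \<Rightarrow> complex" where
  "matpow I X 0 = (\<lambda>i j. if i = j then 1 else 0)"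
| "matpow I X (Suc n) = matmul I (matpow I X n) X"

definition mattrace :: "'i set \<Rightarrow> ('i \<Rightarrow> 'i \<Rightarrow> complex) \<Rightarrow> complex" where
  "mattrace I X = (\<Sum>i\<in>I. X i i)"

lemma sum_diag_similar:
  fixes A B :: "complex mat"
  assumes A: "A \<in> carrier_mat d d" and sim: "similar_mat A B"
  shows "(\<Sum>i<d. A $$ (i, i)) = (\<Sum>i<d. B $$ (i, i))"
proof -
  from sim obtain P Q where w: "similar_mat_wit A B P Q"
    unfolding similar_mat_def by blast
  note D = similar_mat_witD2[OF A w]
  have diag: "(\<Sum>i<d. (X * Y) $$ (i, i)) = (\<Sum>i<d. (Y * X) $$ (i, i))"
    if "X \<in> carrier_mat d d" "Y \<in> carrier_mat d d" for X Y :: "complex mat"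
  proof -
    have "(\<Sum>i<d. (X * Y) $$ (i, i)) = (\<Sum>i<d. \<Sum>k<d. X $$ (i, k) * Y $$ (k, i))"
      using that by (intro sum.cong refl) (auto simp: scalar_prod_def atLeast0LessThan)
    also have "\<dots> = (\<Sum>k<d. \<Sum>i<d. Y $$ (k, i) * X $$ (i, k))"
      by (subst sum.swap) (simp add: mult.commute)
    also have "\<dots> = (\<Sum>i<d. (Y * X) $$ (i, i))"
      using that by (intro sum.cong refl) (auto simp: scalar_prod_def atLeast0LessThan)
    finally show ?thesis .
  qed
  have "(\<Sum>i<d. A $$ (i, i)) = (\<Sum>i<d. (P * (B * Q)) $$ (i, i))"
    using D by simp
  also have "\<dots> = (\<Sum>i<d. ((B * Q) * P) $$ (i, i))"
    using D by (intro diag) auto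
  also have "(B * Q) * P = B"
    using D by (simp add: assoc_mult_mat[of B d d Q d P d])
  finally show ?thesis .
qed

text \<open>
  In a triangular form of \<open>A\<close> the trace is the sum of the eigenvalues, and each of these inherits the
  equation that \<open>A\<close> satisfies.
\<close>

lemma sum_diag_potent:
  fixes A :: "complex mat"
  assumes A: "A \<in> carrier_mat d d" and pow: "A ^\<^sub>m Suc m = A"
  shows "\<exists>as. (\<forall>a\<in>set as. a ^ Suc m = a) \<and> (\<Sum>i<d. A $$ (i, i)) = sum_list as"
proof -
  from char_poly_factorized[OF A] obtain es where "char_poly A = (\<Prod> a \<leftarrow> es. [:- a, 1:])"
    by blast
  from schur_decomposition_exists[OF A this] obtain B where
    B: "B \<in> carrier_mat d d" "upper_triangular B" "similar_mat A B" by blast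
  have "a ^ Suc m = a" if "a \<in> set (diag_mat B)" for a
  proof -
    have "poly (char_poly B) a = 0"
      using that by (auto simp: char_poly_upper_triangular[OF B(1,2)] poly_prod_list prod_list_zero_iff)
    hence "eigenvalue A a"
      by (simp add: eigenvalue_root_char_poly[OF A] char_poly_similar[OF B(3)])
    then obtain v where v: "eigenvector A v a" unfolding eigenvalue_def by blast
    hence "A *\<^sub>v v = a \<cdot>\<^sub>v v" "v \<in> carrier_vec d" "v \<noteq> 0\<^sub>v d"
      using A by (auto simp: eigenvector_def)
    moreover have "A *\<^sub>v v = a ^ Suc m \<cdot>\<^sub>v v"
      using eigenvector_pow[OF A v, of "Suc m"] pow by simp
    ultimately have eq: "a \<cdot>\<^sub>v v = a ^ Suc m \<cdot>\<^sub>v v" and v: "v \<in> carrier_vec d" "v \<noteq> 0\<^sub>v d"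
      by auto
    from v obtain i where i: "i < d" "v $ i \<noteq> 0"
      by (metis carrier_vecD eq_vecI index_zero_vec(1,2))
    from eq have "(a \<cdot>\<^sub>v v) $ i = (a ^ Suc m \<cdot>\<^sub>v v) $ i" by (rule arg_cong)
    thus ?thesis using i v by simp
  qed
  moreover have "(\<Sum>i<d. A $$ (i, i)) = sum_list (diag_mat B)"
    unfolding sum_diag_similar[OF A B(3)] using B(1)
    by (simp add: diag_mat_def sum_list_sum_nth atLeast0LessThan)
  ultimately show ?thesis by blast
qed

lemma mattrace_potent:
  assumes fin: "finite I"
    and pow: "\<And>i j. i \<in> I \<Longrightarrow> j \<in> I \<Longrightarrow> matpow I X (Suc m) i j = X i j"
  shows "\<exists>as. (\<forall>a\<in>set as. a ^ Suc m = a) \<and> mattrace I X = sum_list as"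
proof -
  define d where "d = card I"
  from fin obtain e where e: "bij_betw e {..<d} I"
    using ex_bij_betw_nat_finite[OF fin] by (auto simp: d_def atLeast0LessThan)
  have eI: "e i \<in> I" if "i < d" for i using e that by (auto simp: bij_betw_def)
  have inj: "e i = e j \<longleftrightarrow> i = j" if "i < d" "j < d" for i j
    using e that by (auto simp: bij_betw_def inj_on_def)
  define A where "A = mat d d (\<lambda>(i, j). X (e i) (e j))"
  have A: "A \<in> carrier_mat d d" by (simp add: A_def)
  have p: "A ^\<^sub>m k = mat d d (\<lambda>(i, j). matpow I X k (e i) (e j))" for k
  proof (induction k)
    case 0
    show ?case by (rule eq_matI) (auto simp: A_def inj)
  next
    case (Suc k)
    show ?case
    proof (rule eq_matI)
      fix i j assume "i < dim_row (mat d d (\<lambda>(i, j). matpow I X (Suc k) (e i) (e j)))"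
        "j < dim_col (mat d d (\<lambda>(i, j). matpow I X (Suc k) (e i) (e j)))"
      hence ij: "i < d" "j < d" by auto
      have "(A ^\<^sub>m Suc k) $$ (i, j) = (\<Sum>l<d. matpow I X k (e i) (e l) * X (e l) (e j))"
        using ij A unfolding pow_mat.simps Suc
        by (simp add: A_def scalar_prod_def atLeast0LessThan)
      also have "\<dots> = (\<Sum>l\<in>I. matpow I X k (e i) l * X l (e j))"
        by (rule sum.reindex_bij_betw[OF e])
      finally show "(A ^\<^sub>m Suc k) $$ (i, j) =
          mat d d (\<lambda>(i, j). matpow I X (Suc k) (e i) (e j)) $$ (i, j)"
        using ij by (simp add: matmul_def)
    qed (auto simp: A_def)
  qed
  have "A ^\<^sub>m Suc m = A"
    unfolding p by (rule eq_matI) (auto simp: A_def pow eI simp del: matpow.simps)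
  from sum_diag_potent[OF A this] obtain as where
    as: "\<forall>a\<in>set as. a ^ Suc m = a" "(\<Sum>i<d. A $$ (i, i)) = sum_list as" by blast
  have "mattrace I X = (\<Sum>i<d. X (e i) (e i))"
    unfolding mattrace_def by (rule sum.reindex_bij_betw[OF e, symmetric])
  also have "\<dots> = sum_list as" using as(2) by (simp add: A_def)
  finally show ?thesis using as(1) by blast
qed

text \<open>
  The eigenvalues of a projection are \<open>0\<close> and \<open>1\<close>.
\<close>

lemma mattrace_idempotent:
  assumes fin: "finite I"
    and idem: "\<And>i j. i \<in> I \<Longrightarrow> j \<in> I \<Longrightarrow> matmul I X X i j = X i j"
  shows "mattrace I X \<in> \<int>"
proof -
  have "matpow I X (Suc 1) i j = X i j" if "i \<in> I" "j \<in> I" for i j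
  proof -
    have "matmul I (matpow I X 0) X i k = X i k" for k
      using that fin by (simp add: matmul_def if_distrib[of "\<lambda>c. c * _"] sum.delta cong: if_cong)
    thus ?thesis using idem[OF that] by (simp add: matmul_def)
  qed
  from mattrace_potent[OF fin this] obtain as where
    as: "\<forall>a\<in>set as. a ^ Suc 1 = a" "mattrace I X = sum_list as" by blast
  have "a \<in> \<int>" if "a \<in> set as" for a
  proof -
    have "a * a = a" using as(1) that by auto
    hence "a = 0 \<or> a = 1" by (metis mult_cancel_left2)
    thus ?thesis by auto
  qed
  hence "sum_list as \<in> \<int>" by (induction as) auto
  thus ?thesis using as(2) by simp
qed

text \<open>
  The sum lies in the ring \<open>\<int>[\<omega>]\<close> for a primitive \<open>m\<close>-th root of unity \<open>\<omega>\<close>. Multiplication by such an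
  element maps each power of \<open>\<omega>\<close> to an integral combination of powers of \<open>\<omega>\<close>, so the
  element is an eigenvalue of an integer matrix, and a root of its monic characteristic polynomial.
\<close>

lemma algebraic_int_sum_roots_of_unity:
  fixes as :: "complex list"
  assumes m: "m \<ge> 1" and as: "\<forall>a\<in>set as. a ^ Suc m = a"
  shows "algebraic_int (sum_list as)"
proof -
  define w where "w = cis (2 * pi / real m)"
  have wm: "w ^ m = 1" using m by (simp add: w_def DeMoivre)
  have wmod: "w ^ (k mod m) = w ^ k" for k
  proof -
    have "w ^ k = w ^ (m * (k div m) + k mod m)" by simp
    also have "\<dots> = w ^ (k mod m)" unfolding power_add power_mult wm by simp
    finally show ?thesis by simp
  qed
  have "\<exists>c :: nat \<Rightarrow> int. sum_list as = (\<Sum>j<m. of_int (c j) * w ^ j)"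
    using as
  proof (induction as)
    case Nil
    show ?case by (rule exI[of _ "\<lambda>_. 0"]) simp
  next
    case (Cons a as)
    then obtain c :: "nat \<Rightarrow> int" where c: "sum_list as = (\<Sum>j<m. of_int (c j) * w ^ j)" by auto
    have "a * a ^ m = a" using Cons.prems by auto
    hence "a = 0 \<or> a ^ m = 1" by (metis mult_cancel_left1)
    thus ?case
    proof
      assume "a = 0" thus ?thesis using c by auto
    next
      assume "a ^ m = 1"
      then obtain k where k: "k < m" "a = w ^ k"
        using bij_betw_roots_unity[of m] m
        by (force simp: bij_betw_def w_def DeMoivre mult_ac)
      have "(\<Sum>j<m. of_int (c j + (if j = k then 1 else 0)) * w ^ j) = sum_list as + a"
        using k by (simp add: c distrib_right sum.distrib if_distrib[of "\<lambda>u. of_int u * _"] sum.delta cong: if_cong)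
      thus ?thesis by (intro exI[of _ "\<lambda>j. c j + (if j = k then 1 else 0)"]) (simp add: add.commute)
    qed
  qed
  then obtain c :: "nat \<Rightarrow> int" where c: "sum_list as = (\<Sum>j<m. of_int (c j) * w ^ j)" by blast
  define C :: "int mat" where "C = mat m m (\<lambda>(i, k). c ((k + (m - i)) mod m))"
  let ?C = "map_mat of_int C :: complex mat"
  let ?v = "vec m (\<lambda>k. w ^ k)"
  have C: "C \<in> carrier_mat m m" by (simp add: C_def)
  \<comment> \<open>the circulant matrix of multiplication by the sum, with the powers of \<open>w\<close> as eigenvector\<close>
  have "eigenvector ?C ?v (sum_list as)"
    unfolding eigenvector_def
  proof (intro conjI)
    show "?v \<in> carrier_vec (dim_row ?C)" using C by simp
    have "?v $ 0 \<noteq> 0\<^sub>v (dim_row ?C) $ 0" using m C by auto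
    thus "?v \<noteq> 0\<^sub>v (dim_row ?C)" by metis
    show "?C *\<^sub>v ?v = sum_list as \<cdot>\<^sub>v ?v"
    proof (rule eq_vecI)
      fix i assume "i < dim_vec (sum_list as \<cdot>\<^sub>v ?v)"
      hence i: "i < m" by simp
      have "(?C *\<^sub>v ?v) $ i = (\<Sum>k<m. of_int (c ((k + (m - i)) mod m)) * w ^ k)"
        using i by (simp add: C_def scalar_prod_def atLeast0LessThan)
      also have "\<dots> = (\<Sum>j<m. of_int (c j) * w ^ ((j + i) mod m))"
      proof (rule sum.reindex_bij_witness[of _ "\<lambda>j. (j + i) mod m" "\<lambda>k. (k + (m - i)) mod m"])
        fix j assume "j \<in> {..<m}"
        hence j: "j < m" by simp
        show "((j + (m - i)) mod m + i) mod m = j"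
          using i j by (simp add: mod_add_left_eq)
        have "((j + i) mod m + (m - i)) mod m = (j + i + (m - i)) mod m"
          by (rule mod_add_left_eq)
        thus "((j + i) mod m + (m - i)) mod m = j" using i j by simp
        show "of_int (c ((j + (m - i)) mod m)) * w ^ (((j + (m - i)) mod m + i) mod m)
            = of_int (c ((j + (m - i)) mod m)) * w ^ j"
          using i j by (simp add: mod_add_left_eq)
      qed (use m in auto)
      also have "\<dots> = sum_list as * w ^ i"
        by (simp add: wmod c sum_distrib_right power_add mult.assoc)
      finally show "(?C *\<^sub>v ?v) $ i = (sum_list as \<cdot>\<^sub>v ?v) $ i" using i by simp
    qed (simp add: C_def)
  qed
  hence "eigenvalue ?C (sum_list as)" unfolding eigenvalue_def by blast
  hence "poly (char_poly ?C) (sum_list as) = 0"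
    by (subst (asm) eigenvalue_root_char_poly[of _ m]) (use C in auto)
  hence "poly (map_poly of_int (char_poly C)) (sum_list as) = 0"
    by (simp add: of_int_hom.char_poly_hom[OF C])
  moreover have "lead_coeff (char_poly C) = 1" using degree_monic_char_poly[OF C] by simp
  ultimately show ?thesis by (auto simp: algebraic_int_altdef_ipoly)
qed

section \<open>Traces of products as sums over closed paths\<close>

definition words :: "'i set \<Rightarrow> nat \<Rightarrow> 'i list set" where
  "words I n = {f. length f = n \<and> set f \<subseteq> I}"

lemma finite_words: "finite I \<Longrightarrow> finite (words I n)"
  using finite_lists_length_eq[of I n] by (simp add: words_def conj_commute)

lemma words_0: "words I 0 = {[]}"
  by (auto simp: words_def)

lemma sum_words_Suc:
  fixes h :: "'i list \<Rightarrow> 'r::comm_monoid_add"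
  shows "(\<Sum>f\<in>words I (Suc n). h f) = (\<Sum>i\<in>I. \<Sum>f\<in>words I n. h (i # f))"
  unfolding sum.cartesian_product
  by (rule sum.reindex_bij_witness[of _ "\<lambda>(i, f). i # f" "\<lambda>f. (hd f, tl f)"])
    (auto simp: words_def length_Suc_conv)

text \<open>
  Expanding a product of sums amounts to choosing one letter for each factor. On tensor powers this
  says that composition is computed in each tensor position separately.
\<close>

lemma sum_words_prod:
  fixes F :: "nat \<Rightarrow> 'i \<Rightarrow> complex"
  shows "(\<Sum>f\<in>words I n. \<Prod>k<n. F k (f ! k)) = (\<Prod>k<n. \<Sum>c\<in>I. F k c)"
proof (induction n arbitrary: F)
  case (Suc n)
  have "(\<Sum>f\<in>words I (Suc n). \<Prod>k<Suc n. F k (f ! k)) =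
      (\<Sum>i\<in>I. F 0 i * (\<Sum>f\<in>words I n. \<Prod>k<n. F (Suc k) (f ! k)))"
    unfolding sum_words_Suc prod.lessThan_Suc_shift by (simp add: sum_distrib_left)
  also have "\<dots> = (\<Prod>k<Suc n. \<Sum>c\<in>I. F k c)"
    unfolding Suc.IH[of "\<lambda>k. F (Suc k)"] prod.lessThan_Suc_shift by (simp add: sum_distrib_right)
  finally show ?case .
qed (simp add: words_0)

definition matprod :: "'i set \<Rightarrow> ('i \<Rightarrow> 'i \<Rightarrow> complex) list \<Rightarrow> 'i \<Rightarrow> 'i \<Rightarrow> complex" where
  "matprod I As = foldr (matmul I) As (\<lambda>i j. if i = j then 1 else 0)"

lemma matprod_Cons: "matprod I (A # As) i j = (\<Sum>k\<in>I. A i k * matprod I As k j)"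
  by (simp add: matprod_def matmul_def)

lemma matprod_single: "finite I \<Longrightarrow> j \<in> I \<Longrightarrow> matprod I [A] i j = A i j"
  by (simp add: matprod_def matmul_def if_distrib[of "\<lambda>c. _ * c"] sum.delta cong: if_cong)

lemma matprod_paths:
  assumes "finite I" "j \<in> I" "length As = Suc m"
  shows "matprod I As i j =
    (\<Sum>f\<in>words I m. \<Prod>k<Suc m. (As ! k) ((i # f) ! k) ((f @ [j]) ! k))"
  using assms(3)
proof (induction m arbitrary: As i)
  case 0
  then obtain A where "As = [A]" by (auto simp: length_Suc_conv)
  thus ?case using assms by (simp add: words_0 matprod_single)
next
  case (Suc m)
  then obtain A As' where As: "As = A # As'" "length As' = Suc m" by (auto simp: length_Suc_conv)
  have "matprod I As i j = (\<Sum>c\<in>I. \<Sum>f\<in>words I m.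
      A i c * (\<Prod>k<Suc m. (As' ! k) ((c # f) ! k) ((f @ [j]) ! k)))"
    by (simp only: As(1) matprod_Cons Suc.IH[OF As(2)] sum_distrib_left)
  also have "\<dots> = (\<Sum>f\<in>words I (Suc m). \<Prod>k<Suc (Suc m). (As ! k) ((i # f) ! k) ((f @ [j]) ! k))"
    unfolding sum_words_Suc prod.lessThan_Suc_shift[of _ "Suc m"] by (simp add: As(1))
  finally show ?case .
qed

text \<open>
  The trace of a product of \<open>n\<close> matrices is a sum over closed paths of length \<open>n\<close>. Read on the \<open>n\<close>-th
  tensor power, it is the trace of the tensor product of the matrices composed with the cyclic shift
  of the tensor factors.
\<close>

lemma mattrace_matprod:
  assumes "finite I" "length As = n" "n > 0"
  shows "mattrace I (matprod I As) = (\<Sum>f\<in>words I n. \<Prod>k<n. (As ! k) (f ! k) (rotate1 f ! k))"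
proof -
  from assms obtain m where m: "n = Suc m" by (cases n) auto
  show ?thesis
    unfolding m sum_words_Suc mattrace_def
    using assms m by (intro sum.cong refl) (simp only: matprod_paths rotate1.simps)
qed

lemma prod_rotate1:
  fixes H :: "'a \<Rightarrow> 'b \<Rightarrow> 'b \<Rightarrow> complex"
  assumes "length xs = n" "length f = n" "length f' = n"
  shows "(\<Prod>k<n. H (rotate1 xs ! k) (rotate1 f ! k) (rotate1 f' ! k)) = (\<Prod>k<n. H (xs ! k) (f ! k) (f' ! k))"
proof (cases n)
  case (Suc m)
  obtain x ys where "xs = x # ys" "length ys = m" using assms(1) Suc by (auto simp: length_Suc_conv)
  moreover obtain a g where "f = a # g" "length g = m" using assms(2) Suc by (auto simp: length_Suc_conv)
  moreover obtain b h where "f' = b # h" "length h = m" using assms(3) Suc by (auto simp: length_Suc_conv)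
  ultimately show ?thesis
    unfolding Suc by (subst prod.lessThan_Suc, subst prod.lessThan_Suc_shift)
      (simp add: nth_append mult.commute)
qed simp

section \<open>Words in a finite group\<close>

context group
begin

definition lprod :: "'a list \<Rightarrow> 'a" where
  "lprod xs = foldr (\<otimes>) xs \<one>"

lemma lprod_simps: "lprod [] = \<one>" "lprod (x # xs) = x \<otimes> lprod xs"
  by (simp_all add: lprod_def)

lemma lprod_closed: "set xs \<subseteq> carrier G \<Longrightarrow> lprod xs \<in> carrier G"
  by (induction xs) (auto simp: lprod_simps)

lemma lprod_append: "set xs \<subseteq> carrier G \<Longrightarrow> set ys \<subseteq> carrier G \<Longrightarrow> lprod (xs @ ys) = lprod xs \<otimes> lprod ys"
  by (induction xs) (auto simp: lprod_simps lprod_closed m_assoc)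

text \<open>
  A cyclic shift conjugates the product of a word.
\<close>

lemma lprod_rotate1:
  assumes "set xs \<subseteq> carrier G"
  shows "lprod (rotate1 xs) = \<one> \<longleftrightarrow> lprod xs = \<one>"
proof (cases xs)
  case (Cons x ys)
  hence c: "x \<in> carrier G" "lprod ys \<in> carrier G" "set ys \<subseteq> carrier G" using assms lprod_closed by auto
  have "x \<otimes> lprod ys = \<one> \<longleftrightarrow> lprod ys \<otimes> x = \<one>"
    using c by (metis inv_comm)
  thus ?thesis using c by (simp add: Cons lprod_append lprod_simps)
qed simp

lemma lprod_conjugate:
  assumes "h \<in> carrier G" "set ys \<subseteq> carrier G"
  shows "lprod (map (\<lambda>y. h \<otimes> y \<otimes> inv h) ys) = h \<otimes> lprod ys \<otimes> inv h"
  using assms(2)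
proof (induction ys)
  case (Cons y ys)
  hence "y \<in> carrier G" "lprod ys \<in> carrier G" by (auto simp: lprod_closed)
  moreover have "inv h \<otimes> (h \<otimes> w) = w" if "w \<in> carrier G" for w
    using that assms(1) by (simp add: m_assoc[symmetric])
  ultimately show ?case using Cons assms(1) by (simp add: lprod_simps m_assoc)
qed (simp add: lprod_simps assms)

definition closed_words :: "nat \<Rightarrow> 'a list set" where
  "closed_words n = {xs \<in> words (carrier G) n. lprod xs = \<one>}"

lemma nat_pow_inv_mult_iff:
  assumes "g \<in> carrier G" "x \<in> carrier G"
  shows "g [^] (n::nat) \<otimes> (inv g \<otimes> x) [^] n = \<one> \<longleftrightarrow> (inv x \<otimes> g) [^] n = g [^] n"
proof -
  have "inv x \<otimes> g = inv (inv g \<otimes> x)" using assms by (simp add: inv_mult_group)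
  hence "(inv x \<otimes> g) [^] n = inv ((inv g \<otimes> x) [^] n)" using assms by (simp add: nat_pow_inv)
  moreover have "g [^] n \<otimes> (inv g \<otimes> x) [^] n = \<one> \<longleftrightarrow> inv ((inv g \<otimes> x) [^] n) = g [^] n"
    (is "?a \<otimes> ?b = \<one> \<longleftrightarrow> _")
  proof
    assume "?a \<otimes> ?b = \<one>"
    thus "inv ?b = ?a" using assms by (intro inv_equality) auto
  next
    assume "inv ?b = ?a"
    hence "?a \<otimes> ?b = inv ?b \<otimes> ?b" by simp
    thus "?a \<otimes> ?b = \<one>" using assms by simp
  qed
  ultimately show ?thesis by simp
qed

text \<open>
  The word \<open>g\<^sup>m x g\<^sup>-\<^sup>m, \<dots>, g x g\<^sup>-\<^sup>1, x\<close>. Up to its last letter it is forced by the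
  requirement that \<open>(g \<delta>\<^bsub>x\<^sub>0\<^esub>) \<cdots> (g \<delta>\<^bsub>x\<^sub>m\<^esub>)\<close> be nonzero.
\<close>

fun conj_word :: "'a \<Rightarrow> nat \<Rightarrow> 'a \<Rightarrow> 'a list" where
  "conj_word g 0 x = [x]"
| "conj_word g (Suc m) x = (g [^] Suc m \<otimes> x \<otimes> inv (g [^] Suc m)) # conj_word g m x"

lemma conj_word_props:
  assumes "g \<in> carrier G" "x \<in> carrier G"
  shows "length (conj_word g m x) = Suc m" "set (conj_word g m x) \<subseteq> carrier G"
    "last (conj_word g m x) = x"
    "lprod (conj_word g m x) = g [^] Suc m \<otimes> (inv g \<otimes> x) [^] Suc m"
proof -
  show "length (conj_word g m x) = Suc m" by (induction m) auto
  show "set (conj_word g m x) \<subseteq> carrier G" using assms by (induction m) auto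
  show "last (conj_word g m x) = x" by (induction m) (auto simp: \<open>length _ = _\<close>, metis conj_word.elims list.distinct(1))
  show "lprod (conj_word g m x) = g [^] Suc m \<otimes> (inv g \<otimes> x) [^] Suc m"
  proof (induction m)
    case 0
    show ?case using assms by (simp add: lprod_simps m_assoc[symmetric])
  next
    case (Suc m)
    let ?p = "g [^] Suc m" and ?r = "(inv g \<otimes> x) [^] Suc m"
    have c: "?p \<in> carrier G" "?r \<in> carrier G" using assms by auto
    have "lprod (conj_word g (Suc m) x) = ?p \<otimes> x \<otimes> inv ?p \<otimes> (?p \<otimes> ?r)"
      by (simp only: conj_word.simps lprod_simps Suc)
    also have "\<dots> = ?p \<otimes> x \<otimes> (inv ?p \<otimes> ?p) \<otimes> ?r" using c assms by (simp only: m_assoc m_closed inv_closed)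
    also have "\<dots> = ?p \<otimes> (g \<otimes> (inv g \<otimes> x)) \<otimes> ?r"
    proof -
      have "inv ?p \<otimes> ?p = \<one>" using c by (intro l_inv)
      moreover have "g \<otimes> (inv g \<otimes> x) = x" using assms by (simp add: m_assoc[symmetric])
      ultimately show ?thesis using c assms by (simp only: r_one m_closed)
    qed
    also have "\<dots> = (?p \<otimes> g) \<otimes> ((inv g \<otimes> x) \<otimes> ?r)" using c assms by (simp only: m_assoc m_closed inv_closed)
    also have "(inv g \<otimes> x) \<otimes> ?r = (inv g \<otimes> x) [^] Suc (Suc m)"
      using assms by (metis nat_pow_Suc2 m_closed inv_closed)
    finally show ?case by (simp only: nat_pow_Suc[of g "Suc m"])
  qed
qed

text \<open>
  Its elements correspond to the pairs \<open>(g, y)\<close> of \<open>n\<close>-th roots of \<open>z\<close> with \<open>g y\<^sup>-\<^sup>1 = x\<close>.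
\<close>

definition root_pairs :: "nat \<Rightarrow> 'a \<Rightarrow> 'a \<Rightarrow> 'a set" where
  "root_pairs n x z = {g \<in> carrier G. g [^] n = z \<and> (inv x \<otimes> g) [^] n = z}"

text \<open>
  The element \<open>z\<close> is a power of \<open>g\<close> and of \<open>x\<^sup>-\<^sup>1 g\<close>, hence commutes with both and with their quotient \<open>x\<close>.
\<close>

lemma root_pairs_commute:
  assumes x: "x \<in> carrier G" and ne: "root_pairs n x z \<noteq> {}"
  shows "z \<otimes> x = x \<otimes> z"
proof -
  from ne obtain g where g: "g \<in> carrier G" "g [^] n = z" "(inv x \<otimes> g) [^] n = z"
    by (auto simp: root_pairs_def)
  have z: "z \<in> carrier G" using g by auto
  have 1: "z \<otimes> g = g \<otimes> z" using g by (metis nat_pow_Suc nat_pow_Suc2)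
  let ?y = "inv x \<otimes> g"
  have y: "?y \<in> carrier G" using g x by simp
  have 2: "z \<otimes> ?y = ?y \<otimes> z" using g(3) y by (metis nat_pow_Suc nat_pow_Suc2)
  have "g = x \<otimes> ?y" using g x by (simp add: m_assoc[symmetric])
  hence "z \<otimes> x \<otimes> ?y = (x \<otimes> ?y) \<otimes> z" using 1 x y z by (simp only: m_assoc)
  also have "\<dots> = x \<otimes> (?y \<otimes> z)" using x y z by (simp only: m_assoc)
  also have "\<dots> = x \<otimes> z \<otimes> ?y" using 2 x y z by (simp add: m_assoc)
  finally show ?thesis using x y z by simp
qed

end

section \<open>Matrix modules over the double of a finite group\<close>

text \<open>
  The matrix \<open>R (g, x)\<close> stands for the action of \<open>g \<delta>\<^sub>x\<close>, and the product rule is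
  \<open>(g \<delta>\<^sub>x) (h \<delta>\<^sub>y) = g h \<delta>\<^sub>y\<close> if \<open>x = h y h\<^sup>-\<^sup>1\<close>, and \<open>0\<close> otherwise.
\<close>

locale double_matrices = group G for G :: "('g, 'm) monoid_scheme" (structure) +
  fixes I :: "'i set" and R :: "'g \<times> 'g \<Rightarrow> 'i \<Rightarrow> 'i \<Rightarrow> complex"
  assumes finite_carrier: "finite (carrier G)" and finite_index: "finite I"
    and R_mult: "g \<in> carrier G \<Longrightarrow> x \<in> carrier G \<Longrightarrow> h \<in> carrier G \<Longrightarrow> y \<in> carrier G \<Longrightarrow>
      i \<in> I \<Longrightarrow> j \<in> I \<Longrightarrow>
      matmul I (R (g, x)) (R (h, y)) i j = (if x = h \<otimes> y \<otimes> inv h then R (g \<otimes> h, y) i j else 0)"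
begin

abbreviation cardG where "cardG \<equiv> (of_nat (card (carrier G)) :: complex)"

lemma cardG_nonzero: "cardG \<noteq> 0"
  using finite_carrier one_closed by (auto simp: card_eq_0_iff)

lemma finite_closed_words: "finite (closed_words n)"
  by (simp add: closed_words_def finite_words finite_carrier)

text \<open>
  The \<open>n\<close>-th Frobenius-Schur indicator, after expanding
  \<open>\<Delta>\<^sub>n(\<Lambda>) = |G|\<^sup>-\<^sup>1 \<Sum> g \<delta>\<^bsub>x\<^sub>1\<^esub> \<otimes> \<cdots> \<otimes> g \<delta>\<^bsub>x\<^sub>n\<^esub>\<close> over \<open>x\<^sub>1 \<cdots> x\<^sub>n = 1\<close>.
\<close>

definition indicator_sum :: "nat \<Rightarrow> complex" where
  "indicator_sum n = (\<Sum>g\<in>carrier G. \<Sum>xs\<in>closed_words n.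
     mattrace I (matprod I (map (\<lambda>x. R (g, x)) xs))) / cardG"

text \<open>
  The matrix of \<open>\<Delta>\<^sub>n(\<Lambda>)\<close> on the \<open>n\<close>-th tensor power of the module, whose basis is indexed by words.
\<close>

definition proj :: "nat \<Rightarrow> 'i list \<Rightarrow> 'i list \<Rightarrow> complex" where
  "proj n f f' = (\<Sum>g\<in>carrier G. \<Sum>xs\<in>closed_words n. \<Prod>k<n. R (g, xs ! k) (f ! k) (f' ! k)) / cardG"

text \<open>
  This is \<open>\<Delta>\<^sub>n(\<Lambda>)\<^sup>2 = \<Delta>\<^sub>n(\<Lambda>\<^sup>2) = \<Delta>\<^sub>n(\<Lambda>)\<close>, computed directly: for fixed \<open>g\<close>, \<open>h\<close> and \<open>ys\<close> only the
  word of conjugates \<open>h y h\<^sup>-\<^sup>1\<close> contributes, and it again has product \<open>1\<close>.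
\<close>

lemma proj_idempotent:
  assumes f: "f \<in> words I n" and f': "f' \<in> words I n"
  shows "matmul (words I n) (proj n) (proj n) f f' = proj n f f'"
proof -
  let ?C = "carrier G" and ?W = "closed_words n"
  have nth_I: "f ! k \<in> I" "f' ! k \<in> I" if "k < n" for k
    using f f' that by (auto simp: words_def)
  have nth_C: "xs ! k \<in> ?C" if "k < n" "xs \<in> ?W" for k xs
    using that by (auto simp: closed_words_def words_def)
  have pair: "(\<Sum>w\<in>words I n. (\<Prod>k<n. R (g, xs ! k) (f ! k) (w ! k)) * (\<Prod>k<n. R (h, ys ! k) (w ! k) (f' ! k)))
      = (if xs = map (\<lambda>y. h \<otimes> y \<otimes> inv h) ys then \<Prod>k<n. R (g \<otimes> h, ys ! k) (f ! k) (f' ! k) else 0)"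
    if "g \<in> ?C" "h \<in> ?C" "xs \<in> ?W" "ys \<in> ?W" for g h xs ys
  proof -
    have len: "length xs = n" "length ys = n" using that by (auto simp: closed_words_def words_def)
    have "(\<Sum>w\<in>words I n. (\<Prod>k<n. R (g, xs ! k) (f ! k) (w ! k)) * (\<Prod>k<n. R (h, ys ! k) (w ! k) (f' ! k)))
        = (\<Prod>k<n. \<Sum>c\<in>I. R (g, xs ! k) (f ! k) c * R (h, ys ! k) c (f' ! k))"
      unfolding prod.distrib[symmetric] by (rule sum_words_prod)
    also have "\<dots> = (\<Prod>k<n. if xs ! k = h \<otimes> ys ! k \<otimes> inv h then R (g \<otimes> h, ys ! k) (f ! k) (f' ! k) else 0)"
      using R_mult nth_I nth_C that by (intro prod.cong refl) (simp add: matmul_def)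
    also have "\<dots> = (if xs = map (\<lambda>y. h \<otimes> y \<otimes> inv h) ys then \<Prod>k<n. R (g \<otimes> h, ys ! k) (f ! k) (f' ! k) else 0)"
    proof (cases "xs = map (\<lambda>y. h \<otimes> y \<otimes> inv h) ys")
      case True
      thus ?thesis using len by (auto intro!: prod.cong)
    next
      case False
      then obtain k where "k < n" "xs ! k \<noteq> h \<otimes> ys ! k \<otimes> inv h"
        using len by (auto simp: list_eq_iff_nth_eq)
      thus ?thesis using False by (auto intro!: prod_zero)
    qed
    finally show ?thesis .
  qed
  have conj: "map (\<lambda>y. h \<otimes> y \<otimes> inv h) ys \<in> ?W" if "h \<in> ?C" "ys \<in> ?W" for h ys
    using that by (auto simp: closed_words_def words_def lprod_conjugate)
  let ?T = "\<lambda>g. \<Sum>ys\<in>?W. \<Prod>k<n. R (g, ys ! k) (f ! k) (f' ! k)"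
  have "matmul (words I n) (proj n) (proj n) f f' =
     (\<Sum>w\<in>words I n. \<Sum>g\<in>?C. \<Sum>xs\<in>?W. \<Sum>h\<in>?C. \<Sum>ys\<in>?W.
       (\<Prod>k<n. R (g, xs ! k) (f ! k) (w ! k)) * (\<Prod>k<n. R (h, ys ! k) (w ! k) (f' ! k))) / (cardG * cardG)"
    unfolding matmul_def proj_def times_divide_times_eq sum_divide_distrib[symmetric]
    unfolding sum_distrib_right unfolding sum_distrib_left ..
  also have "(\<Sum>w\<in>words I n. \<Sum>g\<in>?C. \<Sum>xs\<in>?W. \<Sum>h\<in>?C. \<Sum>ys\<in>?W.
       (\<Prod>k<n. R (g, xs ! k) (f ! k) (w ! k)) * (\<Prod>k<n. R (h, ys ! k) (w ! k) (f' ! k)))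
     = (\<Sum>g\<in>?C. \<Sum>xs\<in>?W. \<Sum>h\<in>?C. \<Sum>ys\<in>?W. \<Sum>w\<in>words I n.
       (\<Prod>k<n. R (g, xs ! k) (f ! k) (w ! k)) * (\<Prod>k<n. R (h, ys ! k) (w ! k) (f' ! k)))"
    by (simp only: sum.swap[of _ _ "words I n"])
  also have "\<dots> = (\<Sum>g\<in>?C. \<Sum>xs\<in>?W. \<Sum>h\<in>?C. \<Sum>ys\<in>?W.
      if xs = map (\<lambda>y. h \<otimes> y \<otimes> inv h) ys then \<Prod>k<n. R (g \<otimes> h, ys ! k) (f ! k) (f' ! k) else 0)"
    by (intro sum.cong refl pair)
  also have "\<dots> = (\<Sum>g\<in>?C. \<Sum>h\<in>?C. \<Sum>ys\<in>?W. \<Sum>xs\<in>?W.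
      if xs = map (\<lambda>y. h \<otimes> y \<otimes> inv h) ys then \<Prod>k<n. R (g \<otimes> h, ys ! k) (f ! k) (f' ! k) else 0)"
  proof (rule sum.cong[OF refl])
    fix g
    let ?f = "\<lambda>xs h ys. if xs = map (\<lambda>y. h \<otimes> y \<otimes> inv h) ys
      then \<Prod>k<n. R (g \<otimes> h, ys ! k) (f ! k) (f' ! k) else 0"
    have "(\<Sum>xs\<in>?W. \<Sum>h\<in>?C. \<Sum>ys\<in>?W. ?f xs h ys) = (\<Sum>h\<in>?C. \<Sum>xs\<in>?W. \<Sum>ys\<in>?W. ?f xs h ys)"
      by (rule sum.swap)
    also have "\<dots> = (\<Sum>h\<in>?C. \<Sum>ys\<in>?W. \<Sum>xs\<in>?W. ?f xs h ys)"
      by (rule sum.cong[OF refl], rule sum.swap)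
    finally show "(\<Sum>xs\<in>?W. \<Sum>h\<in>?C. \<Sum>ys\<in>?W. ?f xs h ys) = (\<Sum>h\<in>?C. \<Sum>ys\<in>?W. \<Sum>xs\<in>?W. ?f xs h ys)" .
  qed
  also have "\<dots> = (\<Sum>g\<in>?C. \<Sum>h\<in>?C. ?T (g \<otimes> h))"
    using conj finite_closed_words by (intro sum.cong refl) (simp add: sum.delta)
  also have "\<dots> = (\<Sum>h\<in>?C. \<Sum>g\<in>?C. ?T (g \<otimes> h))" by (rule sum.swap)
  also have "\<dots> = (\<Sum>h\<in>?C. \<Sum>g\<in>?C. ?T g)"
  proof (rule sum.cong[OF refl])
    fix h assume "h \<in> ?C"
    thus "(\<Sum>g\<in>?C. ?T (g \<otimes> h)) = (\<Sum>g\<in>?C. ?T g)"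
      by (intro sum.reindex_bij_witness[of _ "\<lambda>g. g \<otimes> inv h" "\<lambda>g. g \<otimes> h"]) (auto simp: m_assoc)
  qed
  also have "\<dots> = cardG * (\<Sum>g\<in>?C. ?T g)" by simp
  finally show ?thesis using cardG_nonzero unfolding proj_def[of n f f'] by simp
qed

text \<open>
  The projection commutes with the cyclic shift because the condition \<open>x\<^sub>1 \<cdots> x\<^sub>n = 1\<close> is invariant
  under cyclic shifts.
\<close>

lemma proj_rotate1:
  assumes f: "f \<in> words I n" and f': "f' \<in> words I n"
  shows "proj n (rotate1 f) (rotate1 f') = proj n f f'"
proof -
  have "(\<Sum>xs\<in>closed_words n. \<Prod>k<n. R (g, xs ! k) (rotate1 f ! k) (rotate1 f' ! k)) =
      (\<Sum>xs\<in>closed_words n. \<Prod>k<n. R (g, xs ! k) (f ! k) (f' ! k))" for g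
  proof -
    have "bij_betw rotate1 (closed_words n) (closed_words n)"
    proof -
      have "rotate1 ` closed_words n \<subseteq> closed_words n"
        by (auto simp: closed_words_def words_def lprod_rotate1)
      moreover have "inj_on rotate1 (closed_words n)"
        using inj_rotate1 by (auto intro: inj_on_subset)
      ultimately show ?thesis
        using finite_closed_words by (simp add: bij_betw_def endo_inj_surj)
    qed
    hence "(\<Sum>xs\<in>closed_words n. \<Prod>k<n. R (g, xs ! k) (rotate1 f ! k) (rotate1 f' ! k)) =
        (\<Sum>xs\<in>closed_words n. \<Prod>k<n. R (g, rotate1 xs ! k) (rotate1 f ! k) (rotate1 f' ! k))"
      by (rule sum.reindex_bij_betw[symmetric])
    also have "\<dots> = (\<Sum>xs\<in>closed_words n. \<Prod>k<n. R (g, xs ! k) (f ! k) (f' ! k))"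
      using f f' by (intro sum.cong refl prod_rotate1) (auto simp: closed_words_def words_def)
    finally show ?thesis .
  qed
  thus ?thesis by (simp add: proj_def)
qed

lemma indicator_sum_eq_trace:
  assumes "n > 0"
  shows "indicator_sum n = mattrace (words I n) (\<lambda>f f'. proj n f (rotate1 f'))"
proof -
  have "(\<Sum>g\<in>carrier G. \<Sum>xs\<in>closed_words n. mattrace I (matprod I (map (\<lambda>x. R (g, x)) xs))) =
      (\<Sum>g\<in>carrier G. \<Sum>xs\<in>closed_words n. \<Sum>f\<in>words I n. \<Prod>k<n. R (g, xs ! k) (f ! k) (rotate1 f ! k))"
    using assms by (intro sum.cong refl)
      (simp add: mattrace_matprod[OF finite_index, of _ n] closed_words_def words_def)
  also have "\<dots> = (\<Sum>f\<in>words I n. \<Sum>g\<in>carrier G. \<Sum>xs\<in>closed_words n. \<Prod>k<n. R (g, xs ! k) (f ! k) (rotate1 f ! k))"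
    by (simp only: sum.swap[of _ "words I n"])
  finally show ?thesis
    by (simp add: indicator_sum_def mattrace_def proj_def sum_divide_distrib[symmetric])
qed

text \<open>
  The matrix \<open>Q\<close> is the projection followed by the cyclic shift. As the two commute, its \<open>r\<close>-th
  power is the projection followed by the \<open>r\<close>-fold shift, and \<open>Q\<^sup>n\<^sup>+\<^sup>1 = Q\<close>.
\<close>

lemma indicator_sum_algebraic_int:
  assumes n: "n > 0"
  shows "algebraic_int (indicator_sum n)"
proof -
  let ?Q = "\<lambda>f f'. proj n f (rotate1 f')"
  let ?W = "words I n"
  have rot: "bij_betw (rotate r) ?W ?W" for r
  proof -
    have "rotate r ` ?W \<subseteq> ?W" by (auto simp: words_def)
    moreover have "inj_on (rotate r) ?W" unfolding rotate_def using inj_fn[OF inj_rotate1] by (auto intro: inj_on_subset)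
    ultimately show ?thesis
      using finite_words[OF finite_index] by (simp add: bij_betw_def endo_inj_surj)
  qed
  have rotW: "rotate r f \<in> ?W" if "f \<in> ?W" for r f using that by (simp add: words_def)
  have proj_rotate: "proj n (rotate r f) (rotate r f') = proj n f f'" if "f \<in> ?W" "f' \<in> ?W" for r f f'
  proof (induction r)
    case (Suc r)
    thus ?case using proj_rotate1[OF rotW[OF that(1)] rotW[OF that(2)], of r r] by simp
  qed simp
  have pow: "matpow ?W ?Q (Suc r) f f' = proj n f (rotate (Suc r) f')" if "f \<in> ?W" "f' \<in> ?W" for r f f'
    using that(2)
  proof (induction r arbitrary: f')
    case 0
    thus ?case using that(1) finite_words[OF finite_index, of n]
      by (simp add: matmul_def if_distrib[of "\<lambda>c. c * _"] sum.delta cong: if_cong)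
  next
    case (Suc r)
    have "matpow ?W ?Q (Suc (Suc r)) f f' = (\<Sum>w\<in>?W. matpow ?W ?Q (Suc r) f w * ?Q w f')"
      by (subst matpow.simps(2)) (simp only: matmul_def)
    also have "\<dots> = (\<Sum>w\<in>?W. proj n f (rotate (Suc r) w) * proj n (rotate (Suc r) w) (rotate (Suc r) (rotate1 f')))"
    proof (rule sum.cong[OF refl])
      fix w assume w: "w \<in> ?W"
      have "rotate1 f' \<in> ?W" using Suc.prems by (simp add: words_def)
      from Suc.IH[OF w] proj_rotate[OF w this, of "Suc r"]
      show "matpow ?W ?Q (Suc r) f w * ?Q w f' =
          proj n f (rotate (Suc r) w) * proj n (rotate (Suc r) w) (rotate (Suc r) (rotate1 f'))"
        by (simp only:)
    qed
    also have "\<dots> = (\<Sum>w\<in>?W. proj n f w * proj n w (rotate (Suc r) (rotate1 f')))"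
      by (rule sum.reindex_bij_betw[OF rot])
    also have "\<dots> = proj n f (rotate (Suc r) (rotate1 f'))"
      using proj_idempotent[OF that(1), of "rotate (Suc r) (rotate1 f')"] Suc.prems
      by (simp add: matmul_def words_def)
    also have "rotate (Suc r) (rotate1 f') = rotate (Suc (Suc r)) f'"
      by (simp add: rotate_def funpow_swap1)
    finally show ?case .
  qed
  have "matpow ?W ?Q (Suc n) f f' = ?Q f f'" if "f \<in> ?W" "f' \<in> ?W" for f f'
  proof -
    have "rotate (Suc n) f' = rotate1 f'" using that(2) by (simp add: words_def)
    thus ?thesis using pow[OF that, of n] by (simp only:)
  qed
  from mattrace_potent[OF finite_words[OF finite_index] this] obtain as where
    "\<forall>a\<in>set as. a ^ Suc n = a" "mattrace ?W ?Q = sum_list as" by blast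
  thus ?thesis using algebraic_int_sum_roots_of_unity[of n as] n indicator_sum_eq_trace[OF n] by simp
qed

lemma matprod_R:
  assumes g: "g \<in> carrier G" and xs: "set xs \<subseteq> carrier G" "length xs = Suc m" and ij: "i \<in> I" "j \<in> I"
  shows "matprod I (map (\<lambda>x. R (g, x)) xs) i j =
    (if xs = conj_word g m (last xs) then R (g [^] Suc m, last xs) i j else 0)"
  using xs ij(1)
proof (induction m arbitrary: xs i)
  case 0
  then obtain x where "xs = [x]" by (auto simp: length_Suc_conv)
  thus ?case using 0 g ij finite_index by (simp add: matprod_single)
next
  case (Suc m)
  then obtain y ys where xs: "xs = y # ys" "length ys = Suc m" "y \<in> carrier G" "set ys \<subseteq> carrier G"
    by (auto simp: length_Suc_conv)
  hence l: "last xs = last ys" "last ys \<in> carrier G"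
    using subsetD[OF xs(4) last_in_set] by force+
  have "matprod I (map (\<lambda>x. R (g, x)) xs) i j =
      (\<Sum>k\<in>I. R (g, y) i k * (if ys = conj_word g m (last ys) then R (g [^] Suc m, last ys) k j else 0))"
    unfolding xs(1) list.map matprod_Cons by (intro sum.cong refl) (simp only: Suc.IH[OF xs(4,2)])
  also have "\<dots> = (if ys = conj_word g m (last ys) then matmul I (R (g, y)) (R (g [^] Suc m, last ys)) i j else 0)"
    by (simp add: matmul_def)
  also have "\<dots> = (if ys = conj_word g m (last ys) then
      (if y = g [^] Suc m \<otimes> last ys \<otimes> inv (g [^] Suc m) then R (g \<otimes> g [^] Suc m, last ys) i j else 0) else 0)"
    by (subst R_mult) (use g xs(3) l(2) Suc.prems(3) ij(2) in simp_all)
  also have "g \<otimes> g [^] Suc m = g [^] Suc (Suc m)" using g by (metis nat_pow_Suc2)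
  finally show ?case unfolding l(1) unfolding xs(1) by simp
qed

text \<open>
  Only the words \<open>conj_word g (n - 1) x\<close> survive. Such a word has product \<open>g\<^sup>n (g\<^sup>-\<^sup>1 x)\<^sup>n\<close>, which is \<open>1\<close>
  exactly if \<open>(x\<^sup>-\<^sup>1 g)\<^sup>n = g\<^sup>n\<close>; the terms are then collected by the value \<open>z = g\<^sup>n\<close>.
\<close>

lemma indicator_sum_eq:
  assumes n: "n > 0"
  shows "indicator_sum n =
    (\<Sum>x\<in>carrier G. \<Sum>z\<in>carrier G. of_nat (card (root_pairs n x z)) * mattrace I (R (z, x))) / cardG"
proof -
  from n obtain m where m: "n = Suc m" by (cases n) auto
  let ?C = "carrier G"
  have inner: "(\<Sum>xs\<in>closed_words n. mattrace I (matprod I (map (\<lambda>x. R (g, x)) xs))) =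
      (\<Sum>x\<in>?C. if (inv x \<otimes> g) [^] n = g [^] n then mattrace I (R (g [^] n, x)) else 0)"
    if g: "g \<in> ?C" for g
  proof -
    have "(\<Sum>xs\<in>closed_words n. mattrace I (matprod I (map (\<lambda>x. R (g, x)) xs))) =
        (\<Sum>xs\<in>closed_words n. if xs = conj_word g m (last xs) then mattrace I (R (g [^] n, last xs)) else 0)"
      by (intro sum.cong refl)
        (auto simp: mattrace_def closed_words_def words_def m matprod_R[OF g] simp del: nat_pow_Suc intro!: sum.cong sum.neutral)
    also have "\<dots> = (\<Sum>xs\<in>{xs \<in> closed_words n. xs = conj_word g m (last xs)}. mattrace I (R (g [^] n, last xs)))"
      by (rule sum.inter_filter[symmetric, OF finite_closed_words])
    also have "\<dots> = (\<Sum>x\<in>{x \<in> ?C. (inv x \<otimes> g) [^] n = g [^] n}. mattrace I (R (g [^] n, x)))"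
    proof (rule sum.reindex_bij_witness[of _ "conj_word g m" last])
      fix xs assume xs: "xs \<in> {xs \<in> closed_words n. xs = conj_word g m (last xs)}"
      hence l: "last xs \<in> ?C" using n by (auto simp: closed_words_def words_def intro!: subsetD[OF _ last_in_set])
      show "conj_word g m (last xs) = xs" using xs by simp
      have "lprod xs = \<one>" using xs by (auto simp: closed_words_def)
      hence "g [^] n \<otimes> (inv g \<otimes> last xs) [^] n = \<one>"
        using conj_word_props(4)[OF g l, of m] xs m by simp
      thus "last xs \<in> {x \<in> ?C. (inv x \<otimes> g) [^] n = g [^] n}"
        using nat_pow_inv_mult_iff[OF g l] l by simp
    next
      fix x assume "x \<in> {x \<in> ?C. (inv x \<otimes> g) [^] n = g [^] n}"
      hence x: "x \<in> ?C" and "g [^] n \<otimes> (inv g \<otimes> x) [^] n = \<one>"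
        using nat_pow_inv_mult_iff[OF g] by auto
      thus "conj_word g m x \<in> {xs \<in> closed_words n. xs = conj_word g m (last xs)}"
        using conj_word_props[OF g x, of m] m by (auto simp: closed_words_def words_def)
      show "last (conj_word g m x) = x" by (rule conj_word_props(3)[OF g x])
    qed simp
    also have "\<dots> = (\<Sum>x\<in>?C. if (inv x \<otimes> g) [^] n = g [^] n then mattrace I (R (g [^] n, x)) else 0)"
      by (rule sum.inter_filter[OF finite_carrier])
    finally show ?thesis .
  qed
  have outer: "(\<Sum>g\<in>?C. if (inv x \<otimes> g) [^] n = g [^] n then mattrace I (R (g [^] n, x)) else 0) =
      (\<Sum>z\<in>?C. of_nat (card (root_pairs n x z)) * mattrace I (R (z, x)))" for x
  proof -
    have "(\<Sum>g\<in>?C. if (inv x \<otimes> g) [^] n = g [^] n then mattrace I (R (g [^] n, x)) else 0) =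
        (\<Sum>z\<in>?C. \<Sum>g\<in>{g \<in> ?C. g [^] n = z}. if (inv x \<otimes> g) [^] n = g [^] n then mattrace I (R (g [^] n, x)) else 0)"
      by (rule sum.group[symmetric]) (auto simp: finite_carrier)
    also have "\<dots> = (\<Sum>z\<in>?C. \<Sum>g\<in>root_pairs n x z. mattrace I (R (z, x)))"
      by (rule sum.cong[OF refl], rule sum.mono_neutral_cong_right)
        (auto simp: finite_carrier root_pairs_def)
    finally show ?thesis by simp
  qed
  have "indicator_sum n = (\<Sum>g\<in>?C. \<Sum>x\<in>?C. if (inv x \<otimes> g) [^] n = g [^] n then mattrace I (R (g [^] n, x)) else 0) / cardG"
    unfolding indicator_sum_def by (simp add: inner)
  also have "\<dots> = (\<Sum>x\<in>?C. \<Sum>g\<in>?C. if (inv x \<otimes> g) [^] n = g [^] n then mattrace I (R (g [^] n, x)) else 0) / cardG"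
    by (subst sum.swap) simp
  finally show ?thesis by (simp only: outer)
qed

text \<open>
  The average of \<open>w \<delta>\<^sub>x\<close> over a subgroup centralising \<open>x\<close> is an idempotent of the double, so it has an
  integral trace.
\<close>

lemma sum_trace_subgroup:
  assumes C: "subgroup C G" and x: "x \<in> carrier G" and comm: "\<And>w. w \<in> C \<Longrightarrow> w \<otimes> x = x \<otimes> w"
  shows "(\<Sum>w\<in>C. mattrace I (R (w, x))) \<in> \<int>"
proof -
  let ?c = "of_nat (card C) :: complex"
  have sub: "C \<subseteq> carrier G" by (rule subgroup.subset[OF C])
  have fin: "finite C" using sub finite_carrier by (rule finite_subset)
  have c: "?c \<noteq> 0" using fin subgroup.one_closed[OF C] by (auto simp: card_eq_0_iff)
  define E where "E i j = (\<Sum>w\<in>C. R (w, x) i j) / ?c" for i j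
  have "matmul I E E i j = E i j" if ij: "i \<in> I" "j \<in> I" for i j
  proof -
    have "matmul I E E i j = (\<Sum>w\<in>C. \<Sum>v\<in>C. matmul I (R (w, x)) (R (v, x)) i j) / (?c * ?c)"
      unfolding matmul_def E_def times_divide_times_eq sum_divide_distrib[symmetric] sum_product
      by (simp only: sum.swap[of _ _ I])
    also have "(\<Sum>w\<in>C. \<Sum>v\<in>C. matmul I (R (w, x)) (R (v, x)) i j) = (\<Sum>w\<in>C. \<Sum>v\<in>C. R (w \<otimes> v, x) i j)"
    proof (intro sum.cong refl)
      fix w v assume wv: "w \<in> C" "v \<in> C"
      have "x = v \<otimes> x \<otimes> inv v" using comm[OF wv(2)] wv sub x by (simp add: m_assoc subset_iff)
      thus "matmul I (R (w, x)) (R (v, x)) i j = R (w \<otimes> v, x) i j"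
        using R_mult[of w x v x i j] wv sub x ij by auto
    qed
    also have "\<dots> = (\<Sum>w\<in>C. \<Sum>v\<in>C. R (v, x) i j)"
    proof (rule sum.cong[OF refl])
      fix w assume w: "w \<in> C"
      show "(\<Sum>v\<in>C. R (w \<otimes> v, x) i j) = (\<Sum>v\<in>C. R (v, x) i j)"
        by (rule sum.reindex_bij_witness[of _ "\<lambda>v. inv w \<otimes> v" "\<lambda>v. w \<otimes> v"])
          (use w sub C in \<open>auto simp: m_assoc[symmetric] subset_iff subgroup.m_closed subgroup.m_inv_closed\<close>)
    qed
    finally show ?thesis using c unfolding E_def[of i j] by simp
  qed
  hence "mattrace I E \<in> \<int>" by (rule mattrace_idempotent[OF finite_index])
  moreover have "(\<Sum>w\<in>C. mattrace I (R (w, x))) = ?c * mattrace I E"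
    using c unfolding mattrace_def E_def sum_divide_distrib[symmetric] by (subst sum.swap) simp
  ultimately show ?thesis by (auto intro: Ints_mult)
qed

text \<open>
  A cyclic group is the disjoint union of the sets of generators of its subgroups; the sum over the
  whole group is an integer, so induction on the order leaves an integer for its own generators.
\<close>

lemma sum_trace_generators:
  assumes x: "x \<in> carrier G" and z: "z \<in> carrier G" and comm: "z \<otimes> x = x \<otimes> z"
  shows "(\<Sum>w | w \<in> carrier G \<and> generate G {w} = generate G {z}. mattrace I (R (w, x))) \<in> \<int>"
  using z comm
proof (induction "card (generate G {z})" arbitrary: z rule: less_induct)
  case less
  note z = less.prems(1)
  define C where "C = generate G {z}"
  have C: "subgroup C G" unfolding C_def using z by (intro generate_is_subgroup) simp
  have sub: "C \<subseteq> carrier G" by (rule subgroup.subset[OF C])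
  have fin: "finite C" using sub finite_carrier by (rule finite_subset)
  have genC: "generate G {w} \<subseteq> C" if "w \<in> C" for w
    using generate_subgroup_incl[OF _ C, of "{w}"] that by simp
  have commC: "w \<otimes> x = x \<otimes> w" if "w \<in> C" for w
  proof -
    from that obtain k :: int where w: "w = z [^] k"
      using generate_pow[OF z] by (auto simp: C_def)
    have pow: "z [^] r \<otimes> x = x \<otimes> z [^] r" for r :: nat
      using less.prems x by (induction r) (simp_all, metis m_assoc nat_pow_closed)
    have inv: "inv y \<otimes> x = x \<otimes> inv y" if "y \<otimes> x = x \<otimes> y" "y \<in> carrier G" for y
      using that x by (metis inv_closed inv_solve_left inv_solve_right m_assoc m_closed)
    show ?thesis unfolding w int_pow_def2
      using inv[OF pow nat_pow_closed[OF z]] pow by (cases "k < 0") (simp_all only: if_True if_False)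
  qed
  let ?T = "\<lambda>D. \<Sum>w | w \<in> carrier G \<and> generate G {w} = D. mattrace I (R (w, x))"
  let ?gen = "\<lambda>w. generate G {w}"
  have "(\<Sum>w\<in>C. mattrace I (R (w, x))) = (\<Sum>D\<in>?gen ` C. \<Sum>w | w \<in> C \<and> ?gen w = D. mattrace I (R (w, x)))"
    by (rule sum.image_gen[OF fin])
  also have "\<dots> = (\<Sum>D\<in>?gen ` C. ?T D)"
  proof (intro sum.cong refl)
    fix D w assume "D \<in> ?gen ` C"
    then obtain v where v: "v \<in> C" "D = ?gen v" by blast
    show "{w. w \<in> C \<and> ?gen w = D} = {w. w \<in> carrier G \<and> ?gen w = D}"
      using sub genC[OF v(1)] generate.incl[of _ "{_}" G] by (auto simp: v(2))
  qed
  also have "\<dots> = ?T C + (\<Sum>D\<in>?gen ` C - {C}. ?T D)"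
    using fin by (intro sum.remove) (auto simp: C_def intro!: imageI generate.incl)
  finally have split: "?T C = (\<Sum>w\<in>C. mattrace I (R (w, x))) - (\<Sum>D\<in>?gen ` C - {C}. ?T D)" by simp
  have "?T D \<in> \<int>" if "D \<in> ?gen ` C - {C}" for D
  proof -
    from that obtain v where v: "v \<in> C" "D = ?gen v" "?gen v \<noteq> C" by blast
    have "card (?gen v) < card C" using genC[OF v(1)] v(3) fin by (intro psubset_card_mono) auto
    thus ?thesis
      using less.hyps[of v] v sub commC[OF v(1)] by (auto simp: C_def)
  qed
  hence "(\<Sum>D\<in>?gen ` C - {C}. ?T D) \<in> \<int>" by (rule Ints_sum)
  moreover have "(\<Sum>w\<in>C. mattrace I (R (w, x))) \<in> \<int>" by (rule sum_trace_subgroup[OF C x commC])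
  ultimately have "?T C \<in> \<int>" unfolding split by (intro Ints_diff)
  thus ?case unfolding C_def .
qed

text \<open>
  Under the hypothesis the sum in \<open>indicator_sum_eq\<close> can be grouped by cyclic subgroups, so the
  indicator is rational; a rational algebraic integer is an integer.
\<close>

theorem indicator_sum_Ints:
  assumes n: "n > 0"
    and inv: "\<And>x z z'. x \<in> carrier G \<Longrightarrow> z \<in> carrier G \<Longrightarrow> z' \<in> carrier G \<Longrightarrow>
      generate G {z} = generate G {z'} \<Longrightarrow> card (root_pairs n x z) = card (root_pairs n x z')"
  shows "indicator_sum n \<in> \<int>"
proof -
  let ?C = "carrier G" and ?gen = "\<lambda>w. generate G {w}"
  have "(\<Sum>z\<in>?C. of_nat (card (root_pairs n x z)) * mattrace I (R (z, x))) \<in> \<int>" if x: "x \<in> ?C" for x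
  proof -
    have "(\<Sum>z\<in>?C. of_nat (card (root_pairs n x z)) * mattrace I (R (z, x))) =
        (\<Sum>D\<in>?gen ` ?C. \<Sum>z | z \<in> ?C \<and> ?gen z = D. of_nat (card (root_pairs n x z)) * mattrace I (R (z, x)))"
      by (rule sum.image_gen[OF finite_carrier])
    also have "\<dots> \<in> \<int>"
    proof (rule Ints_sum)
      fix D assume "D \<in> ?gen ` ?C"
      then obtain v where v: "v \<in> ?C" "D = ?gen v" by blast
      have "(\<Sum>z | z \<in> ?C \<and> ?gen z = D. of_nat (card (root_pairs n x z)) * mattrace I (R (z, x))) =
          of_nat (card (root_pairs n x v)) * (\<Sum>z | z \<in> ?C \<and> ?gen z = ?gen v. mattrace I (R (z, x)))"
        unfolding sum_distrib_left v(2) by (intro sum.cong refl) (simp add: inv[OF x _ v(1)])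
      also have "\<dots> \<in> \<int>"
      proof (cases "root_pairs n x v = {}")
        case False
        from sum_trace_generators[OF x v(1) root_pairs_commute[OF x False]] show ?thesis
          by (intro Ints_mult) auto
      qed simp
      finally show "(\<Sum>z | z \<in> ?C \<and> ?gen z = D. of_nat (card (root_pairs n x z)) * mattrace I (R (z, x))) \<in> \<int>" .
    qed
    finally show ?thesis .
  qed
  hence "(\<Sum>x\<in>?C. \<Sum>z\<in>?C. of_nat (card (root_pairs n x z)) * mattrace I (R (z, x))) \<in> \<int>"
    by (rule Ints_sum)
  hence "indicator_sum n \<in> \<rat>"
    unfolding indicator_sum_eq[OF n] using Ints_subset_Rats by (intro Rats_divide) auto
  with indicator_sum_algebraic_int[OF n] show ?thesis by (rule rational_algebraic_int_is_int)
qed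

end

section \<open>Integral weights on the orbits of two permutations\<close>

lemma sum_fibre_split:
  fixes h :: "'x \<Rightarrow> 'r::comm_monoid_add"
  assumes "finite S" and "q i \<noteq> q j"
  shows "(\<Sum>x\<in>{x\<in>S. q x = q i \<or> q x = q j}. h x) =
    (\<Sum>x\<in>{x\<in>S. q x = q i}. h x) + (\<Sum>x\<in>{x\<in>S. q x = q j}. h x)"
  using assms by (subst sum.union_disjoint[symmetric]) (auto intro!: sum.cong)

text \<open>
  Real weights on the edges of a bipartite multigraph (the edges are the elements of \<open>X\<close>, the vertices
  the classes of \<open>p\<close> and of \<open>q\<close>) can be replaced by integers with the same vertex sums, as soon as these
  sums are integers. If two \<open>q\<close>-classes meet a common \<open>p\<close>-class, merge them: a solution of the merged
  problem is repaired by moving an amount \<open>s\<close> between two edges of that \<open>p\<close>-class, one from each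
  of the merged classes. If no such classes exist, every \<open>q\<close>-class is a union of \<open>p\<close>-classes, and each
  \<open>p\<close>-class sum can be put on a single edge.
\<close>

lemma integral_rounding:
  fixes w :: "'x \<Rightarrow> real" and p :: "'x \<Rightarrow> 'b" and q :: "'x \<Rightarrow> 'c"
  assumes fin: "finite X"
    and "\<And>i. i \<in> X \<Longrightarrow> (\<Sum>j | j \<in> X \<and> p j = p i. w j) \<in> \<int>"
    and "\<And>i. i \<in> X \<Longrightarrow> (\<Sum>j | j \<in> X \<and> q j = q i. w j) \<in> \<int>"
  shows "\<exists>t :: 'x \<Rightarrow> int. \<forall>i\<in>X.
    real_of_int (\<Sum>j | j \<in> X \<and> p j = p i. t j) = (\<Sum>j | j \<in> X \<and> p j = p i. w j) \<and>
    real_of_int (\<Sum>j | j \<in> X \<and> q j = q i. t j) = (\<Sum>j | j \<in> X \<and> q j = q i. w j)"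
  using assms(2,3)
proof (induction "card (q ` X)" arbitrary: q rule: less_induct)
  case less
  show ?case
  proof (cases "\<forall>i\<in>X. \<forall>j\<in>X. p i = p j \<longrightarrow> q i = q j")
    case True
    define r where "r i = (SOME j. j \<in> X \<and> p j = p i)" for i
    have r: "r i \<in> X" "p (r i) = p i" if "i \<in> X" for i
      using someI[of "\<lambda>j. j \<in> X \<and> p j = p i" i] that unfolding r_def by blast+
    have r_cong: "r i = r j" if "p i = p j" for i j using that by (simp add: r_def)
    define t where "t i = (if r i = i then \<lfloor>\<Sum>j | j \<in> X \<and> p j = p i. w j\<rfloor> else 0)" for i
    have P: "real_of_int (\<Sum>j | j \<in> X \<and> p j = p i. t j) = (\<Sum>j | j \<in> X \<and> p j = p i. w j)"
      if i: "i \<in> X" for i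
    proof -
      have "(\<Sum>j | j \<in> X \<and> p j = p i. t j) =
          (\<Sum>j | j \<in> X \<and> p j = p i. if j = r i then \<lfloor>\<Sum>j | j \<in> X \<and> p j = p i. w j\<rfloor> else 0)"
        by (intro sum.cong refl) (auto simp: t_def dest: r_cong)
      also have "\<dots> = \<lfloor>\<Sum>j | j \<in> X \<and> p j = p i. w j\<rfloor>"
        using fin r[OF i] by (simp add: sum.delta)
      finally show ?thesis using less.prems(1)[OF i] by simp
    qed
    have "real_of_int (\<Sum>j | j \<in> X \<and> q j = q i. t j) = (\<Sum>j | j \<in> X \<and> q j = q i. w j)"
      if i: "i \<in> X" for i
    proof -
      let ?S = "{j. j \<in> X \<and> q j = q i}"
      have fS: "finite ?S" using fin by simp
      have fib: "{j \<in> ?S. p j = b} = {j. j \<in> X \<and> p j = b}" if "b \<in> p ` ?S" for b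
      proof -
        from that obtain k where "k \<in> X" "q k = q i" "b = p k" by blast
        thus ?thesis using True by fastforce
      qed
      have "real_of_int (\<Sum>j\<in>?S. t j) = (\<Sum>j\<in>?S. real_of_int (t j))" by simp
      also have "\<dots> = (\<Sum>b\<in>p ` ?S. \<Sum>j | j \<in> ?S \<and> p j = b. real_of_int (t j))"
        by (rule sum.image_gen[OF fS])
      also have "\<dots> = (\<Sum>b\<in>p ` ?S. \<Sum>j | j \<in> ?S \<and> p j = b. w j)"
      proof (rule sum.cong[OF refl])
        fix b assume b: "b \<in> p ` ?S"
        then obtain k where "k \<in> X" "b = p k" by auto
        thus "(\<Sum>j | j \<in> ?S \<and> p j = b. real_of_int (t j)) = (\<Sum>j | j \<in> ?S \<and> p j = b. w j)"
          using P[of k] fib[OF b] by simp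
      qed
      also have "\<dots> = (\<Sum>j\<in>?S. w j)" by (rule sum.image_gen[OF fS, symmetric])
      finally show ?thesis .
    qed
    with P show ?thesis by blast
  next
    case False
    then obtain i j where ij: "i \<in> X" "j \<in> X" "p i = p j" "q i \<noteq> q j" by blast
    define q' where "q' x = (if q x = q j then q i else q x)" for x
    have "q' ` X \<subseteq> q ` X - {q j}" using ij by (auto simp: q'_def)
    hence "card (q' ` X) < card (q ` X)"
      using ij fin by (intro psubset_card_mono) auto
    moreover have merged: "{x. x \<in> X \<and> q' x = q' y} =
        (if q y = q i \<or> q y = q j then {x\<in>X. q x = q i \<or> q x = q j} else {x. x \<in> X \<and> q x = q y})" for y
      by (auto simp: q'_def)
    have "(\<Sum>x | x \<in> X \<and> q' x = q' y. w x) \<in> \<int>" if "y \<in> X" for y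
      using less.prems(2)[of i] less.prems(2)[of j] less.prems(2)[OF that] ij fin
      by (simp add: merged sum_fibre_split del: Collect_disj_eq)
    ultimately obtain t :: "'x \<Rightarrow> int" where t: "\<forall>y\<in>X.
        real_of_int (\<Sum>x | x \<in> X \<and> p x = p y. t x) = (\<Sum>x | x \<in> X \<and> p x = p y. w x) \<and>
        real_of_int (\<Sum>x | x \<in> X \<and> q' x = q' y. t x) = (\<Sum>x | x \<in> X \<and> q' x = q' y. w x)"
      using less.hyps[of q'] less.prems(1) by blast
    \<comment> \<open>the amount by which the solution of the merged problem falls short on the class of \<open>i\<close>\<close>
    define s where "s = \<lfloor>\<Sum>x | x \<in> X \<and> q x = q i. w x\<rfloor> - (\<Sum>x | x \<in> X \<and> q x = q i. t x)"
    define u where "u x = t x + (if x = i then s else 0) - (if x = j then s else 0)" for x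
    have u: "(\<Sum>x\<in>S. u x) = (\<Sum>x\<in>S. t x) + (if i \<in> S then s else 0) - (if j \<in> S then s else 0)"
      if "S \<subseteq> X" for S
      using finite_subset[OF that fin] by (simp add: u_def sum.distrib sum_subtractf)
    have tsplit: "real_of_int (\<Sum>x | x \<in> X \<and> q x = q i. t x) + real_of_int (\<Sum>x | x \<in> X \<and> q x = q j. t x)
        = (\<Sum>x | x \<in> X \<and> q x = q i. w x) + (\<Sum>x | x \<in> X \<and> q x = q j. w x)"
      using bspec[OF t ij(1)] fin ij(4) by (simp add: merged sum_fibre_split del: Collect_disj_eq)
    have si: "real_of_int s = (\<Sum>x | x \<in> X \<and> q x = q i. w x) - real_of_int (\<Sum>x | x \<in> X \<and> q x = q i. t x)"
      using less.prems(2)[OF ij(1)] by (simp add: s_def)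
    have "real_of_int (\<Sum>x | x \<in> X \<and> p x = p y. u x) = (\<Sum>x | x \<in> X \<and> p x = p y. w x)"
      if "y \<in> X" for y
      using t that ij by (subst u) auto
    moreover have "real_of_int (\<Sum>x | x \<in> X \<and> q x = q y. u x) = (\<Sum>x | x \<in> X \<and> q x = q y. w x)"
      if y: "y \<in> X" for y
    proof -
      consider "q y = q i" | "q y = q j" | "q y \<noteq> q i" "q y \<noteq> q j" by blast
      thus ?thesis
      proof cases
        case 1
        thus ?thesis using ij si by (subst u) auto
      next
        case 2
        thus ?thesis using ij si tsplit by (subst u) auto
      next
        case 3
        hence "{x. x \<in> X \<and> q' x = q' y} = {x. x \<in> X \<and> q x = q y}" by (simp add: merged)
        thus ?thesis using 3 t y by (subst u) auto
      qed
    qed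
    ultimately show ?thesis by blast
  qed
qed

definition orb :: "('x \<Rightarrow> 'x) \<Rightarrow> 'x \<Rightarrow> 'x set" where
  "orb f i = range (\<lambda>r. (f ^^ r) i)"

lemma orb_self: "i \<in> orb f i"
  unfolding orb_def by (rule range_eqI[of _ _ 0]) simp

lemma orb_funpow: "(f ^^ r) i \<in> orb f i"
  unfolding orb_def by blast

lemma orb_eq_iff:
  assumes "permutation f"
  shows "orb f j = orb f i \<longleftrightarrow> j \<in> orb f i"
proof
  assume "j \<in> orb f i"
  then obtain r where j: "j = (f ^^ r) i" by (auto simp: orb_def)
  define c where "c = least_power f i"
  note c = least_power_of_permutation[OF assms, of i, folded c_def]
  have "r \<le> c * r" using c(2) by simp
  then obtain b where b: "c * r = b + r" by (metis le_add_diff_inverse2)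
  have "(f ^^ (c * r)) i = i" using least_power_dvd[OF assms, of i "c * r"] by (simp add: c_def)
  hence ret: "i = (f ^^ b) j" by (simp add: b j funpow_add)
  show "orb f j = orb f i"
  proof
    show "orb f j \<subseteq> orb f i"
      unfolding orb_def j by (auto simp flip: funpow_add comp_apply[of "f ^^ _" "f ^^ _"])
    show "orb f i \<subseteq> orb f j"
      unfolding orb_def
      by (subst ret) (auto simp flip: funpow_add comp_apply[of "f ^^ _" "f ^^ _"])
  qed
next
  assume "orb f j = orb f i"
  thus "j \<in> orb f i" using orb_self[of j f] by simp
qed

lemma orb_step: "permutation f \<Longrightarrow> orb f (f i) = orb f i"
  using orb_eq_iff[of f "f i" i] orb_funpow[of 1 f i] by simp

lemma orb_eq_least_power_image:
  assumes "permutation f"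
  shows "orb f i = (\<lambda>r. (f ^^ r) i) ` {..<least_power f i}"
proof
  let ?c = "least_power f i"
  note c = least_power_of_permutation[OF assms, of i]
  show "orb f i \<subseteq> (\<lambda>r. (f ^^ r) i) ` {..<?c}"
  proof
    fix j assume "j \<in> orb f i"
    then obtain r where j: "j = (f ^^ r) i" by (auto simp: orb_def)
    have "j = (f ^^ (r mod ?c + ?c * (r div ?c))) i" by (simp add: j)
    also have "\<dots> = (f ^^ (r mod ?c)) ((f ^^ (?c * (r div ?c))) i)"
      by (simp only: funpow_add comp_apply)
    also have "(f ^^ (?c * (r div ?c))) i = i" using least_power_dvd[OF assms] by (metis dvd_triv_left)
    finally show "j \<in> (\<lambda>r. (f ^^ r) i) ` {..<?c}" using c(2) by auto
  qed
qed (auto simp: orb_def)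

lemma inj_on_orbit:
  assumes "permutation f"
  shows "inj_on (\<lambda>r. (f ^^ r) i) {..<least_power f i}"
  using cycle_of_permutation[OF assms, of i] by (auto simp: distinct_map atLeast0LessThan)

lemma sum_lessThan_add:
  fixes h :: "nat \<Rightarrow> 'r::comm_monoid_add"
  shows "(\<Sum>r<a + b. h r) = (\<Sum>r<a. h r) + (\<Sum>r<b. h (a + r))"
  by (induction b) (simp_all add: add_ac)

lemma sum_blocks:
  fixes h :: "nat \<Rightarrow> 'r::comm_monoid_add"
  shows "(\<Sum>s<q. \<Sum>j<n. h (j + n * s)) = (\<Sum>r<q * n. h r)"
proof (induction q)
  case (Suc q)
  have "(\<Sum>r<Suc q * n. h r) = (\<Sum>r<q * n + n. h r)" by (simp add: add.commute)
  also have "\<dots> = (\<Sum>r<q * n. h r) + (\<Sum>j<n. h (j + n * q))"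
    unfolding sum_lessThan_add by (simp add: add.commute mult.commute)
  finally show ?case using Suc by simp
qed simp

text \<open>
  Going \<open>M\<close> times around a cycle visits each of its points \<open>M\<close> times.
\<close>

lemma sum_along_orbit:
  fixes h :: "'x \<Rightarrow> 'r::comm_semiring_1"
  assumes f: "permutation f" and K: "K = least_power f i * M"
  shows "(\<Sum>r<K. h ((f ^^ r) i)) = of_nat M * (\<Sum>j\<in>orb f i. h j)"
  unfolding K
proof (induction M)
  case (Suc M)
  let ?c = "least_power f i"
  have "(\<Sum>r<?c * M + ?c. h ((f ^^ r) i)) =
      (\<Sum>r<?c * M. h ((f ^^ r) i)) + (\<Sum>r<?c. h ((f ^^ (?c * M + r)) i))"
    by (rule sum_lessThan_add)
  also have "(\<Sum>r<?c. h ((f ^^ (?c * M + r)) i)) = (\<Sum>r<?c. h ((f ^^ r) i))"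
  proof (intro sum.cong refl)
    fix r
    have "(f ^^ (?c * M + r)) i = (f ^^ r) ((f ^^ (?c * M)) i)"
      by (simp only: add.commute[of _ r] funpow_add comp_apply)
    also have "(f ^^ (?c * M)) i = i" using least_power_dvd[OF f] by (metis dvd_triv_left)
    finally show "h ((f ^^ (?c * M + r)) i) = h ((f ^^ r) i)" by simp
  qed
  also have "\<dots> = (\<Sum>j\<in>orb f i. h j)"
    by (simp add: orb_eq_least_power_image[OF f] sum.reindex[OF inj_on_orbit[OF f]])
  finally show ?case using Suc by (simp add: algebra_simps)
qed simp

text \<open>
  A cycle of length \<open>c\<close> of \<open>f\<close> splits into \<open>gcd c n\<close> cycles of the \<open>n\<close>-th power of \<open>f\<close>.
\<close>

lemma least_power_funpow:
  assumes f: "permutation f" and n: "n > 0"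
  shows "least_power f i = least_power (f ^^ n) i * gcd (least_power f i) n"
proof -
  let ?c = "least_power f i" and ?q = "least_power (f ^^ n) i"
  have c0: "?c > 0" by (rule least_power_of_permutation[OF f])
  have fn: "permutation (f ^^ n)" by (induction n) (simp_all add: permutation_compose f del: comp_apply)
  have q: "?q dvd m \<longleftrightarrow> ?c dvd n * m" for m
    using least_power_dvd[OF fn, of i m] least_power_dvd[OF f, of i "n * m"]
    by (simp add: funpow_mult mult.commute)
  define l where "l = gcd ?c n"
  have l0: "l > 0" using n by (simp add: l_def)
  obtain a b where a: "?c = l * a" and b: "n = l * b" and ab: "coprime a b"
    using gcd_coprime_exists[of ?c n] l0 unfolding l_def by (metis mult.commute less_irrefl)
  have "?q dvd m \<longleftrightarrow> a dvd m" for m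
    unfolding q using l0 ab by (subst a, subst b) (simp add: mult.assoc coprime_dvd_mult_right_iff)
  hence "?q = a" by (meson dvd_antisym dvd_refl)
  thus ?thesis using a by (simp add: l_def mult.commute)
qed

text \<open>
  Here \<open>gcd (least_power \<sigma> i) n\<close> is the number of \<open>\<zeta>\<close>-orbits in the \<open>\<sigma>\<close>-cycle of \<open>i\<close>.
\<close>

definition graded_root :: "'x set \<Rightarrow> nat \<Rightarrow> ('x \<Rightarrow> 'x) \<Rightarrow> ('x \<Rightarrow> nat) \<Rightarrow> ('x \<Rightarrow> 'x) \<Rightarrow> bool" where
  "graded_root X n \<zeta> l \<sigma> \<longleftrightarrow> \<sigma> permutes X \<and> \<sigma> ^^ n = \<zeta> \<and>
     (\<forall>i\<in>X. l (\<sigma> i) = l i \<and> l i dvd gcd (least_power \<sigma> i) n)"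

text \<open>
  A \<open>\<rho>\<close>-cycle through \<open>i\<close> consists of \<open>d\<close> orbits of \<open>\<zeta>\<close>, each of some length \<open>c\<close>. The constant
  weight \<open>1/(c l\<^sub>i)\<close> on its points sums to the integer \<open>d/l\<^sub>i\<close>, so it can be rounded for \<open>\<sigma>\<close> and
  \<open>\<tau>\<close> at once. Adding the rounded weights over each \<open>\<zeta>\<close>-orbit gives \<open>t\<close>.

  The weights serve every \<open>\<rho>\<close> with the same cycle partition as \<open>\<sigma>\<close> or as \<open>\<tau>\<close>: this uniformity makes
  the map \<open>g \<mapsto> g u\<close> below injective.
\<close>

lemma orbit_weights:
  fixes \<sigma> \<tau> \<zeta> :: "'x \<Rightarrow> 'x"
  assumes fin: "finite X" and n: "n > 0"
    and \<sigma>: "graded_root X n \<zeta> l \<sigma>" and \<tau>: "graded_root X n \<zeta> l \<tau>"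
  shows "\<exists>t :: 'x \<Rightarrow> int. (\<forall>i j. orb \<zeta> i = orb \<zeta> j \<longrightarrow> t i = t j) \<and>
    (\<forall>\<rho>. graded_root X n \<zeta> l \<rho> \<longrightarrow> orb \<rho> = orb \<sigma> \<or> orb \<rho> = orb \<tau> \<longrightarrow>
      (\<forall>i\<in>X. (\<Sum>j<n. t ((\<rho> ^^ j) i)) = int (n div l i)))"
proof -
  define w where "w i = 1 / (real (least_power \<zeta> i) * real (l i))" for i
  have perm: "permutation \<rho>" "\<rho> ^^ n = \<zeta>" "(\<rho> ^^ r) i \<in> X"
    "l ((\<rho> ^^ r) i) = l i" "l i dvd gcd (least_power \<rho> i) n"
    if "graded_root X n \<zeta> l \<rho>" "i \<in> X" for \<rho> i r
  proof -
    show p: "permutation \<rho>" "\<rho> ^^ n = \<zeta>" "l i dvd gcd (least_power \<rho> i) n"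
      using that fin by (auto simp: graded_root_def permutation_permutes)
    have "(\<rho> ^^ r) i \<in> X \<and> l ((\<rho> ^^ r) i) = l i"
      using that by (induction r) (auto simp: graded_root_def permutes_in_image)
    thus "(\<rho> ^^ r) i \<in> X" "l ((\<rho> ^^ r) i) = l i" by auto
  qed
  have lp: "least_power \<zeta> ((\<rho> ^^ r) i) = least_power \<zeta> i"
    if "graded_root X n \<zeta> l \<rho>" "i \<in> X" for \<rho> i r
  proof -
    have inj: "inj (\<rho> ^^ r)" using perm(1)[OF that] by (simp add: bij_is_inj inj_fn permutation)
    have "(\<zeta> ^^ m) ((\<rho> ^^ r) i) = (\<rho> ^^ r) ((\<zeta> ^^ m) i)" for m
      unfolding perm(2)[OF that, symmetric] funpow_mult comp_apply[symmetric, of "\<rho> ^^ _" "\<rho> ^^ _"]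
      funpow_add[symmetric] by (simp add: add.commute)
    thus ?thesis unfolding least_power_def by (simp add: inj_eq[OF inj])
  qed
  have cls: "{j. j \<in> X \<and> orb \<rho> j = orb \<rho> i} = orb \<rho> i"
    if "graded_root X n \<zeta> l \<rho>" "i \<in> X" for \<rho> i
    using perm[OF that] unfolding orb_eq_iff[OF perm(1)[OF that]] by (auto simp: orb_def)
  have W: "(\<Sum>j\<in>orb \<rho> i. w j) = real (gcd (least_power \<rho> i) n div l i)"
    if "graded_root X n \<zeta> l \<rho>" "i \<in> X" for \<rho> i
  proof -
    note p = perm[OF that]
    have "w ((\<rho> ^^ r) i) = w i" for r by (simp add: w_def p(4) lp[OF that])
    hence "(\<Sum>j\<in>orb \<rho> i. w j) = real (least_power \<rho> i) * w i"
      using sum_along_orbit[OF p(1), of "least_power \<rho> i" i 1 w] by simp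
    also have "\<dots> = real (gcd (least_power \<rho> i) n) / real (l i)"
    proof -
      have c: "least_power \<rho> i = least_power \<zeta> i * gcd (least_power \<rho> i) n"
        using least_power_funpow[OF p(1) n, of i] p(2) by simp
      have "least_power \<zeta> i > 0"
        using c least_power_of_permutation(2)[OF p(1), of i] by (metis gr0I mult_is_0 less_irrefl)
      thus ?thesis unfolding w_def by (subst (1) c) simp
    qed
    also have "\<dots> = real (gcd (least_power \<rho> i) n div l i)" using p(5) by (simp add: real_of_nat_div)
    finally show ?thesis .
  qed
  have "\<exists>t :: 'x \<Rightarrow> int. \<forall>i\<in>X.
    real_of_int (\<Sum>j | j \<in> X \<and> orb \<sigma> j = orb \<sigma> i. t j) = (\<Sum>j | j \<in> X \<and> orb \<sigma> j = orb \<sigma> i. w j) \<and>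
    real_of_int (\<Sum>j | j \<in> X \<and> orb \<tau> j = orb \<tau> i. t j) = (\<Sum>j | j \<in> X \<and> orb \<tau> j = orb \<tau> i. w j)"
    using fin by (rule integral_rounding) (simp_all add: cls[OF \<sigma>] cls[OF \<tau>] W[OF \<sigma>] W[OF \<tau>])
  then obtain t :: "'x \<Rightarrow> int" where t: "\<forall>i\<in>X.
    real_of_int (\<Sum>j\<in>orb \<sigma> i. t j) = (\<Sum>j\<in>orb \<sigma> i. w j) \<and>
    real_of_int (\<Sum>j\<in>orb \<tau> i. t j) = (\<Sum>j\<in>orb \<tau> i. w j)"
    by (auto simp: cls[OF \<sigma>] cls[OF \<tau>])
  define u where "u i = (\<Sum>j\<in>orb \<zeta> i. t j)" for i
  have "(\<Sum>j<n. u ((\<rho> ^^ j) i)) = int (n div l i)"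
    if \<rho>: "graded_root X n \<zeta> l \<rho>" and or: "orb \<rho> = orb \<sigma> \<or> orb \<rho> = orb \<tau>" and i: "i \<in> X" for \<rho> i
  proof -
    note p = perm[OF \<rho> i]
    let ?c = "least_power \<rho> i" and ?q = "least_power \<zeta> i"
    define g where "g = gcd ?c n"
    have c: "?c = ?q * g" using least_power_funpow[OF p(1) n, of i] p(2) by (simp add: g_def)
    obtain b where b: "n = g * b" unfolding g_def by (metis dvdE gcd_dvd2)
    obtain d where d: "g = l i * d" using p(5) unfolding g_def by (metis dvdE)
    have pz: "permutation \<zeta>"
      using p(1) p(2) fin \<rho> permutes_funpow[of \<rho> X n] unfolding graded_root_def permutation_permutes by blast
    have "u ((\<rho> ^^ j) i) = (\<Sum>s<?q. t ((\<rho> ^^ (j + n * s)) i))" for j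
    proof -
      have "(\<zeta> ^^ s) ((\<rho> ^^ j) i) = (\<rho> ^^ (j + n * s)) i" for s
      proof -
        have "(\<zeta> ^^ s) ((\<rho> ^^ j) i) = (\<rho> ^^ (n * s)) ((\<rho> ^^ j) i)"
          by (simp only: p(2)[symmetric] funpow_mult mult.commute)
        also have "\<dots> = (\<rho> ^^ (n * s + j)) i" by (simp only: funpow_add comp_apply)
        finally show ?thesis by (simp only: add.commute)
      qed
      thus ?thesis
        using sum_along_orbit[OF pz, of ?q "(\<rho> ^^ j) i" 1 t] by (simp add: u_def lp[OF \<rho> i])
    qed
    hence "(\<Sum>j<n. u ((\<rho> ^^ j) i)) = (\<Sum>j<n. \<Sum>s<?q. t ((\<rho> ^^ (j + n * s)) i))" by simp
    also have "\<dots> = (\<Sum>s<?q. \<Sum>j<n. t ((\<rho> ^^ (j + n * s)) i))" by (rule sum.swap)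
    also have "\<dots> = (\<Sum>r<?q * n. t ((\<rho> ^^ r) i))"
      by (rule sum_blocks)
    also have "\<dots> = int b * (\<Sum>j\<in>orb \<rho> i. t j)"
      by (rule sum_along_orbit[OF p(1), of _ i b t, unfolded of_nat_id]) (simp add: c b)
    also have "(\<Sum>j\<in>orb \<rho> i. t j) = int (g div l i)"
    proof -
      have "real_of_int (\<Sum>j\<in>orb \<rho> i. t j) = (\<Sum>j\<in>orb \<rho> i. w j)" using t i or by auto
      also have "\<dots> = real_of_int (int (g div l i))" using W[OF \<rho> i] by (simp add: g_def)
      finally show ?thesis unfolding of_int_eq_iff .
    qed
    also have "int b * int (g div l i) = int (n div l i)"
    proof -
      have "l i > 0" using d b n by (auto intro!: gr0I)
      thus ?thesis by (simp add: b d mult.assoc)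
    qed
    finally show ?thesis .
  qed
  thus ?thesis by (intro exI[of _ u]) (auto simp: u_def)
qed

text \<open>
  Modulo \<open>S\<close>, the divisors \<open>j\<close> of \<open>n\<close> for which \<open>z\<close> has an \<open>(n/j)\<close>-th root are closed under gcd: with
  roots \<open>a\<close>, \<open>b\<close> for \<open>j\<close>, \<open>k\<close> and Bezout coefficients \<open>u j + v k = gcd j k\<close>, the element
  \<open>a\<^sup>u b\<^sup>v\<close> is a root for \<open>gcd j k\<close>. So the least such divisor divides all others.
\<close>

lemma (in comm_group) minimal_root:
  fixes n :: nat
  assumes S: "subgroup S G" and z: "z \<in> carrier G" and n: "n > 0"
  shows "\<exists>l m. l dvd n \<and> m \<in> carrier G \<and> m [^] (n div l) \<otimes> inv z \<in> S \<and>
    (\<forall>j m'. j dvd n \<longrightarrow> m' \<in> carrier G \<longrightarrow> m' [^] (n div j) \<otimes> inv z \<in> S \<longrightarrow> l dvd j)"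
proof -
  define J where "J j \<longleftrightarrow> j dvd n \<and> (\<exists>m\<in>carrier G. m [^] (n div j) \<otimes> inv z \<in> S)" for j
  have Jn: "J n" using z n subgroup.one_closed[OF S] by (auto simp: J_def intro!: bexI[of _ z])
  have pos: "j > 0" if "J j" for j using that n by (auto simp: J_def intro!: gr0I)
  have gcd: "J (gcd j k)" if j: "J j" and k: "J k" for j k
  proof -
    obtain a b where a: "a \<in> carrier G" "a [^] (n div j) \<otimes> inv z \<in> S"
      and b: "b \<in> carrier G" "b [^] (n div k) \<otimes> inv z \<in> S"
      using j k by (auto simp: J_def)
    define d where "d = gcd j k"
    have d0: "d > 0" using pos[OF j] by (simp add: d_def)
    obtain j' k' where jk: "j = d * j'" "k = d * k'" unfolding d_def by (meson dvdE gcd_dvd1 gcd_dvd2)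
    obtain n1 n2 where nn: "n = j * n1" "n = k * n2" using j k unfolding J_def by (metis dvdE)
    obtain u v where uv: "u * int j + v * int k = int d"
      using bezout_int[of "int j" "int k"] by (auto simp: d_def)
    have "int d * (u * int j' + v * int k') = int d * 1" using uv by (simp add: jk algebra_simps)
    hence uv1: "u * int j' + v * int k' = 1" using d0 by (simp only: mult_cancel_left) auto
    have q: "n div j = n1" "n div k = n2" "n div d = j' * n1" "n div d = k' * n2"
      using pos[OF j] pos[OF k] d0 nn by (simp_all add: jk mult.assoc) (metis nn jk mult.assoc nonzero_mult_div_cancel_left not_gr0)
    define c where "c = a [^] u \<otimes> b [^] v"
    have c: "c \<in> carrier G" using a b by (simp add: c_def)
    have "c [^] int (n div d) \<otimes> inv z =
        (a [^] int n1 \<otimes> inv z) [^] (u * int j') \<otimes> (b [^] int n2 \<otimes> inv z) [^] (v * int k')"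
    proof -
      have "c [^] int (n div d) = a [^] (u * int (n div d)) \<otimes> b [^] (v * int (n div d))"
        using a b by (simp add: c_def int_pow_distrib int_pow_pow)
      also have "\<dots> = a [^] (int n1 * (u * int j')) \<otimes> b [^] (int n2 * (v * int k'))"
        by (subst q(3), subst q(4)) (simp add: mult_ac)
      finally have 1: "c [^] int (n div d) = a [^] (int n1 * (u * int j')) \<otimes> b [^] (int n2 * (v * int k'))" .
      have "inv z = (inv z) [^] (u * int j' + v * int k')" using z by (simp add: uv1)
      also have "\<dots> = (inv z) [^] (u * int j') \<otimes> (inv z) [^] (v * int k')"
        using z by (intro int_pow_mult) simp
      finally have 2: "inv z = (inv z) [^] (u * int j') \<otimes> (inv z) [^] (v * int k')" .
      show ?thesis unfolding 1
        by (subst 2) (use a b z in \<open>simp add: int_pow_distrib int_pow_pow m_ac\<close>)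
    qed
    also have "\<dots> \<in> S"
      using a(2) b(2) S by (auto simp: q int_pow_int intro!: subgroup.m_closed subgroup_int_pow_closed)
    finally have "c [^] (n div d) \<otimes> inv z \<in> S" by (simp add: int_pow_int)
    moreover have "d dvd n" using j by (auto simp: J_def d_def intro: dvd_trans)
    ultimately show ?thesis using c by (auto simp: J_def d_def)
  qed
  define l where "l = (LEAST j. J j)"
  have l: "J l" using LeastI[of J, OF Jn] by (simp add: l_def)
  have "l dvd j" if "J j" for j
  proof -
    have "l \<le> gcd l j" using Least_le[of J, OF gcd[OF l that]] by (simp add: l_def)
    hence "gcd l j = l" using pos[OF l] by (simp add: antisym gcd_le1_nat)
    thus ?thesis by (metis gcd_dvd2)
  qed
  with l show ?thesis unfolding J_def by blast
qed

section \<open>Common roots in wreath products\<close>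

locale abelian_wreath = A: comm_group A for A :: "('a, 'm) monoid_scheme" +
  fixes N :: nat
  assumes finite_base: "finite (carrier A)"
begin

abbreviation G where "G \<equiv> wreath_product N A"
definition X where "X = {1..N}"

lemma finite_X: "finite X"
  by (simp add: X_def)

sublocale G: group G
  by (rule wreath_product_group) (rule A.group_axioms)

lemma carrier_iff: "g \<in> carrier G \<longleftrightarrow> fst g permutes X \<and> snd g \<in> X \<rightarrow>\<^sub>E carrier A"
  by (cases g) (auto simp: X_def wreath_product_def semidirect_product_def sym_group_def)

lemma fst_in: "g \<in> carrier G \<Longrightarrow> i \<in> X \<Longrightarrow> fst g i \<in> X"
  by (simp add: carrier_iff permutes_in_image)

lemma snd_in: "g \<in> carrier G \<Longrightarrow> i \<in> X \<Longrightarrow> snd g i \<in> carrier A"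
  by (auto simp: carrier_iff)

lemma permutation_fst: "g \<in> carrier G \<Longrightarrow> permutation (fst g)"
  using finite_X by (auto simp: carrier_iff permutation_permutes)

lemma finite_carrier: "finite (carrier G)"
proof -
  have "carrier G \<subseteq> {p. p permutes X} \<times> (X \<rightarrow>\<^sub>E carrier A)"
    using carrier_iff by (auto simp: mem_Times_iff)
  thus ?thesis
    using finite_base finite_X by (elim finite_subset) (auto intro!: finite_cartesian_product finite_permutations finite_PiE)
qed

lemma fst_mult: "h \<in> carrier G \<Longrightarrow> fst (g \<otimes>\<^bsub>G\<^esub> h) = fst g \<circ> fst h"
  by (simp add: wreath_product_def semidirect_product_def sym_group_def case_prod_unfold)

lemma snd_mult:
  assumes "h \<in> carrier G" "i \<in> X"
  shows "snd (g \<otimes>\<^bsub>G\<^esub> h) i = snd g (fst h i) \<otimes>\<^bsub>A\<^esub> snd h i"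
proof -
  have p: "fst h permutes X" using assms by (simp add: carrier_iff)
  hence "inv\<^bsub>sym_group N\<^esub> (fst h) = inv' (fst h)"
    unfolding X_def by (metis sym_group_carrier sym_group_inv_equality)
  thus ?thesis
    using assms p permutes_inv_inv[OF p]
    by (simp add: X_def wreath_product_def semidirect_product_def permute_coords_def case_prod_unfold)
qed

lemma fst_one: "fst \<one>\<^bsub>G\<^esub> = id" and snd_one: "i \<in> X \<Longrightarrow> snd \<one>\<^bsub>G\<^esub> i = \<one>\<^bsub>A\<^esub>"
  by (simp_all add: X_def wreath_product_def semidirect_product_def sym_group_def)

lemma fst_pow: "g \<in> carrier G \<Longrightarrow> fst (g [^]\<^bsub>G\<^esub> (r::nat)) = fst g ^^ r"
  by (induction r) (simp_all add: fst_one fst_mult funpow_Suc_right del: funpow.simps(2))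

text \<open>
  An element \<open>(\<sigma>, a)\<close> of the wreath product acts on \<open>X \<times> A\<close> by \<open>(i, s) \<mapsto> (\<sigma> i, a\<^sub>i s)\<close>, commuting with
  the translations by \<open>A\<close>. Agreement at \<open>i\<close> means equal values on the fibre above \<open>i\<close>.
\<close>

definition agree :: "(nat \<Rightarrow> nat) \<times> (nat \<Rightarrow> 'a) \<Rightarrow> (nat \<Rightarrow> nat) \<times> (nat \<Rightarrow> 'a) \<Rightarrow> nat \<Rightarrow> bool" where
  "agree x y i \<longleftrightarrow> fst x i = fst y i \<and> snd x i = snd y i"

lemma agree_refl: "agree x x i" by (simp add: agree_def)

lemma agree_mult:
  assumes "b \<in> carrier G" "b' \<in> carrier G" "i \<in> X"
    and "agree a a' (fst b i)" "agree b b' i"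
  shows "agree (a \<otimes>\<^bsub>G\<^esub> b) (a' \<otimes>\<^bsub>G\<^esub> b') i"
  using assms by (auto simp: agree_def fst_mult snd_mult)

lemma agree_right:
  assumes "x \<in> carrier G" "y \<in> carrier G" "h \<in> carrier G" "i \<in> X"
  shows "agree (x \<otimes>\<^bsub>G\<^esub> h) (y \<otimes>\<^bsub>G\<^esub> h) i \<longleftrightarrow> agree x y (fst h i)"
  using assms snd_in[OF _ fst_in] by (auto simp: agree_def fst_mult snd_mult snd_in)

lemma agree_left:
  assumes "x \<in> carrier G" "y \<in> carrier G" "h \<in> carrier G" "i \<in> X"
  shows "agree (h \<otimes>\<^bsub>G\<^esub> x) (h \<otimes>\<^bsub>G\<^esub> y) i \<longleftrightarrow> agree x y i"
proof -
  have "inj (fst h)" using assms(3) unfolding carrier_iff by (blast intro: permutes_inj)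
  moreover have "snd h (fst y i) \<otimes>\<^bsub>A\<^esub> snd x i = snd h (fst y i) \<otimes>\<^bsub>A\<^esub> snd y i \<longleftrightarrow> snd x i = snd y i"
    using assms by (simp add: snd_in fst_in)
  ultimately show ?thesis
    using assms by (auto simp: agree_def fst_mult snd_mult inj_eq)
qed

text \<open>
  Comparing \<open>h x = x h\<close> with \<open>h y = y h\<close> above \<open>i\<close> carries agreement from \<open>i\<close> to its image under \<open>h\<close>.
\<close>

lemma agree_transport:
  assumes "x \<in> carrier G" "y \<in> carrier G" "h \<in> carrier G" "i \<in> X"
    and "h \<otimes>\<^bsub>G\<^esub> x = x \<otimes>\<^bsub>G\<^esub> h" "h \<otimes>\<^bsub>G\<^esub> y = y \<otimes>\<^bsub>G\<^esub> h"
  shows "agree x y (fst h i) \<longleftrightarrow> agree x y i"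
  using agree_left[OF assms(1-4)] agree_right[OF assms(1-4)] assms(5,6) by simp

lemma agree_imp_eq:
  assumes "x \<in> carrier G" "y \<in> carrier G" "\<And>i. i \<in> X \<Longrightarrow> agree x y i"
  shows "x = y"
proof (rule prod_eqI)
  show "fst x = fst y"
  proof
    fix i
    show "fst x i = fst y i"
      using assms by (cases "i \<in> X") (auto simp: agree_def carrier_iff permutes_def)
  qed
  show "snd x = snd y"
  proof
    fix i
    show "snd x i = snd y i"
      using assms by (cases "i \<in> X") (auto simp: agree_def carrier_iff PiE_def extensional_def)
  qed
qed

text \<open>
  The pointwise stabiliser of the fibre above \<open>i\<close>.
\<close>

definition stab :: "nat \<Rightarrow> ((nat \<Rightarrow> nat) \<times> (nat \<Rightarrow> 'a)) set" where
  "stab i = {x \<in> carrier G. agree x \<one>\<^bsub>G\<^esub> i}"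

lemma stab_subgroup:
  assumes "i \<in> X"
  shows "subgroup (stab i) G"
proof (rule G.subgroupI)
  show "stab i \<subseteq> carrier G" by (auto simp: stab_def)
  show "stab i \<noteq> {}" using G.one_closed agree_refl unfolding stab_def by blast
  show "inv\<^bsub>G\<^esub> x \<in> stab i" if "x \<in> stab i" for x
  proof -
    have "agree (inv\<^bsub>G\<^esub> x \<otimes>\<^bsub>G\<^esub> x) (inv\<^bsub>G\<^esub> x \<otimes>\<^bsub>G\<^esub> \<one>\<^bsub>G\<^esub>) i"
      using that assms by (subst agree_left) (auto simp: stab_def)
    thus ?thesis using that by (auto simp: stab_def agree_def)
  qed
  show "x \<otimes>\<^bsub>G\<^esub> y \<in> stab i" if "x \<in> stab i" "y \<in> stab i" for x y
    using that assms agree_mult[of y "\<one>\<^bsub>G\<^esub>" i x "\<one>\<^bsub>G\<^esub>"]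
    by (auto simp: stab_def agree_def fst_one)
qed

lemma agree_iff_stab:
  assumes "x \<in> carrier G" "y \<in> carrier G" "i \<in> X" "x \<otimes>\<^bsub>G\<^esub> y = y \<otimes>\<^bsub>G\<^esub> x"
  shows "agree x y i \<longleftrightarrow> x \<otimes>\<^bsub>G\<^esub> inv\<^bsub>G\<^esub> y \<in> stab i"
proof -
  have "x \<otimes>\<^bsub>G\<^esub> inv\<^bsub>G\<^esub> y = inv\<^bsub>G\<^esub> y \<otimes>\<^bsub>G\<^esub> x"
    using assms by (metis G.inv_closed G.inv_solve_left G.inv_solve_right G.m_assoc G.m_closed)
  moreover have "agree x y i \<longleftrightarrow> agree (inv\<^bsub>G\<^esub> y \<otimes>\<^bsub>G\<^esub> x) (inv\<^bsub>G\<^esub> y \<otimes>\<^bsub>G\<^esub> y) i"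
    using assms by (subst agree_left) auto
  ultimately show ?thesis using assms by (simp add: stab_def)
qed

definition diag :: "'a \<Rightarrow> (nat \<Rightarrow> nat) \<times> (nat \<Rightarrow> 'a)" where
  "diag a = (id, \<lambda>i\<in>X. a)"

lemma diag_in: "a \<in> carrier A \<Longrightarrow> diag a \<in> carrier G"
  by (auto simp: diag_def carrier_iff permutes_id)

lemma diag_central:
  assumes "a \<in> carrier A" "g \<in> carrier G"
  shows "diag a \<otimes>\<^bsub>G\<^esub> g = g \<otimes>\<^bsub>G\<^esub> diag a"
proof (rule agree_imp_eq)
  fix i assume i: "i \<in> X"
  show "agree (diag a \<otimes>\<^bsub>G\<^esub> g) (g \<otimes>\<^bsub>G\<^esub> diag a) i"
    using assms i fst_in[OF assms(2) i] snd_in[OF assms(2) i] diag_in[OF assms(1)]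
    by (auto simp: agree_def fst_mult snd_mult diag_def A.m_comm)
qed (use assms diag_in in auto)

lemma diag_mult: "a \<in> carrier A \<Longrightarrow> b \<in> carrier A \<Longrightarrow> diag a \<otimes>\<^bsub>G\<^esub> diag b = diag (a \<otimes>\<^bsub>A\<^esub> b)"
  by (rule agree_imp_eq) (auto simp: diag_in agree_def fst_mult snd_mult, auto simp: diag_def)

lemma diag_one: "diag \<one>\<^bsub>A\<^esub> = \<one>\<^bsub>G\<^esub>"
  by (rule agree_imp_eq) (auto simp: diag_in agree_def fst_one snd_one, auto simp: diag_def)

text \<open>
  The abelian group generated by \<open>z\<close> and the diagonal copy of \<open>A\<close>. As the group is finite,
  nonnegative powers of \<open>z\<close> suffice.
\<close>

definition translates where
  "translates z = {z [^]\<^bsub>G\<^esub> (s::nat) \<otimes>\<^bsub>G\<^esub> diag a | s a. a \<in> carrier A}"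

lemma translates_commute:
  assumes "z \<in> carrier G" "h \<in> carrier G" "h \<otimes>\<^bsub>G\<^esub> z = z \<otimes>\<^bsub>G\<^esub> h" "m \<in> translates z"
  shows "h \<otimes>\<^bsub>G\<^esub> m = m \<otimes>\<^bsub>G\<^esub> h"
proof -
  from assms obtain s :: nat and a where m: "m = z [^]\<^bsub>G\<^esub> s \<otimes>\<^bsub>G\<^esub> diag a" "a \<in> carrier A"
    by (auto simp: translates_def)
  have "h \<otimes>\<^bsub>G\<^esub> z [^]\<^bsub>G\<^esub> s = z [^]\<^bsub>G\<^esub> s \<otimes>\<^bsub>G\<^esub> h"
    using assms(1,2,3)
    by (induction s) (simp_all, metis G.m_assoc G.nat_pow_closed)
  thus ?thesis
    using assms m diag_in[OF m(2)] diag_central[OF m(2) assms(2)]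
    by (simp add: G.m_assoc[symmetric]) (simp add: G.m_assoc)
qed

lemma translates_subset: "z \<in> carrier G \<Longrightarrow> translates z \<subseteq> carrier G"
  by (auto simp: translates_def diag_in)

lemma self_translation: "z \<in> carrier G \<Longrightarrow> z \<in> translates z"
  unfolding translates_def by (rule CollectI, rule exI[of _ 1], rule exI[of _ "\<one>\<^bsub>A\<^esub>"]) (simp add: diag_one)

lemma translates_subgroup:
  assumes z: "z \<in> carrier G"
  shows "subgroup (translates z) G"
proof -
  have one: "\<one>\<^bsub>G\<^esub> \<in> translates z"
    unfolding translates_def by (rule CollectI, rule exI[of _ 0], rule exI[of _ "\<one>\<^bsub>A\<^esub>"]) (simp add: diag_one)
  have mult: "x \<otimes>\<^bsub>G\<^esub> y \<in> translates z" if xy: "x \<in> translates z" "y \<in> translates z" for x y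
  proof -
    from xy obtain s t :: nat and a b where *: "x = z [^]\<^bsub>G\<^esub> s \<otimes>\<^bsub>G\<^esub> diag a" "a \<in> carrier A"
      "y = z [^]\<^bsub>G\<^esub> t \<otimes>\<^bsub>G\<^esub> diag b" "b \<in> carrier A" by (auto simp: translates_def)
    have "x \<otimes>\<^bsub>G\<^esub> y = z [^]\<^bsub>G\<^esub> s \<otimes>\<^bsub>G\<^esub> (diag a \<otimes>\<^bsub>G\<^esub> z [^]\<^bsub>G\<^esub> t) \<otimes>\<^bsub>G\<^esub> diag b"
      using z * by (simp add: G.m_assoc diag_in)
    also have "\<dots> = (z [^]\<^bsub>G\<^esub> s \<otimes>\<^bsub>G\<^esub> z [^]\<^bsub>G\<^esub> t) \<otimes>\<^bsub>G\<^esub> (diag a \<otimes>\<^bsub>G\<^esub> diag b)"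
      using z * by (simp add: G.m_assoc diag_in diag_central[of a "z [^]\<^bsub>G\<^esub> t"])
    also have "\<dots> = z [^]\<^bsub>G\<^esub> (s + t) \<otimes>\<^bsub>G\<^esub> diag (a \<otimes>\<^bsub>A\<^esub> b)"
      using z * by (simp add: G.nat_pow_mult diag_mult)
    finally show ?thesis using * by (auto simp: translates_def)
  qed
  have sub: "translates z \<subseteq> carrier G" by (rule translates_subset[OF z])
  have pow: "x [^]\<^bsub>G\<^esub> (r::nat) \<in> translates z" if "x \<in> translates z" for x r
    using that one mult by (induction r) auto
  have "inv\<^bsub>G\<^esub> x \<in> translates z" if x: "x \<in> translates z" for x
  proof -
    have xc: "x \<in> carrier G" using x sub by auto
    have o: "Coset.order G > 0" using finite_carrier G.order_gt_0_iff_finite by simp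
    have "x [^]\<^bsub>G\<^esub> (Coset.order G - 1) \<otimes>\<^bsub>G\<^esub> x = x [^]\<^bsub>G\<^esub> (Coset.order G)"
      using o by (metis G.nat_pow_Suc Suc_pred' One_nat_def)
    hence "x [^]\<^bsub>G\<^esub> (Coset.order G - 1) = inv\<^bsub>G\<^esub> x"
      using xc by (simp add: G.pow_order_eq_1 G.inv_equality)
    thus ?thesis using pow[OF x, of "Coset.order G - 1"] by simp
  qed
  with one mult sub show ?thesis by (intro G.subgroupI) auto
qed

lemma translation_fst_orb:
  assumes "z \<in> carrier G" "m \<in> translates z"
  shows "fst m i \<in> orb (fst z) i"
  using assms by (auto simp: translates_def fst_mult diag_in fst_pow) (auto simp: diag_def orb_def)

text \<open>
  The translates act transitively above the \<open>z\<close>-orbit of \<open>i\<close>, so one of them agrees with \<open>h\<close> at \<open>i\<close>;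
  as it commutes with \<open>h\<close>, agreement persists for all powers.
\<close>

lemma translation_matches:
  assumes z: "z \<in> carrier G" and h: "h \<in> carrier G" and comm: "h \<otimes>\<^bsub>G\<^esub> z = z \<otimes>\<^bsub>G\<^esub> h"
    and i: "i \<in> X" and orb: "fst h i \<in> orb (fst z) i"
  shows "\<exists>m\<in>translates z. \<forall>r::nat. agree (m [^]\<^bsub>G\<^esub> r) (h [^]\<^bsub>G\<^esub> r) i"
proof -
  from orb obtain s where s: "fst h i = (fst z ^^ s) i" by (auto simp: orb_def)
  let ?Z = "z [^]\<^bsub>G\<^esub> s"
  have Z: "?Z \<in> carrier G" using z by simp
  define a where "a = inv\<^bsub>A\<^esub> (snd ?Z i) \<otimes>\<^bsub>A\<^esub> snd h i"
  have a: "a \<in> carrier A" using snd_in[OF Z i] snd_in[OF h i] by (simp add: a_def)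
  define m where "m = ?Z \<otimes>\<^bsub>G\<^esub> diag a"
  have mM: "m \<in> translates z" using a by (auto simp: m_def translates_def)
  have m: "m \<in> carrier G" using mM translates_subset[OF z] by auto
  have mh: "agree m h i"
    using i a snd_in[OF Z i] snd_in[OF h i] s
    by (simp add: agree_def m_def fst_mult snd_mult diag_in fst_pow[OF z])
      (simp add: diag_def a_def A.m_assoc[symmetric])
  have hm: "h \<otimes>\<^bsub>G\<^esub> m = m \<otimes>\<^bsub>G\<^esub> h" by (rule translates_commute[OF z h comm mM])
  have pow: "h \<otimes>\<^bsub>G\<^esub> m [^]\<^bsub>G\<^esub> r = m [^]\<^bsub>G\<^esub> r \<otimes>\<^bsub>G\<^esub> h" for r :: nat
    using hm m h by (induction r) (simp_all, metis G.m_assoc G.nat_pow_closed)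
  have pow': "h \<otimes>\<^bsub>G\<^esub> h [^]\<^bsub>G\<^esub> r = h [^]\<^bsub>G\<^esub> r \<otimes>\<^bsub>G\<^esub> h" for r :: nat
    using h by (metis G.nat_pow_Suc G.nat_pow_Suc2)
  have "agree (m [^]\<^bsub>G\<^esub> r) (h [^]\<^bsub>G\<^esub> r) i" for r :: nat
  proof (induction r)
    case (Suc r)
    have "agree (m [^]\<^bsub>G\<^esub> r) (h [^]\<^bsub>G\<^esub> r) (fst h i)"
      using Suc agree_transport[of "m [^]\<^bsub>G\<^esub> r" "h [^]\<^bsub>G\<^esub> r" h i] m h i pow pow' by simp
    moreover have "fst h i = fst m i" using mh by (simp add: agree_def)
    ultimately show ?case using mh m h i by (simp add: agree_mult)
  qed (simp add: agree_refl)
  with mM show ?thesis by blast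
qed

lemma local_root:
  fixes n :: nat
  assumes z: "z \<in> carrier G" and n: "n > 0" and i: "i \<in> X"
  defines "K \<equiv> translates z"
  shows "\<exists>l m. l dvd n \<and> m \<in> K \<and> m [^]\<^bsub>G\<^esub> (n div l) \<otimes>\<^bsub>G\<^esub> inv\<^bsub>G\<^esub> z \<in> stab i \<inter> K \<and>
    (\<forall>j m'. j dvd n \<longrightarrow> m' \<in> K \<longrightarrow> m' [^]\<^bsub>G\<^esub> (n div j) \<otimes>\<^bsub>G\<^esub> inv\<^bsub>G\<^esub> z \<in> stab i \<inter> K \<longrightarrow> l dvd j)"
proof -
  have sub: "subgroup K G" unfolding K_def by (rule translates_subgroup[OF z])
  have zK: "z \<in> K" using self_translation[OF z] by (simp add: K_def)
  let ?K = "G\<lparr>carrier := K\<rparr>"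
  interpret K: group ?K by (rule G.subgroup_imp_group[OF sub])
  have Kc: "x \<in> carrier G" if "x \<in> K" for x using that subgroup.subset[OF sub] by auto
  interpret K: comm_group ?K
  proof (rule K.group_comm_groupI)
    fix x y assume "x \<in> carrier ?K" "y \<in> carrier ?K"
    hence xy: "x \<in> K" "y \<in> K" by auto
    have "z \<otimes>\<^bsub>G\<^esub> x = x \<otimes>\<^bsub>G\<^esub> z"
      using translates_commute[OF z z refl] xy by (simp add: K_def)
    hence "x \<otimes>\<^bsub>G\<^esub> y = y \<otimes>\<^bsub>G\<^esub> x"
      using translates_commute[OF z Kc[OF xy(1)] _] xy by (simp add: K_def)
    thus "x \<otimes>\<^bsub>?K\<^esub> y = y \<otimes>\<^bsub>?K\<^esub> x" by simp
  qed
  have "subgroup (stab i \<inter> K) G"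
    using sub stab_subgroup[OF i] by (rule G.subgroups_Inter_pair[rotated])
  hence S: "subgroup (stab i \<inter> K) ?K"
    using G.subgroup_incl[OF _ sub] by simp
  have "x [^]\<^bsub>?K\<^esub> r = x [^]\<^bsub>G\<^esub> r" for x and r :: nat
    by (simp add: nat_pow_def)
  thus ?thesis
    using K.minimal_root[OF S _ n, of z] zK by (simp add: G.m_inv_consistent[OF sub zK])
qed

lemma agree_trans: "agree x y i \<Longrightarrow> agree y w i \<Longrightarrow> agree x w i"
  by (simp add: agree_def)

lemma root_commutes: "g \<in> carrier G \<Longrightarrow> g [^]\<^bsub>G\<^esub> (n::nat) = z \<Longrightarrow> g \<otimes>\<^bsub>G\<^esub> z = z \<otimes>\<^bsub>G\<^esub> g"
  by (metis G.nat_pow_Suc G.nat_pow_Suc2)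

text \<open>
  The twist \<open>u\<close> is assembled from powers of local roots. At each \<open>i\<close> the group of translates
  contains a root \<open>m\<^sub>i\<close> of \<open>z\<close> of the largest possible exponent \<open>n/l\<^sub>i\<close>. Both are chosen as
  functions of the stabiliser of \<open>i\<close> among the translates, which is the same along each orbit of the
  centraliser of \<open>z\<close>. On the fibre above \<open>i\<close>, \<open>u\<close> acts as \<open>m\<^sub>i\<close> to the power
  \<open>(k - 1) t\<^sub>i\<close>, with the weights \<open>t\<close> of \<open>orbit_weights\<close>.
\<close>

lemma orbit_twist:
  fixes n :: nat and k :: int
  assumes z: "z \<in> carrier G" and n: "n > 0"
    and g0: "g0 \<in> carrier G" "g0 [^]\<^bsub>G\<^esub> n = z"
    and y0: "y0 \<in> carrier G" "y0 [^]\<^bsub>G\<^esub> n = z"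
  shows "\<exists>u\<in>carrier G. (\<forall>i\<in>X. fst u i \<in> orb (fst z) i) \<and>
    (\<forall>g\<in>carrier G. g [^]\<^bsub>G\<^esub> n = z \<longrightarrow>
      orb (fst g) = orb (fst g0) \<or> orb (fst g) = orb (fst y0) \<longrightarrow> (g \<otimes>\<^bsub>G\<^esub> u) [^]\<^bsub>G\<^esub> n = z [^]\<^bsub>G\<^esub> k)"
proof -
  define K where "K = translates z"
  have sub: "subgroup K G" unfolding K_def by (rule translates_subgroup[OF z])
  have Kc: "x \<in> carrier G" if "x \<in> K" for x using that subgroup.subset[OF sub] by auto
  have zK: "z \<in> K" using self_translation[OF z] by (simp add: K_def)
  have Kcomm: "h \<otimes>\<^bsub>G\<^esub> x = x \<otimes>\<^bsub>G\<^esub> h"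
    if "h \<in> carrier G" "h \<otimes>\<^bsub>G\<^esub> z = z \<otimes>\<^bsub>G\<^esub> h" "x \<in> K" for h x
    using translates_commute[OF z] that by (simp add: K_def)
  have KK: "x \<otimes>\<^bsub>G\<^esub> y = y \<otimes>\<^bsub>G\<^esub> x" if "x \<in> K" "y \<in> K" for x y
    using Kcomm[OF Kc[OF that(1)] _ that(2)] Kcomm[OF z refl that(1)] by simp
  have pw: "x [^]\<^bsub>G\<^esub> (r::int) \<in> K" if "x \<in> K" for x r
    using G.subgroup_int_pow_closed[OF sub that] .
  have npw: "x [^]\<^bsub>G\<^esub> (r::nat) \<in> K" if "x \<in> K" for x r
    using pw[OF that, of "int r"] by (simp add: int_pow_int)
  have "\<forall>S. \<exists>l m. (\<exists>i\<in>X. S = stab i \<inter> K) \<longrightarrow>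
    l dvd n \<and> m \<in> K \<and> m [^]\<^bsub>G\<^esub> (n div l) \<otimes>\<^bsub>G\<^esub> inv\<^bsub>G\<^esub> z \<in> S \<and>
    (\<forall>j m'. j dvd n \<longrightarrow> m' \<in> K \<longrightarrow> m' [^]\<^bsub>G\<^esub> (n div j) \<otimes>\<^bsub>G\<^esub> inv\<^bsub>G\<^esub> z \<in> S \<longrightarrow> l dvd j)"
    (is "\<forall>S. \<exists>l m. _ S \<longrightarrow> ?P S l m")
  proof
    fix S
    show "\<exists>l m. (\<exists>i\<in>X. S = stab i \<inter> K) \<longrightarrow> ?P S l m"
    proof (cases "\<exists>i\<in>X. S = stab i \<inter> K")
      case True
      then obtain i where i: "i \<in> X" "S = stab i \<inter> K" by blast
      from local_root[OF z n i(1), folded K_def] have "\<exists>l m. ?P S l m" unfolding i(2) .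
      thus ?thesis by blast
    qed blast
  qed
  then obtain L M where LM: "\<And>i. i \<in> X \<Longrightarrow>
    L (stab i \<inter> K) dvd n \<and> M (stab i \<inter> K) \<in> K \<and>
    M (stab i \<inter> K) [^]\<^bsub>G\<^esub> (n div L (stab i \<inter> K)) \<otimes>\<^bsub>G\<^esub> inv\<^bsub>G\<^esub> z \<in> stab i \<inter> K \<and>
    (\<forall>j m'. j dvd n \<longrightarrow> m' \<in> K \<longrightarrow>
      m' [^]\<^bsub>G\<^esub> (n div j) \<otimes>\<^bsub>G\<^esub> inv\<^bsub>G\<^esub> z \<in> stab i \<inter> K \<longrightarrow> L (stab i \<inter> K) dvd j)"
    by metis
  define l where "l i = L (stab i \<inter> K)" for i
  define m where "m i = M (stab i \<inter> K)" for i
  have lm: "l i dvd n" "m i \<in> K" "m i [^]\<^bsub>G\<^esub> (n div l i) \<otimes>\<^bsub>G\<^esub> inv\<^bsub>G\<^esub> z \<in> stab i"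
    and least: "j dvd n \<Longrightarrow> m' \<in> K \<Longrightarrow>
      m' [^]\<^bsub>G\<^esub> (n div j) \<otimes>\<^bsub>G\<^esub> inv\<^bsub>G\<^esub> z \<in> stab i \<inter> K \<Longrightarrow> l i dvd j"
    if "i \<in> X" for i j m'
    using LM[OF that] unfolding l_def m_def by blast+
  have shift: "l (fst h i) = l i" "m (fst h i) = m i"
    if "h \<in> carrier G" "h \<otimes>\<^bsub>G\<^esub> z = z \<otimes>\<^bsub>G\<^esub> h" "i \<in> X" for h i
  proof -
    have "agree x \<one>\<^bsub>G\<^esub> (fst h i) \<longleftrightarrow> agree x \<one>\<^bsub>G\<^esub> i" if "x \<in> K" for x
      using agree_transport[of x "\<one>\<^bsub>G\<^esub>" h i] Kcomm[of h x] Kc \<open>x \<in> K\<close> \<open>h \<in> carrier G\<close>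
        \<open>i \<in> X\<close> \<open>h \<otimes>\<^bsub>G\<^esub> z = z \<otimes>\<^bsub>G\<^esub> h\<close> by simp
    hence "stab (fst h i) \<inter> K = stab i \<inter> K" by (auto simp: stab_def)
    thus "l (fst h i) = l i" "m (fst h i) = m i" by (simp_all add: l_def m_def)
  qed
  have good: "graded_root X n (fst z) l (fst g)" if g: "g \<in> carrier G" "g [^]\<^bsub>G\<^esub> n = z" for g
    unfolding graded_root_def
  proof (intro conjI ballI)
    show "fst g permutes X" using g(1) by (simp add: carrier_iff)
    show fg: "fst g ^^ n = fst z" using fst_pow[OF g(1), of n] g(2) by simp
    have gz: "g \<otimes>\<^bsub>G\<^esub> z = z \<otimes>\<^bsub>G\<^esub> g" by (rule root_commutes[OF g])
    fix i assume i: "i \<in> X"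
    show "l (fst g i) = l i" by (rule shift[OF g(1) gz i])
    \<comment> \<open>the cycle of \<open>i\<close> has \<open>d\<close> orbits of \<open>z\<close>, so the \<open>d\<close>-th power of \<open>g\<close> returns \<open>i\<close> to its own orbit\<close>
    let ?c = "least_power (fst g) i"
    define d where "d = gcd ?c n"
    have dn: "d dvd n" by (simp add: d_def)
    let ?h = "g [^]\<^bsub>G\<^esub> d"
    have h: "?h \<in> carrier G" using g(1) by simp
    have hz: "?h \<otimes>\<^bsub>G\<^esub> z = z \<otimes>\<^bsub>G\<^esub> ?h"
      using g(1) unfolding g(2)[symmetric] by (simp add: G.nat_pow_mult add.commute)
    obtain x y where xy: "n * x = ?c * y + d"
      using bezout_nat[of n ?c] n by (auto simp: d_def gcd.commute)
    have "(fst z ^^ x) i = (fst g ^^ (d + ?c * y)) i"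
      unfolding fg[symmetric] funpow_mult by (simp add: xy mult.commute add.commute)
    also have "\<dots> = (fst g ^^ d) ((fst g ^^ (?c * y)) i)" by (simp only: funpow_add comp_apply)
    also have "(fst g ^^ (?c * y)) i = i"
      using least_power_dvd[OF permutation_fst[OF g(1)]] by (metis dvd_triv_left)
    finally have "fst ?h i \<in> orb (fst z) i"
      using fst_pow[OF g(1), of d] orb_funpow[of x "fst z" i] by simp
    from translation_matches[OF z h hz i this] obtain a where
      a: "a \<in> K" "agree (a [^]\<^bsub>G\<^esub> (n div d)) (?h [^]\<^bsub>G\<^esub> (n div d)) i"
      by (auto simp: K_def)
    have "?h [^]\<^bsub>G\<^esub> (n div d) = z"
      using g dn by (simp add: G.nat_pow_pow)
    hence "agree (a [^]\<^bsub>G\<^esub> (n div d)) z i" using a(2) by simp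
    hence "a [^]\<^bsub>G\<^esub> (n div d) \<otimes>\<^bsub>G\<^esub> inv\<^bsub>G\<^esub> z \<in> stab i"
      using agree_iff_stab[OF Kc[OF npw[OF a(1)]] z i KK[OF npw[OF a(1)] zK]] by simp
    moreover have "a [^]\<^bsub>G\<^esub> (n div d) \<otimes>\<^bsub>G\<^esub> inv\<^bsub>G\<^esub> z \<in> K"
      using npw[OF a(1)] zK subgroup.m_closed[OF sub] subgroup.m_inv_closed[OF sub] by blast
    ultimately show "l i dvd gcd ?c n" using least[OF i dn a(1)] by (simp add: d_def)
  qed
  obtain t :: "nat \<Rightarrow> int" where t_orb: "\<And>i j. orb (fst z) i = orb (fst z) j \<Longrightarrow> t i = t j"
    and t_sum: "\<And>\<rho> i. graded_root X n (fst z) l \<rho> \<Longrightarrow> orb \<rho> = orb (fst g0) \<or> orb \<rho> = orb (fst y0) \<Longrightarrow>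
      i \<in> X \<Longrightarrow> (\<Sum>j<n. t ((\<rho> ^^ j) i)) = int (n div l i)"
    using orbit_weights[OF finite_X n good[OF g0] good[OF y0]] by blast
  \<comment> \<open>multiplying \<open>z\<close> by its \<open>(k - 1)\<close>-st power turns it into its \<open>k\<close>-th power\<close>
  define e where "e = k - 1"
  define v where "v i = m i [^]\<^bsub>G\<^esub> (e * t i)" for i
  have vK: "v i \<in> K" if "i \<in> X" for i using pw[OF lm(2)[OF that]] by (simp add: v_def)
  have pz: "permutation (fst z)" by (rule permutation_fst[OF z])
  have m_orb: "m j = m i" if "i \<in> X" and j: "j \<in> orb (fst z) i" for i j
  proof -
    from j obtain s :: nat where "j = fst (z [^]\<^bsub>G\<^esub> s) i" by (auto simp: orb_def fst_pow[OF z])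
    moreover have "z [^]\<^bsub>G\<^esub> s \<otimes>\<^bsub>G\<^esub> z = z \<otimes>\<^bsub>G\<^esub> z [^]\<^bsub>G\<^esub> s"
      using z by (metis G.nat_pow_Suc G.nat_pow_Suc2)
    ultimately show ?thesis using shift(2)[of "z [^]\<^bsub>G\<^esub> s" i] z that by simp
  qed
  have v_orb: "v j = v i" if "i \<in> X" and "j \<in> orb (fst z) i" for i j
    using m_orb[OF that] t_orb[of j i] orb_eq_iff[OF pz] that by (simp add: v_def)
  define u where "u = (\<lambda>i. if i \<in> X then fst (v i) i else i, \<lambda>i\<in>X. snd (v i) i)"
  have u_v: "agree u (v i) i" if "i \<in> X" for i using that by (simp add: u_def agree_def)
  have u_orb: "fst u i \<in> orb (fst z) i" if "i \<in> X" for i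
    using translation_fst_orb[OF z, of "v i" i] vK[OF that] that by (simp add: u_def K_def)
  have u: "u \<in> carrier G"
    unfolding carrier_iff
  proof
    show "snd u \<in> X \<rightarrow>\<^sub>E carrier A"
      using snd_in Kc vK by (auto simp: u_def)
    have into: "fst u i \<in> X" if "i \<in> X" for i
      using fst_in[OF Kc[OF vK[OF that]] that] that by (simp add: u_def)
    have "inj_on (fst u) X"
    proof (rule inj_onI)
      fix i j assume ij: "i \<in> X" "j \<in> X" "fst u i = fst u j"
      have "orb (fst z) i = orb (fst z) j"
        using u_orb[OF ij(1)] u_orb[OF ij(2)] ij(3) orb_eq_iff[OF pz] by metis
      hence "v i = v j" using v_orb[OF ij(2), of i] orb_self[of i "fst z"] by simp
      hence "fst (v j) i = fst (v j) j" using ij by (simp add: u_def)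
      moreover have "inj (fst (v j))"
        using Kc[OF vK[OF ij(2)]] unfolding carrier_iff by (blast intro: permutes_inj)
      ultimately show "i = j" by (simp add: inj_eq)
    qed
    hence "bij_betw (fst u) X X"
      using into finite_X by (simp add: bij_betw_def endo_inj_surj image_subset_iff)
    thus "fst u permutes X" by (rule bij_imp_permutes) (simp add: u_def)
  qed
  have "(g \<otimes>\<^bsub>G\<^esub> u) [^]\<^bsub>G\<^esub> n = z [^]\<^bsub>G\<^esub> k"
    if g: "g \<in> carrier G" "g [^]\<^bsub>G\<^esub> n = z" and og: "orb (fst g) = orb (fst g0) \<or> orb (fst g) = orb (fst y0)" for g
  proof (rule agree_imp_eq)
    let ?s = "fst g"
    have gz: "g \<otimes>\<^bsub>G\<^esub> z = z \<otimes>\<^bsub>G\<^esub> g" by (rule root_commutes[OF g])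
    have fg: "?s ^^ n = fst z" using fst_pow[OF g(1), of n] g(2) by simp
    have grc: "g [^]\<^bsub>G\<^esub> r \<otimes>\<^bsub>G\<^esub> z = z \<otimes>\<^bsub>G\<^esub> g [^]\<^bsub>G\<^esub> r" for r :: nat
      using g(1) unfolding g(2)[symmetric] by (simp add: G.nat_pow_mult add.commute)
    \<comment> \<open>the root commutes with \<open>g\<close>, so its powers accumulate in front of the powers of \<open>g\<close>\<close>
    have claim: "agree ((g \<otimes>\<^bsub>G\<^esub> u) [^]\<^bsub>G\<^esub> r)
        (m i [^]\<^bsub>G\<^esub> (e * (\<Sum>j<r. t ((?s ^^ j) i))) \<otimes>\<^bsub>G\<^esub> g [^]\<^bsub>G\<^esub> r) i" if "i \<in> X" for r i
      using that
    proof (induction r arbitrary: i)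
      case 0
      show ?case using 0 by (simp add: agree_refl)
    next
      case (Suc r)
      note i = Suc.prems
      \<comment> \<open>the first factor moves \<open>i\<close> within its \<open>z\<close>-orbit, where neither the root nor the weights change\<close>
      define i' where "i' = fst u i"
      have i': "i' \<in> X" "i' \<in> orb (fst z) i"
        using fst_in[OF u i] u_orb[OF i] by (simp_all add: i'_def)
      have i1: "fst (g \<otimes>\<^bsub>G\<^esub> u) i = ?s i'" "?s i' \<in> X"
        using fst_mult[OF u, of g] fst_in[OF g(1) i'(1)] by (simp_all add: i'_def)
      have m1: "m (?s i') = m i" using shift(2)[OF g(1) gz i'(1)] m_orb[OF i i'(2)] by simp
      have t1: "t ((?s ^^ j) (?s i')) = t ((?s ^^ Suc j) i)" for j
      proof -
        from i'(2) obtain q where q: "i' = (fst z ^^ q) i" by (auto simp: orb_def)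
        have "(?s ^^ j) (?s i') = (?s ^^ Suc j) ((?s ^^ (n * q)) i)"
          by (simp add: q funpow_swap1 fg[symmetric] funpow_mult)
        also have "\<dots> = (?s ^^ (Suc j + n * q)) i" by (simp only: funpow_add comp_apply)
        also have "\<dots> = (?s ^^ (n * q)) ((?s ^^ Suc j) i)"
          by (simp only: funpow_add comp_apply add.commute[of "Suc j"])
        also have "\<dots> = (fst z ^^ q) ((?s ^^ Suc j) i)"
          by (simp only: fg[symmetric] funpow_mult mult.commute)
        finally have "(?s ^^ j) (?s i') \<in> orb (fst z) ((?s ^^ Suc j) i)" by (simp only: orb_funpow)
        thus ?thesis using t_orb orb_eq_iff[OF pz] by blast
      qed
      let ?S = "e * (\<Sum>j<r. t ((?s ^^ Suc j) i))"
      have mG: "m i \<in> carrier G" using Kc lm(2)[OF i] by auto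
      have "agree ((g \<otimes>\<^bsub>G\<^esub> u) [^]\<^bsub>G\<^esub> r \<otimes>\<^bsub>G\<^esub> (g \<otimes>\<^bsub>G\<^esub> u))
          (m i [^]\<^bsub>G\<^esub> ?S \<otimes>\<^bsub>G\<^esub> g [^]\<^bsub>G\<^esub> r \<otimes>\<^bsub>G\<^esub> (g \<otimes>\<^bsub>G\<^esub> v i)) i"
      proof (rule agree_mult)
        show "agree ((g \<otimes>\<^bsub>G\<^esub> u) [^]\<^bsub>G\<^esub> r) (m i [^]\<^bsub>G\<^esub> ?S \<otimes>\<^bsub>G\<^esub> g [^]\<^bsub>G\<^esub> r) (fst (g \<otimes>\<^bsub>G\<^esub> u) i)"
          using Suc.IH[OF i1(2)] unfolding i1(1) m1 t1 .
        show "agree (g \<otimes>\<^bsub>G\<^esub> u) (g \<otimes>\<^bsub>G\<^esub> v i) i"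
          using agree_left[OF u Kc[OF vK[OF i]] g(1) i] u_v[OF i] by simp
      qed (use g u i Kc vK in auto)
      also have "m i [^]\<^bsub>G\<^esub> ?S \<otimes>\<^bsub>G\<^esub> g [^]\<^bsub>G\<^esub> r \<otimes>\<^bsub>G\<^esub> (g \<otimes>\<^bsub>G\<^esub> v i) =
          m i [^]\<^bsub>G\<^esub> ?S \<otimes>\<^bsub>G\<^esub> (g [^]\<^bsub>G\<^esub> Suc r \<otimes>\<^bsub>G\<^esub> v i)"
        using g(1) Kc[OF vK[OF i]] mG by (simp add: G.m_assoc)
      also have "g [^]\<^bsub>G\<^esub> Suc r \<otimes>\<^bsub>G\<^esub> v i = v i \<otimes>\<^bsub>G\<^esub> g [^]\<^bsub>G\<^esub> Suc r"
        by (rule Kcomm[OF _ grc vK[OF i]]) (use g(1) in simp)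
      also have "m i [^]\<^bsub>G\<^esub> ?S \<otimes>\<^bsub>G\<^esub> (v i \<otimes>\<^bsub>G\<^esub> g [^]\<^bsub>G\<^esub> Suc r) =
          m i [^]\<^bsub>G\<^esub> (?S + e * t i) \<otimes>\<^bsub>G\<^esub> g [^]\<^bsub>G\<^esub> Suc r"
        using g(1) mG by (simp add: v_def G.int_pow_mult G.m_assoc del: G.nat_pow_Suc)
      also have "?S + e * t i = e * (\<Sum>j<Suc r. t ((?s ^^ j) i))"
        by (simp only: sum.lessThan_Suc_shift) (simp add: distrib_left)
      finally show ?case by simp
    qed
    fix i assume i: "i \<in> X"
    let ?a = "m i [^]\<^bsub>G\<^esub> (n div l i)"
    have aK: "?a \<in> K" using npw lm(2)[OF i] by auto
    have "(?a \<otimes>\<^bsub>G\<^esub> inv\<^bsub>G\<^esub> z) [^]\<^bsub>G\<^esub> e \<in> stab i"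
      using G.subgroup_int_pow_closed[OF stab_subgroup[OF i] lm(3)[OF i]] .
    also have "(?a \<otimes>\<^bsub>G\<^esub> inv\<^bsub>G\<^esub> z) [^]\<^bsub>G\<^esub> e = ?a [^]\<^bsub>G\<^esub> e \<otimes>\<^bsub>G\<^esub> (inv\<^bsub>G\<^esub> z) [^]\<^bsub>G\<^esub> e"
      using KK[OF aK subgroup.m_inv_closed[OF sub zK]] Kc[OF aK] z by (intro G.int_pow_mult_distrib) auto
    also have "(inv\<^bsub>G\<^esub> z) [^]\<^bsub>G\<^esub> e = inv\<^bsub>G\<^esub> (z [^]\<^bsub>G\<^esub> e)" using z by (simp add: G.int_pow_inv)
    finally have "agree (?a [^]\<^bsub>G\<^esub> e) (z [^]\<^bsub>G\<^esub> e) i"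
      using agree_iff_stab[OF Kc[OF pw[OF aK]] Kc[OF pw[OF zK]] i KK[OF pw[OF aK] pw[OF zK]]] by simp
    hence "agree (?a [^]\<^bsub>G\<^esub> e) (z [^]\<^bsub>G\<^esub> e) (fst z i)"
      using agree_transport[OF Kc[OF pw[OF aK]] Kc[OF pw[OF zK]] z i KK[OF zK pw[OF aK]] KK[OF zK pw[OF zK]]]
      by simp
    hence "agree (?a [^]\<^bsub>G\<^esub> e \<otimes>\<^bsub>G\<^esub> z) (z [^]\<^bsub>G\<^esub> e \<otimes>\<^bsub>G\<^esub> z) i"
      using z i agree_refl by (intro agree_mult) auto
    also have "z [^]\<^bsub>G\<^esub> e \<otimes>\<^bsub>G\<^esub> z = z [^]\<^bsub>G\<^esub> k"
      using G.int_pow_mult[OF z, of e 1] z by (simp add: e_def)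
    finally have step: "agree (?a [^]\<^bsub>G\<^esub> e \<otimes>\<^bsub>G\<^esub> z) (z [^]\<^bsub>G\<^esub> k) i" .
    have a_pow: "?a [^]\<^bsub>G\<^esub> e = m i [^]\<^bsub>G\<^esub> (e * int (n div l i))"
      using Kc[OF lm(2)[OF i]] by (simp add: int_pow_int[symmetric] G.int_pow_pow mult.commute)
    have "agree ((g \<otimes>\<^bsub>G\<^esub> u) [^]\<^bsub>G\<^esub> n) (m i [^]\<^bsub>G\<^esub> (e * int (n div l i)) \<otimes>\<^bsub>G\<^esub> z) i"
      using claim[OF i, of n] unfolding t_sum[OF good[OF g] og i] g(2) .
    thus "agree ((g \<otimes>\<^bsub>G\<^esub> u) [^]\<^bsub>G\<^esub> n) (z [^]\<^bsub>G\<^esub> k) i"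
      by (rule agree_trans) (rule step[unfolded a_pow])
  qed (use g(1) u z in auto)
  thus ?thesis using u u_orb by blast
qed

text \<open>
  Twists stay within the orbits of \<open>\<zeta>\<close>, which are contained in those of its roots; so equal
  twisted permutations come from permutations with the same orbits.
\<close>

lemma orb_subset_of_twist:
  assumes \<sigma>: "permutation \<sigma>" "\<sigma> ^^ n = \<zeta>" and \<zeta>: "permutation \<zeta>"
    and out: "\<And>i. i \<notin> X \<Longrightarrow> \<sigma>' i = i"
    and tw: "\<sigma> \<circ> \<upsilon> = \<sigma>' \<circ> \<upsilon>'" and \<upsilon>': "\<upsilon>' permutes X"
    and near: "\<And>i. i \<in> X \<Longrightarrow> \<upsilon> i \<in> orb \<zeta> i" "\<And>i. i \<in> X \<Longrightarrow> \<upsilon>' i \<in> orb \<zeta> i"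
  shows "orb \<sigma>' i \<subseteq> orb \<sigma> i"
proof -
  have fine: "orb \<zeta> j \<subseteq> orb \<sigma> j" for j
    unfolding orb_def \<sigma>(2)[symmetric] by (auto simp: funpow_mult)
  have step: "\<sigma>' j \<in> orb \<sigma> j" for j
  proof (cases "j \<in> X")
    case True
    with \<upsilon>' obtain j0 where j0: "j = \<upsilon>' j0" "j0 \<in> X"
      by (metis permutes_def permutes_in_image)
    have "\<sigma>' j = \<sigma> (\<upsilon> j0)" using fun_cong[OF tw, of j0] j0 by simp
    moreover have "\<upsilon> j0 \<in> orb \<zeta> j"
      using near j0 orb_eq_iff[OF \<zeta>] by metis
    hence "\<sigma> (\<upsilon> j0) \<in> orb \<sigma> j"
      using fine[of j] orb_eq_iff[OF \<sigma>(1)] orb_step[OF \<sigma>(1)] by (metis subsetD)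
    ultimately show ?thesis by simp
  qed (simp add: out orb_self)
  have "(\<sigma>' ^^ r) i \<in> orb \<sigma> i" for r
  proof (induction r)
    case (Suc r)
    thus ?case using step[of "(\<sigma>' ^^ r) i"] orb_eq_iff[OF \<sigma>(1)] by (metis funpow.simps(2) comp_apply)
  qed (simp add: orb_self)
  thus ?thesis by (auto simp: orb_def)
qed

text \<open>
  The element \<open>u\<close> depends on \<open>g\<close> only through the cycle partitions of \<open>g\<close> and of \<open>x\<^sup>-\<^sup>1 g\<close>. By
  \<open>orb_subset_of_twist\<close> these can be read off from \<open>g u\<close>, hence so can \<open>u\<close> and then \<open>g\<close>.
\<close>

lemma card_root_pairs_le:
  fixes k :: int
  assumes x: "x \<in> carrier G" and z: "z \<in> carrier G" and n: "n > 0"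
  shows "card (G.root_pairs n x z) \<le> card (G.root_pairs n x (z [^]\<^bsub>G\<^esub> k))"
proof -
  let ?y = "\<lambda>g. inv\<^bsub>G\<^esub> x \<otimes>\<^bsub>G\<^esub> g"
  have "\<exists>u\<in>carrier G. (\<forall>i\<in>X. fst u i \<in> orb (fst z) i) \<and>
    (\<forall>g\<in>G.root_pairs n x z. orb (fst g) = p \<and> orb (fst (?y g)) = q \<longrightarrow>
      g \<otimes>\<^bsub>G\<^esub> u \<in> G.root_pairs n x (z [^]\<^bsub>G\<^esub> k))" for p q
  proof (cases "\<exists>g\<in>G.root_pairs n x z. orb (fst g) = p \<and> orb (fst (?y g)) = q")
    case True
    then obtain g0 where g0: "g0 \<in> G.root_pairs n x z" "orb (fst g0) = p" "orb (fst (?y g0)) = q" by blast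
    have "g0 \<in> carrier G" "g0 [^]\<^bsub>G\<^esub> n = z" "?y g0 \<in> carrier G" "?y g0 [^]\<^bsub>G\<^esub> n = z"
      using g0(1) x by (auto simp: G.root_pairs_def)
    from orbit_twist[OF z n this, of k] obtain u where u: "u \<in> carrier G"
      "\<And>i. i \<in> X \<Longrightarrow> fst u i \<in> orb (fst z) i"
      "\<And>g. g \<in> carrier G \<Longrightarrow> g [^]\<^bsub>G\<^esub> n = z \<Longrightarrow> orb (fst g) = p \<or> orb (fst g) = q \<Longrightarrow>
        (g \<otimes>\<^bsub>G\<^esub> u) [^]\<^bsub>G\<^esub> n = z [^]\<^bsub>G\<^esub> k"
      unfolding g0(2,3) by blast
    have "g \<otimes>\<^bsub>G\<^esub> u \<in> G.root_pairs n x (z [^]\<^bsub>G\<^esub> k)"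
      if "g \<in> G.root_pairs n x z" "orb (fst g) = p" "orb (fst (?y g)) = q" for g
      using that u(1) u(3)[of g] u(3)[of "?y g"] x by (auto simp: G.root_pairs_def G.m_assoc)
    with u(1,2) show ?thesis by blast
  next
    case False
    thus ?thesis by (intro bexI[of _ "\<one>\<^bsub>G\<^esub>"]) (auto simp: fst_one orb_self)
  qed
  then obtain U where U: "\<And>p q. U p q \<in> carrier G" "\<And>p q i. i \<in> X \<Longrightarrow> fst (U p q) i \<in> orb (fst z) i"
    "\<And>p q g. g \<in> G.root_pairs n x z \<Longrightarrow> orb (fst g) = p \<Longrightarrow> orb (fst (?y g)) = q \<Longrightarrow>
      g \<otimes>\<^bsub>G\<^esub> U p q \<in> G.root_pairs n x (z [^]\<^bsub>G\<^esub> k)" by metis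
  define F where "F g = g \<otimes>\<^bsub>G\<^esub> U (orb (fst g)) (orb (fst (?y g)))" for g
  have pz: "permutation (fst z)" by (rule permutation_fst[OF z])
  have same_orb: "orb (fst g) = orb (fst g')"
    if g: "g \<in> carrier G" "g [^]\<^bsub>G\<^esub> n = z" and g': "g' \<in> carrier G" "g' [^]\<^bsub>G\<^esub> n = z"
      and eq: "g \<otimes>\<^bsub>G\<^esub> U p q = g' \<otimes>\<^bsub>G\<^esub> U p' q'" for g g' p q p' q'
  proof -
    have tw: "fst g \<circ> fst (U p q) = fst g' \<circ> fst (U p' q')"
      using arg_cong[OF eq, of fst] by (simp add: fst_mult U(1))
    have per: "fst (U a b) permutes X" for a b using U(1)[of a b] by (simp add: carrier_iff)
    have f: "fst g ^^ n = fst z" "fst g' ^^ n = fst z"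
      using fst_pow[OF g(1), of n] g(2) fst_pow[OF g'(1), of n] g'(2) by auto
    have out: "fst h i = i" if "h \<in> carrier G" "i \<notin> X" for h i
      using that by (auto simp: carrier_iff permutes_def)
    show ?thesis
    proof
      fix i
      show "orb (fst g) i = orb (fst g') i"
        using orb_subset_of_twist[OF permutation_fst[OF g(1)] f(1) pz out[OF g'(1)] tw per U(2) U(2)]
          orb_subset_of_twist[OF permutation_fst[OF g'(1)] f(2) pz out[OF g(1)] tw[symmetric] per U(2) U(2)]
        by blast
    qed
  qed
  have "inj_on F (G.root_pairs n x z)"
  proof (rule inj_onI)
    fix g g' assume g: "g \<in> G.root_pairs n x z" and g': "g' \<in> G.root_pairs n x z" and eq: "F g = F g'"
    have c: "g \<in> carrier G" "g' \<in> carrier G" "?y g \<in> carrier G" "?y g' \<in> carrier G"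
      using g g' x by (auto simp: G.root_pairs_def)
    have "?y g \<otimes>\<^bsub>G\<^esub> U (orb (fst g)) (orb (fst (?y g))) =
        ?y g' \<otimes>\<^bsub>G\<^esub> U (orb (fst g')) (orb (fst (?y g')))"
      using eq c x U(1) by (simp add: F_def G.m_assoc)
    hence "orb (fst (?y g)) = orb (fst (?y g'))"
      using g g' c by (intro same_orb) (auto simp: G.root_pairs_def)
    moreover have "orb (fst g) = orb (fst g')"
      using eq g g' c by (intro same_orb[where g = g and g' = g']) (auto simp: G.root_pairs_def F_def)
    ultimately show "g = g'" using eq c U(1) by (simp add: F_def)
  qed
  moreover have "F ` G.root_pairs n x z \<subseteq> G.root_pairs n x (z [^]\<^bsub>G\<^esub> k)"
    using U(3) by (auto simp: F_def)
  moreover have "finite (G.root_pairs n x (z [^]\<^bsub>G\<^esub> k))"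
    using finite_carrier by (simp add: G.root_pairs_def)
  ultimately show ?thesis by (rule card_inj_on_le)
qed

text \<open>
  Two generators of a cyclic group are powers of each other.
\<close>

lemma card_root_pairs_generator:
  assumes x: "x \<in> carrier G" and z: "z \<in> carrier G" and z': "z' \<in> carrier G" and n: "n > 0"
    and gen: "generate G {z} = generate G {z'}"
  shows "card (G.root_pairs n x z) = card (G.root_pairs n x z')"
proof -
  have "z' \<in> generate G {z}" "z \<in> generate G {z'}" using gen by (auto intro: generate.incl)
  then obtain k k' :: int where "z' = z [^]\<^bsub>G\<^esub> k" "z = z' [^]\<^bsub>G\<^esub> k'"
    using G.generate_pow[OF z] G.generate_pow[OF z'] by auto
  thus ?thesis
    using card_root_pairs_le[OF x z n, of k] card_root_pairs_le[OF x z' n, of k'] by auto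
qed

end

section \<open>From Hopf modules to matrices\<close>

context hopf_module
begin

lemma zero_in_elems: "(\<lambda>_. 0) \<in> hopf_elems H"
  by (simp add: hopf_elems_def)

lemma action_zero: "\<rho> (\<lambda>_. 0) v = 0"
  using action_scale[OF zero_in_elems, of 0 v] by simp

lemma sum_in_elems:
  assumes "\<And>k. k \<in> K \<Longrightarrow> f k \<in> hopf_elems H"
  shows "(\<lambda>b. \<Sum>k\<in>K. c k * f k b) \<in> hopf_elems H"
  using assms by (auto simp: hopf_elems_def intro!: sum.neutral)

lemma action_sum:
  assumes "\<And>k. k \<in> K \<Longrightarrow> f k \<in> hopf_elems H"
  shows "\<rho> (\<lambda>b. \<Sum>k\<in>K. c k * f k b) v = (\<Sum>k\<in>K. scale (c k) (\<rho> (f k) v))"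
  using assms
proof (induction K rule: infinite_finite_induct)
  case (insert k K)
  have split: "(\<lambda>b. \<Sum>k\<in>insert k K. c k * f k b) = (\<lambda>b. c k * f k b + (\<Sum>k\<in>K. c k * f k b))"
    using insert by simp
  have "\<rho> (\<lambda>b. c k * f k b + (\<Sum>k\<in>K. c k * f k b)) v =
      \<rho> (\<lambda>b. c k * f k b) v + \<rho> (\<lambda>b. \<Sum>k\<in>K. c k * f k b) v"
    using insert sum_in_elems[of "{k}" f c] sum_in_elems[of K f c] by (intro action_add) auto
  thus ?case unfolding split using insert by (simp add: action_scale)
qed (simp_all add: action_zero)

lemma basis_elem_in: "b \<in> hopf_basis H \<Longrightarrow> basis_elem b \<in> hopf_elems H"
  by (auto simp: hopf_elems_def basis_elem_def)

lemma hopf_mult_in: "hopf_mult H u w \<in> hopf_elems H"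
  by (simp add: hopf_elems_def hopf_mult_def)

lemma hopf_one_in: "hopf_one H \<in> hopf_elems H"
  by (simp add: hopf_elems_def hopf_one_def)

lemma action_expand:
  assumes "finite (hopf_basis H)" "u \<in> hopf_elems H"
  shows "\<rho> u v = (\<Sum>b\<in>hopf_basis H. scale (u b) (\<rho> (basis_elem b) v))"
proof -
  have "u = (\<lambda>c. \<Sum>b\<in>hopf_basis H. u b * basis_elem b c)"
    using assms by (auto simp: basis_elem_def hopf_elems_def fun_eq_iff if_distrib[of "\<lambda>x. _ * x"]
        sum.delta' cong: if_cong)
  hence "\<rho> u v = \<rho> (\<lambda>c. \<Sum>b\<in>hopf_basis H. u b * basis_elem b c) v" by simp
  also have "\<dots> = (\<Sum>b\<in>hopf_basis H. scale (u b) (\<rho> (basis_elem b) v))"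
    by (rule action_sum) (rule basis_elem_in)
  finally show ?thesis .
qed

lemma action_sum_vector:
  assumes "u \<in> hopf_elems H"
  shows "\<rho> u (\<Sum>k\<in>K. scale (c k) (f k)) = (\<Sum>k\<in>K. scale (c k) (\<rho> u (f k)))"
proof -
  interpret f: Vector_Spaces.linear scale scale "\<rho> u" by (rule action_linear[OF assms])
  show ?thesis by (simp add: f.sum f.scale)
qed

end

text \<open>
  The basis is a parameter because the trace is taken over one that is obtained by choice.
\<close>

locale based_hopf_module = hopf_module H scale \<rho>
  for H :: "'b hopf_data" and scale :: "complex \<Rightarrow> 'v::ab_group_add \<Rightarrow> 'v"
    and \<rho> :: "('b \<Rightarrow> complex) \<Rightarrow> 'v \<Rightarrow> 'v" +
  fixes B :: "'v set"
  assumes finite_basis: "finite B" and indep: "independent B" and span: "span B = UNIV"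
    and finite_hopf_basis: "finite (hopf_basis H)"
begin

definition mat_of :: "('b \<Rightarrow> complex) \<Rightarrow> 'v \<Rightarrow> 'v \<Rightarrow> complex" where
  "mat_of u = (\<lambda>i j. representation B (\<rho> u j) i)"

lemma mat_of_sum:
  assumes "\<And>k. k \<in> K \<Longrightarrow> f k \<in> hopf_elems H"
  shows "mat_of (\<lambda>b. \<Sum>k\<in>K. c k * f k b) i j = (\<Sum>k\<in>K. c k * mat_of (f k) i j)"
proof -
  have "\<rho> (\<lambda>b. \<Sum>k\<in>K. c k * f k b) j = (\<Sum>k\<in>K. scale (c k) (\<rho> (f k) j))"
    by (rule action_sum) (rule assms)
  thus ?thesis
    by (simp add: mat_of_def representation_sum[OF indep] representation_scale[OF indep] span)
qed

lemma mat_of_mult: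
  assumes "u \<in> hopf_elems H" "w \<in> hopf_elems H"
  shows "mat_of (hopf_mult H u w) i j = matmul B (mat_of u) (mat_of w) i j"
proof -
  have "\<rho> w j = (\<Sum>k\<in>B. scale (representation B (\<rho> w j) k) k)"
    by (rule sum_representation_eq[symmetric, OF indep]) (simp_all add: span finite_basis)
  hence "\<rho> u (\<rho> w j) = (\<Sum>k\<in>B. scale (representation B (\<rho> w j) k) (\<rho> u k))"
    using action_sum_vector[OF assms(1), of "representation B (\<rho> w j)" "\<lambda>k. k" B] by simp
  thus ?thesis
    by (simp add: mat_of_def matmul_def action_mult[OF assms] representation_sum[OF indep]
        representation_scale[OF indep] span mult.commute)
qed

lemma mat_of_one: "j \<in> B \<Longrightarrow> mat_of (hopf_one H) i j = (if i = j then 1 else 0)"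
  by (simp add: mat_of_def action_one representation_basis[OF indep])

lemma foldr_mult_in: "foldr (hopf_mult H) us (hopf_one H) \<in> hopf_elems H"
  by (cases us) (simp_all add: hopf_one_in hopf_mult_in)

lemma mat_of_foldr:
  assumes "set us \<subseteq> hopf_elems H" "j \<in> B"
  shows "mat_of (foldr (hopf_mult H) us (hopf_one H)) i j = matprod B (map mat_of us) i j"
  using assms(1)
proof (induction us arbitrary: i)
  case Nil
  thus ?case using assms(2) by (simp add: mat_of_one matprod_def)
next
  case (Cons u us)
  thus ?case
    by (simp add: mat_of_mult foldr_mult_in matmul_def matprod_Cons)
qed

lemma trace_tensor_mult:
  "mattrace B (mat_of (tensor_mult H n t)) =
    (\<Sum>bs\<in>words (hopf_basis H) n. t bs * mattrace B (matprod B (map (\<lambda>b. mat_of (basis_elem b)) bs)))"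
proof -
  have "tensor_mult H n t = (\<lambda>d. \<Sum>bs\<in>words (hopf_basis H) n.
      t bs * foldr (hopf_mult H) (map basis_elem bs) (hopf_one H) d)"
    by (simp add: tensor_mult_def words_def)
  hence "mat_of (tensor_mult H n t) i j = (\<Sum>bs\<in>words (hopf_basis H) n.
      t bs * mat_of (foldr (hopf_mult H) (map basis_elem bs) (hopf_one H)) i j)" for i j
    by (simp add: mat_of_sum foldr_mult_in)
  moreover have "mat_of (foldr (hopf_mult H) (map basis_elem bs) (hopf_one H)) i j =
      matprod B (map (\<lambda>b. mat_of (basis_elem b)) bs) i j"
    if "bs \<in> words (hopf_basis H) n" "j \<in> B" for bs i j
    using that by (subst mat_of_foldr) (auto simp: words_def basis_elem_in o_def)
  ultimately have "mattrace B (mat_of (tensor_mult H n t)) = (\<Sum>i\<in>B. \<Sum>bs\<in>words (hopf_basis H) n.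
      t bs * matprod B (map (\<lambda>b. mat_of (basis_elem b)) bs) i i)"
    by (simp add: mattrace_def)
  also have "\<dots> = (\<Sum>bs\<in>words (hopf_basis H) n. \<Sum>i\<in>B.
      t bs * matprod B (map (\<lambda>b. mat_of (basis_elem b)) bs) i i)" by (rule sum.swap)
  finally show ?thesis by (simp add: mattrace_def sum_distrib_left)
qed

end

text \<open>
  An irreducible module is spanned by the finitely many images of one nonzero vector under the
  basis of the algebra, so every basis of it is finite.
\<close>

lemma (in irreducible_hopf_module) based:
  assumes fin: "finite (hopf_basis H)"
  defines "B \<equiv> SOME B. independent B \<and> span B = UNIV"
  shows "based_hopf_module H scale \<rho> B"
proof -
  obtain v :: 'v where v: "v \<noteq> 0" using nonzero by blast
  define T where "T = (\<lambda>b. \<rho> (basis_elem b) v) ` hopf_basis H"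
  have orbit: "\<rho> u v \<in> span T" if "u \<in> hopf_elems H" for u
    unfolding action_expand[OF fin that] T_def
    by (intro span_sum span_scale span_base imageI)
  have closed: "\<rho> u w \<in> span T" if u: "u \<in> hopf_elems H" and w: "w \<in> span T" for u w
  proof -
    interpret f: Vector_Spaces.linear scale scale "\<rho> u" by (rule action_linear[OF u])
    have gen: "\<rho> u t \<in> span T" if "t \<in> T" for t
      using that orbit[OF hopf_mult_in] u
      by (auto simp: T_def action_mult[symmetric] basis_elem_in)
    from w show ?thesis
      by (induction rule: span_induct_alt) (auto simp: gen f.zero f.add f.scale span_zero span_add span_scale)
  qed
  have "v \<in> span T" using orbit[OF hopf_one_in] by (simp add: action_one)
  with v irreducible[OF subspace_span closed] have T: "span T = UNIV" by blast
  have "\<exists>B. independent B \<and> span B = UNIV"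
    using maximal_independent_subset[of UNIV] by (metis subset_UNIV top.extremum_uniqueI)
  hence B: "independent B" "span B = UNIV"
    using someI_ex[of "\<lambda>B. independent B \<and> span B = UNIV"] by (auto simp: B_def)
  have "finite B"
    using independent_span_bound[of T B] B T fin by (simp add: T_def)
  with B fin show ?thesis by unfold_locales auto
qed

lemma (in irreducible_hopf_module) fs_indicator_eq_trace:
  defines "B \<equiv> SOME B. independent B \<and> span B = UNIV"
  assumes "based_hopf_module H scale \<rho> B"
  shows "fs_indicator H scale \<rho> n = mattrace B (based_hopf_module.mat_of scale \<rho> B
    (tensor_mult H n (iterated_comult H n (hopf_integral H))))"
  using assms(2) unfolding fs_indicator_def lin_trace_def Let_def mattrace_def B_def
  by (simp add: based_hopf_module.mat_of_def)

context group
begin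

abbreviation D where "D \<equiv> quantum_double G"

lemma hopf_basis_double: "hopf_basis D = carrier G \<times> carrier G"
  by (simp add: quantum_double_def)

lemma double_basis_mult:
  assumes fin: "finite (carrier G)" and c: "g \<in> carrier G" "x \<in> carrier G" "h \<in> carrier G" "y \<in> carrier G"
  shows "hopf_mult D (basis_elem (g, x)) (basis_elem (h, y)) =
    (\<lambda>d. (if x = h \<otimes> y \<otimes> inv h then 1 else 0) * basis_elem (g \<otimes> h, y) d)"
proof
  fix d
  have iff: "inv h \<otimes> x \<otimes> h = y \<longleftrightarrow> x = h \<otimes> y \<otimes> inv h"
    using c by (metis inv_closed inv_solve_left inv_solve_right m_assoc m_closed)
  let ?B = "carrier G \<times> carrier G"
  have "(\<Sum>b\<in>?B. \<Sum>e\<in>?B. basis_elem (g, x) b * basis_elem (h, y) e * mult_coeff D b e d) =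
      (\<Sum>b\<in>?B. if b = (g, x) then (\<Sum>e\<in>?B. if e = (h, y) then mult_coeff D b e d else 0) else 0)"
    by (intro sum.cong refl) (auto simp: basis_elem_def intro!: sum.cong)
  also have "\<dots> = mult_coeff D (g, x) (h, y) d"
    using fin c by (simp add: sum.delta)
  also have "\<dots> = (if x = h \<otimes> y \<otimes> inv h then 1 else 0) * basis_elem (g \<otimes> h, y) d"
    by (cases d) (auto simp: quantum_double_def basis_elem_def iff)
  finally show "hopf_mult D (basis_elem (g, x)) (basis_elem (h, y)) d =
      (if x = h \<otimes> y \<otimes> inv h then 1 else 0) * basis_elem (g \<otimes> h, y) d"
    using c by (auto simp: hopf_mult_def hopf_basis_double basis_elem_def)
qed

text \<open>
  In the recursion, a term \<open>g \<delta>\<^sub>x \<otimes> g \<delta>\<^sub>y\<close> arises only from \<open>\<Delta>(g \<delta>\<^bsub>x y\<^esub>)\<close>, so at each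
  step exactly one summand remains.
\<close>

lemma double_iterated_comult:
  assumes fin: "finite (carrier G)" and bs: "length bs = Suc m" "set bs \<subseteq> carrier G \<times> carrier G"
  shows "iterated_comult D (Suc m) (hopf_integral D) bs =
    (if (\<forall>b\<in>set bs. fst b = fst (hd bs)) \<and> lprod (map snd bs) = \<one>
     then 1 / of_nat (card (carrier G)) else 0)"
  using bs
proof (induction m arbitrary: bs)
  case 0
  then obtain g x where "bs = [(g, x)]" "g \<in> carrier G" "x \<in> carrier G"
    by (auto simp: length_Suc_conv)
  thus ?case by (simp add: lprod_simps quantum_double_integral(2)[OF group_axioms fin])
next
  case (Suc m)
  then obtain g x h y bs' where bs: "bs = (g, x) # (h, y) # bs'" "length bs' = m"
    and c: "g \<in> carrier G" "x \<in> carrier G" "h \<in> carrier G" "y \<in> carrier G" "set bs' \<subseteq> carrier G \<times> carrier G"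
    by (auto simp: length_Suc_conv)
  have cl: "lprod (map snd bs') \<in> carrier G" using c(5) by (intro lprod_closed) auto
  let ?it = "iterated_comult D (Suc m) (hopf_integral D)"
  have "iterated_comult D (Suc (Suc m)) (hopf_integral D) bs =
      (\<Sum>d\<in>carrier G \<times> carrier G. ?it (d # bs') * comult_coeff D d (g, x) (h, y))"
    by (simp add: bs(1) hopf_basis_double)
  also have "\<dots> = (\<Sum>d\<in>carrier G \<times> carrier G. if d = (g, x \<otimes> y) then (if h = g then ?it (d # bs') else 0) else 0)"
  proof (rule sum.cong[OF refl])
    fix d
    have "comult_coeff D d (g, x) (h, y) = (if d = (g, x \<otimes> y) \<and> h = g then 1 else 0)"
      by (cases d) (auto simp: quantum_double_def)
    thus "?it (d # bs') * comult_coeff D d (g, x) (h, y) =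
        (if d = (g, x \<otimes> y) then (if h = g then ?it (d # bs') else 0) else 0)" by simp
  qed
  also have "\<dots> = (if h = g then ?it ((g, x \<otimes> y) # bs') else 0)"
    using fin c by (simp add: sum.delta)
  also have "?it ((g, x \<otimes> y) # bs') = (if (\<forall>b\<in>set bs'. fst b = g) \<and> x \<otimes> y \<otimes> lprod (map snd bs') = \<one>
     then 1 / of_nat (card (carrier G)) else 0)"
    using c bs(2) by (subst Suc.IH) (auto simp: lprod_simps)
  also have "x \<otimes> y \<otimes> lprod (map snd bs') = x \<otimes> (y \<otimes> lprod (map snd bs'))"
    using c cl by (simp add: m_assoc)
  finally show ?case by (auto simp: bs(1) lprod_simps)
qed

lemma double_module_matrices:
  assumes fin: "finite (carrier G)" and "based_hopf_module D scale \<rho> B"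
  shows "double_matrices G B (\<lambda>b. based_hopf_module.mat_of scale \<rho> B (basis_elem b))"
proof -
  interpret based_hopf_module D scale \<rho> B by fact
  show ?thesis
  proof unfold_locales
    fix g x h y i j
    assume c: "g \<in> carrier G" "x \<in> carrier G" "h \<in> carrier G" "y \<in> carrier G"
    have "matmul B (mat_of (basis_elem (g, x))) (mat_of (basis_elem (h, y))) i j =
        mat_of (hopf_mult D (basis_elem (g, x)) (basis_elem (h, y))) i j"
      using c by (intro mat_of_mult[symmetric] basis_elem_in) (auto simp: hopf_basis_double)
    also have "\<dots> = (if x = h \<otimes> y \<otimes> inv h then 1 else 0) * mat_of (basis_elem (g \<otimes> h, y)) i j"
      unfolding double_basis_mult[OF fin c]
      using mat_of_sum[of "{()}" "\<lambda>_. basis_elem (g \<otimes> h, y)" "\<lambda>_. if x = h \<otimes> y \<otimes> inv h then 1 else 0" i j] c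
      by (simp add: basis_elem_in hopf_basis_double)
    finally show "matmul B (mat_of (basis_elem (g, x))) (mat_of (basis_elem (h, y))) i j =
        (if x = h \<otimes> y \<otimes> inv h then mat_of (basis_elem (g \<otimes> h, y)) i j else 0)" by simp
  qed (use fin finite_basis in auto)
qed

text \<open>
  The nonzero terms of \<open>\<Delta>\<^sub>n(\<Lambda>)\<close> are indexed by a group element \<open>g\<close> and a word with product \<open>1\<close>, which
  turns the indicator into \<open>indicator_sum\<close> for the matrices of the basis elements.
\<close>

theorem double_indicator_Ints:
  assumes fin: "finite (carrier G)" and irr: "irreducible_hopf_module D scale \<rho>" and n: "n > 0"
    and inv: "\<And>x z z'. x \<in> carrier G \<Longrightarrow> z \<in> carrier G \<Longrightarrow> z' \<in> carrier G \<Longrightarrow>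
      generate G {z} = generate G {z'} \<Longrightarrow> card (root_pairs n x z) = card (root_pairs n x z')"
  shows "fs_indicator D scale \<rho> n \<in> \<int>"
proof -
  interpret irreducible_hopf_module D scale \<rho> by fact
  define B where "B = (SOME B. independent B \<and> span B = UNIV)"
  have based: "based_hopf_module D scale \<rho> B"
    unfolding B_def using fin by (intro based) (simp add: hopf_basis_double)
  interpret based_hopf_module D scale \<rho> B by (rule based)
  define R where "R = (\<lambda>b. mat_of (basis_elem b))"
  interpret R: double_matrices G B R
    unfolding R_def by (rule double_module_matrices[OF fin based])
  let ?C = "carrier G" and ?t = "iterated_comult D n (hopf_integral D)"
  let ?F = "\<lambda>bs. mattrace B (matprod B (map R bs))"
  let ?W = "words (?C \<times> ?C) n"
  let ?S = "{bs \<in> ?W. (\<forall>b\<in>set bs. fst b = fst (hd bs)) \<and> lprod (map snd bs) = \<one>}"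
  obtain m where m: "n = Suc m" using n by (cases n) auto
  have "fs_indicator D scale \<rho> n = (\<Sum>bs\<in>?W. ?t bs * ?F bs)"
    using fs_indicator_eq_trace[of n] based unfolding B_def[symmetric]
    by (simp add: trace_tensor_mult hopf_basis_double R_def)
  also have "\<dots> = (\<Sum>bs\<in>?W. if (\<forall>b\<in>set bs. fst b = fst (hd bs)) \<and> lprod (map snd bs) = \<one>
      then ?F bs / R.cardG else 0)"
    by (intro sum.cong refl) (auto simp: words_def m double_iterated_comult[OF fin] simp del: iterated_comult.simps)
  also have "\<dots> = (\<Sum>bs\<in>?S. ?F bs / R.cardG)"
    using fin by (intro sum.inter_filter[symmetric]) (simp add: finite_words)
  also have "\<dots> = (\<Sum>(g, xs)\<in>?C \<times> closed_words n. ?F (map (Pair g) xs) / R.cardG)"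
  proof (rule sum.reindex_bij_witness[of _ "\<lambda>(g, xs). map (Pair g) xs" "\<lambda>bs. (fst (hd bs), map snd bs)"])
    fix bs assume bs: "bs \<in> ?S"
    hence "map (\<lambda>b. (fst (hd bs), snd b)) bs = map (\<lambda>b. b) bs"
      by (intro map_cong refl) (metis (mono_tags, lifting) mem_Collect_eq prod.collapse)
    thus eq: "(case (fst (hd bs), map snd bs) of (g, xs) \<Rightarrow> map (Pair g) xs) = bs"
      by (simp add: o_def)
    thus "(case (fst (hd bs), map snd bs) of (g, xs) \<Rightarrow> ?F (map (Pair g) xs) / R.cardG) = ?F bs / R.cardG"
      by (simp only: prod.case)
    have "hd bs \<in> set bs" using bs m by (intro hd_in_set) (auto simp: words_def)
    moreover have sub: "set bs \<subseteq> ?C \<times> ?C" and props: "length bs = n" "lprod (map snd bs) = \<one>"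
      using bs by (simp_all add: words_def)
    ultimately have "hd bs \<in> ?C \<times> ?C" by blast
    thus "(fst (hd bs), map snd bs) \<in> ?C \<times> closed_words n"
      using sub props by (auto simp: words_def closed_words_def)
  next
    fix p assume p: "p \<in> ?C \<times> closed_words n"
    then obtain g xs where gx: "p = (g, xs)" "g \<in> ?C" "xs \<in> closed_words n" by blast
    hence "xs \<noteq> []" using m by (auto simp: closed_words_def words_def)
    thus "(fst (hd (case p of (g, xs) \<Rightarrow> map (Pair g) xs)), map snd (case p of (g, xs) \<Rightarrow> map (Pair g) xs)) = p"
      "(case p of (g, xs) \<Rightarrow> map (Pair g) xs) \<in> ?S"
      using gx by (auto simp: hd_map o_def closed_words_def words_def)
  qed
  also have "\<dots> = R.indicator_sum n"
    unfolding R.indicator_sum_def sum_divide_distrib sum.cartesian_product[symmetric]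
    by (simp add: o_def)
  also have "\<dots> \<in> \<int>" by (rule R.indicator_sum_Ints[OF n]) (rule inv)
  finally show ?thesis .
qed

end

theorem theorem2p1:
  fixes A :: "('a, 'm) monoid_scheme"
    and N n :: nat
    and scale :: "complex \<Rightarrow> 'v::ab_group_add \<Rightarrow> 'v"
    and \<rho> :: "(((nat \<Rightarrow> nat) \<times> (nat \<Rightarrow> 'a)) \<times> ((nat \<Rightarrow> nat) \<times> (nat \<Rightarrow> 'a)) \<Rightarrow> complex) \<Rightarrow> 'v \<Rightarrow> 'v"
  assumes "comm_group A" and "finite (carrier A)"
    and "N \<ge> 1"
    and "irreducible_hopf_module (quantum_double (wreath_product N A)) scale \<rho>"
    and "n \<ge> 1"
  shows "fs_indicator (quantum_double (wreath_product N A)) scale \<rho> n \<in> \<int>"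
proof -
  interpret abelian_wreath A N
    using assms(1,2) by (intro abelian_wreath.intro abelian_wreath_axioms.intro)
  have n: "n > 0" using assms(5) by simp
  show ?thesis
    by (rule G.double_indicator_Ints[OF finite_carrier assms(4) n])
      (rule card_root_pairs_generator[OF _ _ _ n])
qed

end
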